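(* Let $n\ge m\ge 2$ be integers and let $\Gamma$ be a discrete subgroup of $\mathrm{SO}_+(m,1)$ acting on $\mathbb{H}_{\mathbb{R}}^m$ whose limit set is the whole sphere $\mathbb{S}^{m-1}$. Let $\Omega\subset\mathbb{P}_{\mathbb{C}}^n$ be the Kulkarni discontinuity region of $\iota(\Gamma)$ acting on $\mathbb{P}_{\mathbb{C}}^n$. Then: (i) if $m=2$, $\Omega$ has exactly three connected components; (ii) if $m>2$, $\Omega$ is connected.
   Context: $\mathbb{C}^{n,1}$ is $\mathbb{C}^{n+1}$ with the Hermitian form $\langle \mathbf{z},\mathbf{w}\rangle=z_1\overline{w_1}+\cdots+z_n\overline{w_n}-z_{n+1}\overline{w_{n+1}}$, and $\mathbb{P}_{\mathbb{C}}^n$ is its projectivization. $\mathbb{H}_{\mathbb{C}}^n=\{[\mathbf z]:\langle\mathbf z,\mathbf z\rangle<0\}$, $\partial\mathbb{H}_{\mathbb{C}}^n=\{[\mathbf z]:\langle\mathbf z,\mathbf z\rangle=0\}$. $\mathrm{SO}_+(m,1)$ is the group of real $(m+1)\times(m+1)$ matrices giving the orientation preserving isometries of real hyperbolic space $\mathbb{H}_{\mathbb{R}}^m$ (negative vectors of $\mathbb{R}^{m,1}$, projectivized), with sphere at infinity $\mathbb{S}^{m-1}$; the limit set of a discrete subgroup $\Gamma$ is the set of accumulation points in $\mathbb{S}^{m-1}$ of an orbit $\Gamma\cdot\mathbf z$, $\mathbf z\in\mathbb{H}_{\mathbb{R}}^m$. The embedding $\iota:\mathrm{SO}_+(m,1)\to\mathrm{SU}(n,1)$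 is $$\begin{pmatrix}A&\mathbf b\\ \mathbf c&d\end{pmatrix}\mapsto\begin{pmatrix}A&0&\mathbf b\\0&I&0\\ \mathbf c&0&d\end{pmatrix},$$ where $A$ is $m\times m$, $\mathbf b$ is a column and $\mathbf c$ a row of size $m$, $d$ is $1\times1$, and $I$ is the identity of size $(n-m)\times(n-m)$. Matrices act projectively on $\mathbb{P}_{\mathbb{C}}^n$. Kulkarni limit set: for a discrete group $G$ acting on $X=\mathbb{P}_{\mathbb{C}}^n$, let $L_0$ be the closure of the set of points with infinite isotropy group, $L_1$ the closure of the set of cluster points of orbits $Gz$, $z\in X\setminus L_0$, and $L_2$ the closure of the set of cluster points of the families $\{gK\}_{g\in G}$, $K$ ranging over compact subsets of $X\setminus(L_0\cup L_1)$. The Kulkarni limit set is $\Lambda_{Kul}(G)=L_0\cup L_1\cup L_2$ and the Kulkarni discontinuity region is $X\setminus\Lambda_{Kul}(G)$. By a known result of Cano, Liu and López, for the groups considered here $\Lambda_{Kul}(\iota(\Gamma))=\bigcup_{p\in\mathcal S}H_p$, where $\mathcal S$ is the real $(m-1)$-sphere of points $[w_1:\cdots:w_m:0:\cdots:0:w_{n+1}]$ with all $w_j$ real and $w_1^2+\cdots+w_m^2=w_{n+1}^2$, and $H_p=\{[\mathbf w]\in\mathbb{P}_{\mathbb{C}}^n:\langle\mathbf p,\mathbf w\rangle=0\}$ is the complex projective hyperplane tangent to $\partial\mathbb{H}_{\mathbb{C}}^n$ at $p=[\mathbf p]$. *)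

theory Defs
  imports
    "HOL-Analysis.Abstract_Topology_2"
    "HOL-Analysis.Product_Topology"
    "HOL-Analysis.Function_Topology"
    "Jordan_Normal_Form.Determinant"
begin

section \<open>Coordinate topologies\<close>

text \<open>
  All dimensions are natural numbers; coordinates are numbered from \<open>0\<close>, so that the
  coordinates \<open>z_1, \<dots>, z_(n+1)\<close> of the literature are \<open>z $ 0, \<dots>, z $ n\<close>. Vectors and matrices
  carry the product topology of their entries.
\<close>

definition vec_topology :: "nat \<Rightarrow> 'a::topological_space vec topology" where
  "vec_topology N = pullback_topology (carrier_vec N) (\<lambda>v. restrict (vec_index v) {..<N})
     (product_topology (\<lambda>_. euclidean) {..<N})"

definition mat_topology :: "nat \<Rightarrow> nat \<Rightarrow> 'a::topological_space mat topology" where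
  "mat_topology N M = pullback_topology (carrier_mat N M)
     (\<lambda>A. restrict (index_mat A) ({..<N} \<times> {..<M}))
     (product_topology (\<lambda>_. euclidean) ({..<N} \<times> {..<M}))"

definition discrete_matrices :: "nat \<Rightarrow> 'a::topological_space mat set \<Rightarrow> bool" where
  "discrete_matrices N G \<longleftrightarrow> subtopology (mat_topology N N) G = discrete_topology G"


section \<open>Projective space\<close>

definition nonzero_vecs :: "nat \<Rightarrow> 'a::field vec set" where
  "nonzero_vecs N = carrier_vec N - {0\<^sub>v N}"

definition proj_pt :: "'a::field vec \<Rightarrow> 'a vec set" where
  "proj_pt v = {c \<cdot>\<^sub>v v | c. c \<noteq> 0}"

text \<open>The \<open>n\<close>-dimensional projective space (lines in dimension \<open>n + 1\<close>), with the quotient topology.\<close>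

definition proj_open :: "nat \<Rightarrow> 'a::{field, topological_space} vec set set \<Rightarrow> bool" where
  "proj_open n U \<longleftrightarrow> U \<subseteq> proj_pt ` nonzero_vecs (n + 1) \<and>
     openin (subtopology (vec_topology (n + 1)) (nonzero_vecs (n + 1)))
       {v \<in> nonzero_vecs (n + 1). proj_pt v \<in> U}"

definition proj_space :: "nat \<Rightarrow> 'a::{field, topological_space} vec set topology" where
  "proj_space n = topology (proj_open n)"

lemma topspace_vec_topology [simp]: "topspace (vec_topology N) = carrier_vec N"
  by (auto simp: vec_topology_def topspace_pullback_topology)

lemma istopology_proj_open: "istopology (proj_open n)"
proof -
  let ?V = "nonzero_vecs (n + 1) :: 'a vec set"
  let ?T = "subtopology (vec_topology (n + 1)) ?V"
  have inter: "proj_open n (S \<inter> T)" if "proj_open n S" "proj_open n T"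
    for S T :: "'a vec set set"
  proof -
    have "{v \<in> ?V. proj_pt v \<in> S \<inter> T} = {v \<in> ?V. proj_pt v \<in> S} \<inter> {v \<in> ?V. proj_pt v \<in> T}"
      by auto
    then show ?thesis using that by (auto simp: proj_open_def)
  qed
  have union: "proj_open n (\<Union>\<K>)" if "\<forall>K\<in>\<K>. proj_open n K" for \<K> :: "'a vec set set set"
  proof -
    have "{v \<in> ?V. proj_pt v \<in> \<Union>\<K>} = (\<Union>K\<in>\<K>. {v \<in> ?V. proj_pt v \<in> K})"
      by auto
    moreover have "openin ?T (\<Union>K\<in>\<K>. {v \<in> ?V. proj_pt v \<in> K})"
      using that by (intro openin_Union) (auto simp: proj_open_def)
    ultimately show ?thesis using that by (auto simp: proj_open_def)
  qed
  show ?thesis unfolding istopology_def using inter union by blast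
qed

lemma openin_proj_space: "openin (proj_space n) U \<longleftrightarrow> proj_open n U"
  by (simp add: proj_space_def istopology_proj_open)

lemma topspace_proj_space: "topspace (proj_space n) = proj_pt ` nonzero_vecs (n + 1)"
proof -
  have "proj_open n (proj_pt ` nonzero_vecs (n + 1) :: 'a vec set set)"
  proof -
    have "{v \<in> nonzero_vecs (n + 1). proj_pt v \<in> proj_pt ` nonzero_vecs (n + 1)}
        = (nonzero_vecs (n + 1) :: 'a vec set)" by auto
    moreover have "openin (subtopology (vec_topology (n + 1)) (nonzero_vecs (n + 1)))
        (nonzero_vecs (n + 1) :: 'a vec set)"
      by (subst openin_subtopology) (auto simp: nonzero_vecs_def intro!: exI[of _ "carrier_vec (n+1)"]
        openin_topspace[of "vec_topology (n + 1)", simplified])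
    ultimately show ?thesis by (simp add: proj_open_def)
  qed
  then have "(proj_pt ` nonzero_vecs (n + 1) :: 'a vec set set) \<subseteq> topspace (proj_space n)"
    by (metis openin_proj_space openin_subset)
  moreover have "topspace (proj_space n) \<subseteq> (proj_pt ` nonzero_vecs (n + 1) :: 'a vec set set)"
    by (metis openin_proj_space openin_topspace proj_open_def)
  ultimately show ?thesis by blast
qed

lemma quotient_map_proj_pt:
  "quotient_map (subtopology (vec_topology (n + 1)) (nonzero_vecs (n + 1)))
     (proj_space n) proj_pt"
proof -
  have "topspace (subtopology (vec_topology (n + 1)) (nonzero_vecs (n + 1)))
      = (nonzero_vecs (n + 1) :: 'a vec set)"
    by (auto simp: nonzero_vecs_def)
  then show ?thesis
    by (simp only: quotient_map_def topspace_proj_space openin_proj_space) (auto simp: proj_open_def)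
qed

definition proj_act :: "'a::field mat \<Rightarrow> 'a vec set \<Rightarrow> 'a vec set" where
  "proj_act A p = (\<lambda>v. A *\<^sub>v v) ` p"


section \<open>Real hyperbolic space\<close>

definition lorentz :: "nat \<Rightarrow> real vec \<Rightarrow> real vec \<Rightarrow> real" where
  "lorentz m v w = (\<Sum>i<m. v $ i * w $ i) - v $ m * w $ m"

definition hyp_space :: "nat \<Rightarrow> real vec set set" where
  "hyp_space m = proj_pt ` {v \<in> nonzero_vecs (m + 1). lorentz m v v < 0}"

definition sphere_at_infinity :: "nat \<Rightarrow> real vec set set" where
  "sphere_at_infinity m = proj_pt ` {v \<in> nonzero_vecs (m + 1). lorentz m v v = 0}"

text \<open>
  Among the matrices preserving the form, those with positive last diagonal entry are those that
  preserve the upper sheet of the hyperboloid; for these, determinant \<open>1\<close> says that the induced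
  isometry preserves orientation.
\<close>

definition SO_plus :: "nat \<Rightarrow> real mat monoid" where
  "SO_plus m =
     \<lparr>carrier = {A \<in> carrier_mat (m + 1) (m + 1).
         (\<forall>v\<in>carrier_vec (m + 1). \<forall>w\<in>carrier_vec (m + 1).
            lorentz m (A *\<^sub>v v) (A *\<^sub>v w) = lorentz m v w) \<and>
         Determinant.det A = 1 \<and> A $$ (m, m) > 0},
      mult = (*), one = 1\<^sub>m (m + 1)\<rparr>"

text \<open>
  The accumulation points of an orbit do not depend on the orbit for discrete groups;
  taking the union over all base points avoids choosing one.
\<close>

definition limit_set :: "nat \<Rightarrow> real mat set \<Rightarrow> real vec set set" where
  "limit_set m G = sphere_at_infinity m \<inter>
     (\<Union>z\<in>hyp_space m. proj_space m derived_set_of ((\<lambda>A. proj_act A z) ` G))"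


section \<open>The embedding\<close>

definition iota :: "nat \<Rightarrow> nat \<Rightarrow> real mat \<Rightarrow> complex mat" where
  "iota m n B = (case split_block (map_mat complex_of_real B) m m of (A, b, c, d) \<Rightarrow>
     four_block_mat
       (four_block_mat A (0\<^sub>m m (n - m)) (0\<^sub>m (n - m) m) (1\<^sub>m (n - m)))
       (b @\<^sub>r 0\<^sub>m (n - m) 1)
       (four_block_mat c (0\<^sub>m 1 (n - m)) (0\<^sub>m 0 m) (0\<^sub>m 0 (n - m)))
       d)"

lemma iota_carrier:
  assumes "B \<in> carrier_mat (m + 1) (m + 1)" "m \<le> n"
  shows "iota m n B \<in> carrier_mat (n + 1) (n + 1)"
  using assms by (auto simp: iota_def split_block_def Let_def append_rows_def)

lemma iota_index:
  assumes "B \<in> carrier_mat (m + 1) (m + 1)" "m \<le> n" "i \<le> n" "j \<le> n"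
  shows "iota m n B $$ (i, j) =
    (let old = (\<lambda>k. k < m \<or> k = n); f = (\<lambda>k. if k = n then m else k)
     in if old i \<and> old j then complex_of_real (B $$ (f i, f j)) else if i = j then 1 else 0)"
  using assms by (auto simp: iota_def split_block_def Let_def append_rows_def)


section \<open>The Kulkarni limit set\<close>

text \<open>
  The family is indexed by \<open>G\<close>: indices are counted, not distinct members of the family.
\<close>

definition cluster_points :: "'a topology \<Rightarrow> 'g set \<Rightarrow> ('g \<Rightarrow> 'a set) \<Rightarrow> 'a set" where
  "cluster_points X G A = {x \<in> topspace X.
     \<forall>U. openin X U \<and> x \<in> U \<longrightarrow> infinite {g \<in> G. U \<inter> A g \<noteq> {}}}"

definition kulkarni_L0 :: "'a topology \<Rightarrow> 'g set \<Rightarrow> ('g \<Rightarrow> 'a \<Rightarrow> 'a) \<Rightarrow> 'a set" where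
  "kulkarni_L0 X G act = X closure_of {x \<in> topspace X. infinite {g \<in> G. act g x = x}}"

definition kulkarni_L1 :: "'a topology \<Rightarrow> 'g set \<Rightarrow> ('g \<Rightarrow> 'a \<Rightarrow> 'a) \<Rightarrow> 'a set" where
  "kulkarni_L1 X G act = X closure_of
     (\<Union>z \<in> topspace X - kulkarni_L0 X G act. X derived_set_of ((\<lambda>g. act g z) ` G))"

definition kulkarni_L2 :: "'a topology \<Rightarrow> 'g set \<Rightarrow> ('g \<Rightarrow> 'a \<Rightarrow> 'a) \<Rightarrow> 'a set" where
  "kulkarni_L2 X G act = X closure_of
     (\<Union>K \<in> {K. compactin X K \<and> K \<subseteq> topspace X - (kulkarni_L0 X G act \<union> kulkarni_L1 X G act)}.
        cluster_points X G (\<lambda>g. act g ` K))"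

definition kulkarni_limit_set :: "'a topology \<Rightarrow> 'g set \<Rightarrow> ('g \<Rightarrow> 'a \<Rightarrow> 'a) \<Rightarrow> 'a set" where
  "kulkarni_limit_set X G act = kulkarni_L0 X G act \<union> kulkarni_L1 X G act \<union> kulkarni_L2 X G act"

definition kulkarni_region :: "'a topology \<Rightarrow> 'g set \<Rightarrow> ('g \<Rightarrow> 'a \<Rightarrow> 'a) \<Rightarrow> 'a set" where
  "kulkarni_region X G act = topspace X - kulkarni_limit_set X G act"

end

theory Submission
  imports Defs "HOL-Analysis.Function_Metric" "HOL-Analysis.T1_Spaces" "HOL-Analysis.Convex"
begin

text \<open>
  Let \<open>Om0\<close> be the set of vectors whose pairing with every real null ray is nonzero; its complement is
  the union of the hyperplanes \<open>H_p\<close>.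

  The inverse of a large isometry contracts some null ray, so an image with large pairings is short
  compared with the original vector, while the values of the Hermitian and the bilinear form are
  invariant. Hence the action on \<open>Om0\<close> is properly discontinuous and the limit set lies in its
  complement. Conversely, since the limit set is the whole sphere and \<open>\<Gamma>\<close> is discrete, the pairs of
  fixed rays of loxodromic elements are dense among the pairs of null rays.

  For \<open>m > 2\<close>, points orthogonal to both fixed rays of a loxodromic element are recurrent under its
  powers. So all points orthogonal to two null rays lie in the limit set, while a point that is
  orthogonal to exactly one null ray is a limit of points of the form \<open>\<alpha> f\<close> with \<open>Re f\<close> timelike. The
  latter form a connected subset of \<open>Om0\<close>, so the region is squeezed between a connected set and its
  closure.

  For \<open>m = 2\<close>, a tangent hyperplane has only one real line of directions, and \<open>L_0 \<union> L_1\<close> stays within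
  the real points. A point of the complement of \<open>Om0\<close> off the real points is, up to scaling,
  \<open>v + \<alpha> s\<close> with \<open>s\<close> null, \<open>v\<close> a unit tangent vector at \<open>s\<close> and \<open>\<alpha>\<close> not real; it is a limit of images of a
  convergent sequence of such points, hence in \<open>L_2\<close>. So the region is \<open>Om0\<close>, which consists of the
  timelike part and of the points \<open>x + \<i> y\<close> with spacelike span, the latter divided by orientation.
\<close>

section \<open>Homogeneous coordinates\<close>

text \<open>The size of a group element is measured by its corner entry \<open>A $$ (m, m)\<close>,
  the hyperbolic cosine of the displacement of the base point. It bounds all entries, and
  discreteness leaves finitely many elements below any given size, so each finiteness statement
  reduces to bounding this one number. The compact sets that enter L_2 must avoid L_0 and L_1. The
  real null points are therefore shown to lie in L_1: the estimate behind proper discontinuity holds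
  on compact sets away from them. This dictates the invariant: the Hermitian value, the bilinear
  value and the coordinates fixed by the action vanish together exactly at real null points. The
  obstacle to prescribing both fixed rays of a loxodromic element is a ray fixed by the whole group;
  discreteness excludes it. For m = 2 the orthogonal complement of two null rays is a line in the
  Lorentz coordinates, so recurrence there yields only points with real Lorentz part; other points
  of a tangent hyperplane have to come from L_2.\<close>

lemma tendsto_fun_iff:
  fixes F :: "'a \<Rightarrow> 'i \<Rightarrow> 'b::topological_space"
  shows "(F \<longlongrightarrow> f) net \<longleftrightarrow> (\<forall>i. ((\<lambda>k. F k i) \<longlongrightarrow> f i) net)"
proof -
  have "(F \<longlongrightarrow> f) net \<longleftrightarrow> limitin (product_topology (\<lambda>_. euclidean) UNIV) F f net"
    by (simp add: euclidean_product_topology)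
  then show ?thesis by (simp add: limitin_componentwise)
qed

lemma open_restrict_vimage:
  fixes I :: "'i set"
  assumes "openin (product_topology (\<lambda>_. euclidean :: 'a::topological_space topology) I) U"
  shows "open {f. restrict f I \<in> U}"
proof -
  have "continuous_map euclidean (product_topology (\<lambda>_. euclidean :: 'a topology) I) (\<lambda>f. restrict f I)"
    unfolding continuous_map_componentwise by auto
  from openin_continuous_map_preimage[OF this assms] show ?thesis by simp
qed

text \<open>Moves the coordinate topology of vectors to the product topology on total functions,
  where \<open>open\<close>, \<open>compact\<close> and \<open>continuous_on\<close> can be used;
  \<open>vec N\<close> ignores the entries from position N on.\<close>

lemma openin_vec_topology:
  "openin (vec_topology N) U \<longleftrightarrow>
     U \<subseteq> carrier_vec N \<and> open {f::nat \<Rightarrow> 'a::topological_space. vec N f \<in> U}" (is "?l \<longleftrightarrow> ?r")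
proof
  assume ?l
  then obtain U' where U': "openin (product_topology (\<lambda>_. euclidean) {..<N}) U'"
    and U: "U = (\<lambda>v. restrict (vec_index v) {..<N}) -` U' \<inter> carrier_vec N"
    unfolding vec_topology_def openin_pullback_topology by blast
  have "restrict (vec_index (vec N f)) {..<N} = restrict f {..<N}" for f :: "nat \<Rightarrow> 'a"
    by auto
  then have "{f. vec N f \<in> U} = {f. restrict f {..<N} \<in> U'}" by (auto simp: U)
  then show ?r using open_restrict_vimage[OF U'] U by auto
next
  assume r: ?r
  \<comment> \<open>On the product over the index set this is the inclusion into all functions.
    Written by cases, each component is visibly a projection or a constant, hence
    continuous.\<close>
  define c where "c = (\<lambda>h i. if i < N then h i else undefined :: 'a)"
  let ?P = "product_topology (\<lambda>_. euclidean :: 'a topology) {..<N}"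
  have "continuous_map ?P (product_topology (\<lambda>_. euclidean) UNIV) c"
    unfolding continuous_map_componentwise_UNIV c_def
    by (auto intro: continuous_map_product_projection)
  then have cont: "continuous_map ?P euclidean c" by (simp add: euclidean_product_topology)
  have "openin ?P {h \<in> topspace ?P. c h \<in> {f. vec N f \<in> U}}"
    by (rule openin_continuous_map_preimage[OF cont]) (use r in simp)
  moreover have "U = (\<lambda>v. restrict (vec_index v) {..<N}) -`
      {h \<in> topspace ?P. c h \<in> {f. vec N f \<in> U}} \<inter> carrier_vec N"
  proof -
    have "vec N (c (restrict (vec_index v) {..<N})) = v" if "v \<in> carrier_vec N" for v
      using that by (intro eq_vecI) (auto simp: c_def)
    then show ?thesis using r by auto
  qed
  ultimately show ?l unfolding vec_topology_def openin_pullback_topology by blast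
qed

lemma open_mat_vimage:
  assumes "openin (mat_topology N M) (U :: 'a::topological_space mat set)"
  shows "open {f. mat N M f \<in> U}"
proof -
  let ?I = "{..<N} \<times> {..<M}"
  from assms obtain U' where U': "openin (product_topology (\<lambda>_. euclidean) ?I) U'"
    and U: "U = (\<lambda>A. restrict (index_mat A) ?I) -` U' \<inter> carrier_mat N M"
    unfolding mat_topology_def openin_pullback_topology by blast
  have "restrict (index_mat (mat N M f)) ?I = restrict f ?I" for f :: "nat \<times> nat \<Rightarrow> 'a"
    by (auto simp: restrict_def fun_eq_iff)
  then have "{f. mat N M f \<in> U} = {f. restrict f ?I \<in> U'}" by (auto simp: U)
  then show ?thesis using open_restrict_vimage[OF U'] by auto
qed

text \<open>Homogeneous coordinates are total functions whose values beyond \<open>n\<close> are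
  forgotten; this form lets projective arguments run in the product topology.\<close>

definition pp :: "nat \<Rightarrow> (nat \<Rightarrow> 'a::field) \<Rightarrow> 'a vec set" where
  "pp n f = proj_pt (vec (n + 1) f)"

definition nz :: "nat \<Rightarrow> (nat \<Rightarrow> 'a::zero) set" where
  "nz n = {f. \<exists>i\<le>n. f i \<noteq> 0}"

lemma vec_in_nonzero_vecs: "vec (n + 1) f \<in> nonzero_vecs (n + 1) \<longleftrightarrow> f \<in> nz n"
proof -
  have "vec (n + 1) f = 0\<^sub>v (n + 1) \<longleftrightarrow> (\<forall>i\<le>n. f i = 0)"
    by (auto simp: vec_eq_iff less_Suc_eq_le)
  then show ?thesis by (auto simp: nonzero_vecs_def nz_def)
qed

lemma topspace_proj_pp: "topspace (proj_space n) = pp n ` nz n"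
proof -
  have "v \<in> (\<lambda>f. vec (n + 1) f) ` nz n" if "v \<in> nonzero_vecs (n + 1)" for v :: "'a vec"
  proof -
    have "v = vec (n + 1) (vec_index v)"
      using that by (auto simp: nonzero_vecs_def)
    then show ?thesis using that vec_in_nonzero_vecs by (metis image_eqI)
  qed
  then show ?thesis
    unfolding topspace_proj_space pp_def by (auto simp flip: vec_in_nonzero_vecs)
qed

lemma pp_in_topspace [intro]: "f \<in> nz n \<Longrightarrow> pp n f \<in> topspace (proj_space n)"
  by (auto simp: topspace_proj_pp)

lemma pp_eq_iff:
  assumes "f \<in> nz n" "g \<in> nz n"
  shows "pp n f = pp n g \<longleftrightarrow> (\<exists>c. c \<noteq> 0 \<and> (\<forall>i\<le>n. f i = c * g i))" (is "?l \<longleftrightarrow> ?r")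
proof
  assume ?l
  have "vec (n + 1) f \<in> proj_pt (vec (n + 1) f)"
    unfolding proj_pt_def by (auto intro!: exI[of _ 1])
  then obtain c where "c \<noteq> 0" "vec (n + 1) f = c \<cdot>\<^sub>v vec (n + 1) g"
    using \<open>?l\<close> unfolding pp_def by (auto simp: proj_pt_def)
  then show ?r by (auto simp: vec_eq_iff less_Suc_eq_le)
next
  assume ?r
  then obtain c where c: "c \<noteq> 0" "\<forall>i\<le>n. f i = c * g i" by blast
  then have e: "vec (n + 1) f = c \<cdot>\<^sub>v vec (n + 1) g" by (auto simp: vec_eq_iff)
  have "\<exists>d. d \<noteq> 0 \<and> a \<cdot>\<^sub>v (c \<cdot>\<^sub>v vec (n + 1) g) = d \<cdot>\<^sub>v vec (n + 1) g" if "a \<noteq> 0" for a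
    using that c(1) by (intro exI[of _ "a * c"]) (auto simp: smult_smult_assoc)
  moreover have "\<exists>d. d \<noteq> 0 \<and> a \<cdot>\<^sub>v vec (n + 1) g = d \<cdot>\<^sub>v (c \<cdot>\<^sub>v vec (n + 1) g)" if "a \<noteq> 0" for a
    using that c(1) by (intro exI[of _ "a / c"]) (auto simp: smult_smult_assoc)
  ultimately show ?l unfolding pp_def e proj_pt_def by blast
qed

lemma pp_scale: "c \<noteq> 0 \<Longrightarrow> f \<in> nz n \<Longrightarrow> pp n (\<lambda>i. c * f i) = pp n f"
  by (subst pp_eq_iff) (auto simp: nz_def)

lemma continuous_on_component: "continuous_on A (\<lambda>f::'i \<Rightarrow> 'b::topological_space. f i)"
  by (rule continuous_on_product_then_coordinatewise[OF continuous_on_id])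

lemma open_nz: "open (nz n :: (nat \<Rightarrow> 'a::real_normed_field) set)"
proof -
  have "nz n = (\<Union>i\<in>{..n}. {f::nat \<Rightarrow> 'a. f i \<noteq> 0})" by (auto simp: nz_def)
  moreover have "open {f::nat \<Rightarrow> 'a. f i \<noteq> 0}" for i
    by (intro open_Collect_neq continuous_on_component continuous_on_const)
  ultimately show ?thesis by auto
qed

lemma openin_proj_iff:
  "openin (proj_space n) U \<longleftrightarrow>
     U \<subseteq> topspace (proj_space n) \<and> open {f \<in> nz n. pp n f \<in> (U :: 'a::real_normed_field vec set set)}"
proof -
  let ?V = "nonzero_vecs (n + 1) :: 'a vec set"
  have V: "openin (vec_topology (n + 1)) ?V"
    unfolding openin_vec_topology vec_in_nonzero_vecs
    using open_nz[of n] by (auto simp: nonzero_vecs_def)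
  have "openin (subtopology (vec_topology (n + 1)) ?V) {v \<in> ?V. proj_pt v \<in> U}
     \<longleftrightarrow> openin (vec_topology (n + 1)) {v \<in> ?V. proj_pt v \<in> U}"
    using openin_open_subtopology[OF V] by auto
  also have "\<dots> \<longleftrightarrow> open {f \<in> nz n. pp n f \<in> U}"
  proof -
    have "{f. vec (n + 1) f \<in> {v \<in> ?V. proj_pt v \<in> U}} = {f \<in> nz n. pp n f \<in> U}"
      using vec_in_nonzero_vecs[of n] by (auto simp: pp_def)
    then show ?thesis
      unfolding openin_vec_topology by (auto simp: nonzero_vecs_def)
  qed
  finally show ?thesis
    unfolding openin_proj_space proj_open_def topspace_proj_space by blast
qed

lemma continuous_map_pp:
  "continuous_map (top_of_set (nz n)) (proj_space n) (pp n :: (nat \<Rightarrow> 'a::real_normed_field) \<Rightarrow> _)"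
  unfolding continuous_map_def
  by (auto simp: openin_open_eq open_nz openin_proj_iff)

text \<open>The projection is open because the saturation of \<open>V\<close> is a union of
  preimages of \<open>V\<close> under rescalings. \<open>V\<close> may restrict coordinates beyond
  \<open>n\<close>, which the projective point forgets, so the union also runs over all tails
  \<open>g\<close>.\<close>

lemma openin_pp_image:
  assumes "open V"
  shows "openin (proj_space n) (pp n ` (V \<inter> nz n) :: 'a::real_normed_field vec set set)"
proof -
  define W where "W = (\<lambda>c g. {f. (\<lambda>i. if i \<le> n then c * f i else g i) \<in> V} \<inter> nz n :: (nat \<Rightarrow> 'a) set)"
  have "{f \<in> nz n. pp n f \<in> pp n ` (V \<inter> nz n)} = (\<Union>c\<in>-{0}. \<Union>g. W c g)" (is "?L = ?R")
  proof (intro equalityI subsetI)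
    fix f assume "f \<in> ?L"
    then obtain g where fg: "f \<in> nz n" "g \<in> V" "g \<in> nz n" "pp n g = pp n f" by auto
    then obtain c where c: "c \<noteq> 0" "\<forall>i\<le>n. g i = c * f i" using pp_eq_iff by blast
    then have "(\<lambda>i. if i \<le> n then c * f i else g i) = g" by auto
    then have "f \<in> W c g" using fg by (simp add: W_def)
    then show "f \<in> ?R" using c(1) by blast
  next
    fix f assume "f \<in> ?R"
    then obtain c g where c: "c \<noteq> 0" "f \<in> nz n" and h: "(\<lambda>i. if i \<le> n then c * f i else g i) \<in> V" (is "?h \<in> V")
      by (auto simp: W_def)
    have "?h \<in> nz n" using c by (auto simp: nz_def)
    moreover have "pp n ?h = pp n f"
      unfolding pp_eq_iff[OF \<open>?h \<in> nz n\<close> c(2)] using c(1) by (intro exI[of _ c]) simp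
    moreover have "pp n ?h \<in> pp n ` (V \<inter> nz n)" by (intro imageI IntI h \<open>?h \<in> nz n\<close>)
    ultimately show "f \<in> ?L" using c by (simp only: mem_Collect_eq)
  qed
  moreover have "open (W c g)" for c g
  proof -
    have "continuous_on UNIV (\<lambda>f. if i \<le> n then c * f i else g i :: 'a)" for i
      by (cases "i \<le> n") (auto intro!: continuous_on_mult_left continuous_on_component)
    then have "continuous_on UNIV (\<lambda>f i. if i \<le> n then c * f i else g i :: 'a)"
      by (rule continuous_on_coordinatewise_then_product)
    from open_vimage[OF assms this] show ?thesis
      unfolding W_def vimage_def using open_nz by auto
  qed
  ultimately have "open {f \<in> nz n. pp n f \<in> pp n ` (V \<inter> nz n)}" by (simp add: open_UN)
  then show ?thesis
    unfolding openin_proj_iff topspace_proj_pp by blast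
qed

lemma limitin_proj_space:
  fixes F :: "nat \<Rightarrow> nat \<Rightarrow> 'a::real_normed_field"
  assumes "F \<longlonglongrightarrow> f" "f \<in> nz n"
  shows "limitin (proj_space n) (\<lambda>k. pp n (F k)) (pp n f) sequentially"
  unfolding limitin_def
proof (intro conjI allI impI)
  show "pp n f \<in> topspace (proj_space n)" using assms by auto
  fix U assume "openin (proj_space n) U \<and> pp n f \<in> U"
  then have "open {f \<in> nz n. pp n f \<in> U}" "f \<in> {f \<in> nz n. pp n f \<in> U}"
    using assms by (auto simp: openin_proj_iff)
  from topological_tendstoD[OF assms(1) this]
  show "\<forall>\<^sub>F k in sequentially. pp n (F k) \<in> U" by (auto elim: eventually_mono)
qed

text \<open>Proportionality is the vanishing of all 2 by 2 minors, a closed condition. Closed points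
  ensure that every neighbourhood of an accumulation point contains infinitely many points of the
  set.\<close>

lemma t1_space_proj: "t1_space (proj_space n :: 'a::real_normed_field vec set topology)"
  unfolding t1_space_closedin_singleton
proof
  fix x :: "'a vec set" assume "x \<in> topspace (proj_space n)"
  then obtain g where g: "g \<in> nz n" "x = pp n g" by (auto simp: topspace_proj_pp)
  have "{f \<in> nz n. pp n f \<noteq> x} = (\<Union>i\<in>{..n}. \<Union>j\<in>{..n}. {f. f i * g j \<noteq> f j * g i}) \<inter> nz n" (is "?L = ?R")
  proof (intro equalityI subsetI)
    fix f assume "f \<in> ?L"
    then have f: "f \<in> nz n" "pp n f \<noteq> pp n g" using g by auto
    obtain j where j: "j \<le> n" "g j \<noteq> 0" using g by (auto simp: nz_def)
    show "f \<in> ?R"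
    proof (rule ccontr)
      assume "f \<notin> ?R"
      then have e: "f i * g k = f k * g i" if "i \<le> n" "k \<le> n" for i k using that f by auto
      have "f i = f j / g j * g i" if "i \<le> n" for i using e[OF that j(1)] j by (simp add: field_simps)
      moreover have "f j \<noteq> 0" using calculation f by (auto simp: nz_def)
      ultimately have "pp n f = pp n g"
        using f g j pp_eq_iff by (metis divide_eq_0_iff)
      then show False using f by simp
    qed
  next
    fix f assume "f \<in> ?R"
    then show "f \<in> ?L" using g by (auto simp: pp_eq_iff algebra_simps)
  qed
  moreover have "open {f::nat \<Rightarrow> 'a. f i * g j \<noteq> f j * g i}" for i j
    by (intro open_Collect_neq continuous_intros continuous_on_component)
  ultimately have "open {f \<in> nz n. pp n f \<noteq> x}" 
    by (simp only:) (intro open_Int open_UN ballI open_nz)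
  moreover have "{f \<in> nz n. pp n f \<in> topspace (proj_space n) - {x}} = {f \<in> nz n. pp n f \<noteq> x}" by auto
  ultimately have "openin (proj_space n) (topspace (proj_space n) - {x})"
    unfolding openin_proj_iff by auto
  then show "closedin (proj_space n) {x}"
    using g by (auto simp: closedin_def)
qed

lemma compactin_pp:
  fixes K :: "(nat \<Rightarrow> 'a::real_normed_field) set"
  assumes "compact K" "K \<subseteq> nz n"
  shows "compactin (proj_space n) (pp n ` K)"
proof (rule image_compactin[OF _ continuous_map_pp])
  show "compactin (top_of_set (nz n)) K" using assms by (simp add: compactin_subtopology)
qed

lemma connectedin_pp:
  fixes K :: "(nat \<Rightarrow> 'a::real_normed_field) set"
  assumes "connected K" "K \<subseteq> nz n"
  shows "connectedin (proj_space n) (pp n ` K)"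
proof (rule connectedin_continuous_map_image[OF continuous_map_pp])
  show "connectedin (top_of_set (nz n)) K" using assms by (simp add: connectedin_subtopology)
qed

section \<open>The Lorentz group\<close>

text \<open>Bilinear over any commutative ring, so one form serves real and complex vectors; the
  Hermitian form arises by conjugating the second argument.\<close>

definition lp :: "nat \<Rightarrow> (nat \<Rightarrow> 'a::comm_ring_1) \<Rightarrow> (nat \<Rightarrow> 'a) \<Rightarrow> 'a" where
  "lp m x y = (\<Sum>i<m. x i * y i) - x m * y m"

text \<open>One definition covers the action on real and on complex vectors. The value 0 beyond
  \<open>m\<close> lets eigenvector equations be equalities of functions.\<close>

definition mv :: "nat \<Rightarrow> real mat \<Rightarrow> (nat \<Rightarrow> 'a::real_normed_field) \<Rightarrow> nat \<Rightarrow> 'a" where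
  "mv m A x = (\<lambda>i. if i \<le> m then \<Sum>j\<le>m. of_real (A $$ (i, j)) * x j else 0)"

definition em :: "nat \<Rightarrow> nat \<Rightarrow> 'a::comm_ring_1" where
  "em m = (\<lambda>i. if i = m then 1 else 0)"

definition lsign :: "nat \<Rightarrow> nat \<Rightarrow> 'a::comm_ring_1" where
  "lsign m i = (if i = m then - 1 else 1)"

text \<open>The adjoint for the Lorentz form, J A^T J with J the signature matrix; on the group it
  is the inverse, given by explicit entries.\<close>

definition adj :: "nat \<Rightarrow> real mat \<Rightarrow> real mat" where
  "adj m A = mat (m + 1) (m + 1) (\<lambda>(i, j). lsign m i * lsign m j * A $$ (j, i))"

lemma lp_alt: "lp m x y = (\<Sum>i\<le>m. lsign m i * x i * y i)"
proof -
  have "{..m} = insert m {..<m}" by auto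
  then have "(\<Sum>i\<le>m. lsign m i * x i * y i) = - (x m * y m) + (\<Sum>i<m. lsign m i * x i * y i)"
    by (simp add: lsign_def)
  also have "(\<Sum>i<m. lsign m i * x i * y i) = (\<Sum>i<m. x i * y i)"
    by (rule sum.cong) (auto simp: lsign_def)
  finally show ?thesis by (simp add: lp_def)
qed

lemma lsign_sq [simp]: "lsign m i * lsign m i = (1 :: 'a::comm_ring_1)"
  by (simp add: lsign_def)

lemma of_real_lsign [simp]: "of_real (lsign m i) = (lsign m i :: 'a::real_normed_field)"
  by (simp add: lsign_def)

lemma lp_commute: "lp m x y = lp m y x"
  by (simp add: lp_def mult.commute)

lemma lp_add_left: "lp m (\<lambda>i. x i + y i) z = lp m x z + lp m y z"
  by (simp add: lp_def sum.distrib algebra_simps)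

lemma lp_add_right: "lp m z (\<lambda>i. x i + y i) = lp m z x + lp m z y"
  by (simp add: lp_def sum.distrib algebra_simps)

lemma lp_diff_left: "lp m (\<lambda>i. x i - y i) z = lp m x z - lp m y z"
  by (simp add: lp_def sum_subtractf algebra_simps)

lemma lp_diff_right: "lp m z (\<lambda>i. x i - y i) = lp m z x - lp m z y"
  by (simp add: lp_def sum_subtractf algebra_simps)

lemma lp_scale_left: "lp m (\<lambda>i. c * x i) z = c * lp m x z"
  by (simp add: lp_def sum_distrib_left algebra_simps)

lemma lp_scale_right: "lp m z (\<lambda>i. c * x i) = c * lp m z x"
  by (simp add: lp_def sum_distrib_left algebra_simps)

lemmas lp_linear = lp_add_left lp_add_right lp_diff_left lp_diff_right lp_scale_left lp_scale_right

lemma lp_cong: "(\<And>i. i \<le> m \<Longrightarrow> x i = x' i) \<Longrightarrow> (\<And>i. i \<le> m \<Longrightarrow> y i = y' i) \<Longrightarrow> lp m x y = lp m x' y'"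
  by (simp add: lp_def)

lemma lp_em_left: "lp m (em m) y = - y m"
  by (simp add: lp_def em_def)

lemma lp_em_right: "lp m y (em m) = - y m"
  by (simp add: lp_def em_def)

lemma lp_em_em [simp]: "lp m (em m) (em m) = - 1"
  by (simp add: lp_em_left) (simp add: em_def)

lemma mv_cong: "(\<And>i. i \<le> m \<Longrightarrow> x i = y i) \<Longrightarrow> mv m A x = mv m A y"
  by (auto simp: mv_def)

lemma mv_add: "mv m A (\<lambda>i. x i + y i) = (\<lambda>i. mv m A x i + mv m A y i)"
  by (auto simp: mv_def sum.distrib algebra_simps)

lemma mv_scale: "mv m A (\<lambda>i. c * x i) = (\<lambda>i. c * mv m A x i)"
  by (auto simp: mv_def sum_distrib_left algebra_simps)

lemma mv_diff: "mv m A (\<lambda>i. x i - y i) = (\<lambda>i. mv m A x i - mv m A y i)"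
  by (auto simp: mv_def sum_subtractf algebra_simps)

lemma mv_em: "i \<le> m \<Longrightarrow> mv m A (em m) i = of_real (A $$ (i, m))"
proof -
  assume "i \<le> m"
  have "(\<Sum>j\<le>m. of_real (A $$ (i, j)) * em m j) = (\<Sum>j\<le>m. if j = m then of_real (A $$ (i, m)) else (0::'a))"
    by (rule sum.cong) (auto simp: em_def)
  then show ?thesis using \<open>i \<le> m\<close> by (simp add: mv_def)
qed

lemma mv_mult:
  assumes "A \<in> carrier_mat (m + 1) (m + 1)" "B \<in> carrier_mat (m + 1) (m + 1)"
  shows "mv m (A * B) x = mv m A (mv m B x)"
proof
  fix i
  show "mv m (A * B) x i = mv m A (mv m B x) i"
  proof (cases "i \<le> m")
    case True
    have e: "(A * B) $$ (i, j) = (\<Sum>k\<le>m. A $$ (i, k) * B $$ (k, j))" if "j \<le> m" for j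
      using assms that True
      by (auto simp: scalar_prod_def atLeast0LessThan lessThan_Suc_atMost)
    have "mv m (A * B) x i = (\<Sum>j\<le>m. \<Sum>k\<le>m. of_real (A $$ (i, k)) * of_real (B $$ (k, j)) * x j)"
      using True e by (simp add: mv_def sum_distrib_right)
    also have "\<dots> = (\<Sum>k\<le>m. \<Sum>j\<le>m. of_real (A $$ (i, k)) * of_real (B $$ (k, j)) * x j)"
      by (rule sum.swap)
    also have "\<dots> = mv m A (mv m B x) i"
      using True by (simp add: mv_def sum_distrib_left mult.assoc)
    finally show ?thesis .
  qed (simp add: mv_def)
qed

lemma mv_one: "i \<le> m \<Longrightarrow> mv m (1\<^sub>m (m + 1)) x i = x i"
proof -
  assume "i \<le> m"
  then have "(\<Sum>j\<le>m. of_real (1\<^sub>m (m + 1) $$ (i, j)) * x j) = (\<Sum>j\<le>m. if j = i then x i else 0)"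
    by (intro sum.cong) auto
  then show ?thesis using \<open>i \<le> m\<close> by (simp add: mv_def)
qed

lemma lorentz_vec: "lorentz m (vec (m + 1) x) (vec (m + 1) y) = lp m x y"
  by (simp add: lorentz_def lp_def)

lemma mult_mat_vec_eq:
  assumes "A \<in> carrier_mat (m + 1) (m + 1)"
  shows "A *\<^sub>v vec (m + 1) x = vec (m + 1) (mv m A x)"
  using assms by (intro eq_vecI)
    (auto simp: mv_def scalar_prod_def atLeast0LessThan lessThan_Suc_atMost row_def)

lemma SO_plus_carrierD:
  assumes "A \<in> carrier (SO_plus m)"
  shows "A \<in> carrier_mat (m + 1) (m + 1)" "A $$ (m, m) > 0" "Determinant.det A = 1"
    "lp m (mv m A x) (mv m A y) = lp m x (y :: nat \<Rightarrow> real)"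
proof -
  show A: "A \<in> carrier_mat (m + 1) (m + 1)" "A $$ (m, m) > 0" "Determinant.det A = 1"
    using assms by (auto simp: SO_plus_def)
  have "lorentz m (A *\<^sub>v vec (m + 1) x) (A *\<^sub>v vec (m + 1) y) = lorentz m (vec (m + 1) x) (vec (m + 1) y)"
    using assms by (auto simp: SO_plus_def)
  then show "lp m (mv m A x) (mv m A y) = lp m x y"
    by (simp only: mult_mat_vec_eq[OF A(1)] lorentz_vec)
qed

lemma SO_plus_orth:
  assumes "A \<in> carrier (SO_plus m)" "j \<le> m" "k \<le> m"
  shows "(\<Sum>i\<le>m. lsign m i * A $$ (i, j) * A $$ (i, k)) = (if j = k then lsign m j else 0)"
proof -
  let ?e = "\<lambda>l i. if i = l then 1 else 0 :: real"
  have e: "mv m A (?e l) i = A $$ (i, l)" if "i \<le> m" "l \<le> m" for i l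
  proof -
    have "(\<Sum>j\<le>m. A $$ (i, j) * ?e l j) = (\<Sum>j\<le>m. if j = l then A $$ (i, l) else 0)"
      by (rule sum.cong) auto
    then show ?thesis using that by (simp add: mv_def)
  qed
  have "(\<Sum>i\<le>m. lsign m i * A $$ (i, j) * A $$ (i, k)) = lp m (mv m A (?e j)) (mv m A (?e k))"
    unfolding lp_alt by (rule sum.cong) (use assms e in auto)
  also have "\<dots> = lp m (?e j) (?e k)" using SO_plus_carrierD(4)[OF assms(1)] .
  also have "\<dots> = (\<Sum>i\<le>m. if i = j then (if j = k then lsign m j else 0) else 0)"
    unfolding lp_alt by (rule sum.cong) auto
  finally show ?thesis using assms by simp
qed

lemma adj_carrier: "adj m A \<in> carrier_mat (m + 1) (m + 1)"
  by (simp add: adj_def)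

lemma adj_index: "i \<le> m \<Longrightarrow> j \<le> m \<Longrightarrow> adj m A $$ (i, j) = lsign m i * lsign m j * A $$ (j, i)"
  by (simp add: adj_def)

lemma lp_mv_adj: "lp m (mv m A x) y = lp m x (mv m (adj m A) y)"
proof -
  have "lp m (mv m A x) y = (\<Sum>i\<le>m. \<Sum>j\<le>m. lsign m i * of_real (A $$ (i, j)) * x j * y i)"
    unfolding lp_alt by (rule sum.cong) (auto simp: mv_def sum_distrib_left sum_distrib_right mult.assoc)
  also have "\<dots> = (\<Sum>j\<le>m. \<Sum>i\<le>m. lsign m i * of_real (A $$ (i, j)) * x j * y i)"
    by (rule sum.swap)
  also have "\<dots> = (\<Sum>j\<le>m. lsign m j * x j * mv m (adj m A) y j)"
  proof (rule sum.cong)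
    fix j assume "j \<in> {..m}"
    then show "(\<Sum>i\<le>m. lsign m i * of_real (A $$ (i, j)) * x j * y i) = lsign m j * x j * mv m (adj m A) y j"
      by (auto simp: mv_def adj_index sum_distrib_left lsign_def intro!: sum.cong)
  qed simp
  finally show ?thesis by (simp add: lp_alt)
qed

lemma adj_mult_left:
  assumes "A \<in> carrier (SO_plus m)"
  shows "adj m A * A = 1\<^sub>m (m + 1)"
proof (rule eq_matI)
  fix i j assume "i < dim_row (1\<^sub>m (m + 1) :: real mat)" "j < dim_col (1\<^sub>m (m + 1) :: real mat)"
  then have ij: "i \<le> m" "j \<le> m" by auto
  note A = SO_plus_carrierD[OF assms]
  have "(adj m A * A) $$ (i, j) = (\<Sum>k\<le>m. adj m A $$ (i, k) * A $$ (k, j))"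
    using A(1) ij by (auto simp: adj_def scalar_prod_def atLeast0LessThan lessThan_Suc_atMost)
  also have "\<dots> = lsign m i * (\<Sum>k\<le>m. lsign m k * A $$ (k, i) * A $$ (k, j))"
    using ij by (auto simp: adj_index sum_distrib_left mult.assoc intro!: sum.cong)
  also have "\<dots> = 1\<^sub>m (m + 1) $$ (i, j)"
    using ij by (simp add: SO_plus_orth[OF assms])
  finally show "(adj m A * A) $$ (i, j) = 1\<^sub>m (m + 1) $$ (i, j)" .
qed (use SO_plus_carrierD(1)[OF assms] in \<open>auto simp: adj_def\<close>)

lemma adj_mult_right:
  assumes "A \<in> carrier (SO_plus m)"
  shows "A * adj m A = 1\<^sub>m (m + 1)"
  using mat_mult_left_right_inverse[OF adj_carrier SO_plus_carrierD(1)[OF assms] adj_mult_left[OF assms]] .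

lemma mv_adj_mv:
  assumes "A \<in> carrier (SO_plus m)" "i \<le> m"
  shows "mv m (adj m A) (mv m A x) i = x i" "mv m A (mv m (adj m A) x) i = x i"
proof -
  note A = SO_plus_carrierD(1)[OF assms(1)]
  have "mv m (adj m A) (mv m A x) = mv m (1\<^sub>m (m + 1)) x"
    unfolding mv_mult[OF adj_carrier A, symmetric] adj_mult_left[OF assms(1)] ..
  then show "mv m (adj m A) (mv m A x) i = x i" by (simp only: mv_one[OF assms(2)])
  have "mv m A (mv m (adj m A) x) = mv m (1\<^sub>m (m + 1)) x"
    unfolding mv_mult[OF A adj_carrier, symmetric] adj_mult_right[OF assms(1)] ..
  then show "mv m A (mv m (adj m A) x) i = x i" by (simp only: mv_one[OF assms(2)])
qed

lemma lp_mv: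
  assumes "A \<in> carrier (SO_plus m)"
  shows "lp m (mv m A x) (mv m A y) = lp m x y"
  unfolding lp_mv_adj using mv_adj_mv(1)[OF assms] by (auto intro!: lp_cong)

lemma adj_in_SO_plus:
  assumes "A \<in> carrier (SO_plus m)"
  shows "adj m A \<in> carrier (SO_plus m)"
proof -
  note A = SO_plus_carrierD[OF assms]
  have "lorentz m (adj m A *\<^sub>v v) (adj m A *\<^sub>v w) = lorentz m v w"
    if "v \<in> carrier_vec (m + 1)" "w \<in> carrier_vec (m + 1)" for v w
  proof -
    define x y where "x = vec_index v" and "y = vec_index w"
    have v: "v = vec (m + 1) x" and w: "w = vec (m + 1) y"
      using that by (auto simp: x_def y_def)
    have "lp m (mv m (adj m A) x) (mv m (adj m A) y)
        = lp m (mv m A (mv m (adj m A) x)) (mv m A (mv m (adj m A) y))"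
      by (simp only: lp_mv[OF assms])
    also have "\<dots> = lp m x y" using mv_adj_mv(2)[OF assms] by (auto intro!: lp_cong)
    finally show ?thesis
      unfolding v w mult_mat_vec_eq[OF adj_carrier] lorentz_vec .
  qed
  moreover have "Determinant.det (adj m A) * Determinant.det A = 1"
    using det_mult[OF adj_carrier[of m A] A(1)] adj_mult_left[OF assms] by simp
  ultimately show ?thesis
    using A adj_carrier[of m A] by (simp add: SO_plus_def adj_index)
qed

lemma SO_plus_inv:
  assumes "A \<in> carrier (SO_plus m)"
  shows "inv\<^bsub>SO_plus m\<^esub> A = adj m A"
proof -
  note A = SO_plus_carrierD[OF assms]
  have "y = adj m A" if "y \<in> carrier_mat (m + 1) (m + 1)" "A * y = 1\<^sub>m (m + 1)" for y
  proof -
    have "adj m A * (A * y) = adj m A * A * y"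
      using A that by (simp add: assoc_mult_mat[OF adj_carrier])
    then show ?thesis
      using that adj_mult_left[OF assms] left_mult_one_mat[OF that(1)] right_mult_one_mat[OF adj_carrier, of m A] by simp
  qed
  then show ?thesis
    unfolding m_inv_def
    using adj_in_SO_plus[OF assms] adj_mult_left[OF assms] adj_mult_right[OF assms]
    by (intro the_equality) (auto simp: SO_plus_def)
qed

lemma adj_adj:
  assumes "A \<in> carrier_mat (m + 1) (m + 1)"
  shows "adj m (adj m A) = A"
  using assms by (intro eq_matI) (auto simp: adj_def lsign_def)

lemma adj_diag [simp]: "adj m A $$ (m, m) = A $$ (m, m)"
  by (simp add: adj_index)

text \<open>Moving \<open>A\<close> across the form onto the base vector turns the time coordinate
  of an image into a pairing with the inverse image of the base point. Expansion and contraction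
  factors are computed this way.\<close>

lemma mv_time: "mv m A x m = - lp m (mv m (adj m A) (em m)) x"
proof -
  have "- mv m A x m = lp m x (mv m (adj m A) (em m))"
    using lp_mv_adj[of m A x "em m"] by (simp add: lp_em_right)
  also have "\<dots> = lp m (mv m (adj m A) (em m)) x" by (rule lp_commute)
  finally show ?thesis by (metis minus_minus)
qed

lemma lp_self_eq: "lp m x x = (\<Sum>i<m. (x i)\<^sup>2) - (x m)\<^sup>2"
  by (simp add: lp_def power2_eq_square)

text \<open>With d the corner entry, the spatial part of the last column has squared length d^2 - 1,
  and so has that of the last row, by passing to \<open>adj\<close>. Any other column has spatial
  squared length 1 plus the square of its time entry, which the row bound keeps below d^2.\<close>

lemma SO_plus_entry_bound:
  assumes A: "A \<in> carrier (SO_plus m)" and i: "i \<le> m" and j: "j \<le> m"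
  shows "\<bar>A $$ (i, j)\<bar> \<le> A $$ (m, m)" and "1 \<le> A $$ (m, m)"
proof -
  let ?d = "A $$ (m, m)"
  have col: "(\<Sum>i<m. (B $$ (i, m))\<^sup>2) = (B $$ (m, m))\<^sup>2 - 1" if "B \<in> carrier (SO_plus m)" for B
  proof -
    have "lp m (mv m B (em m)) (mv m B (em m)) = (-1::real)"
      by (simp add: lp_mv[OF that])
    moreover have "lp m (mv m B (em m)) (mv m B (em m)) = (\<Sum>i<m. (B $$ (i, m))\<^sup>2) - (B $$ (m, m))\<^sup>2"
      by (simp add: lp_self_eq mv_em)
    ultimately show ?thesis by simp
  qed
  have le: "(g i)\<^sup>2 \<le> (\<Sum>i<m. (g i)\<^sup>2)" if "i < m" for g :: "nat \<Rightarrow> real" and i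
    by (rule member_le_sum) (use that in auto)
  note d = SO_plus_carrierD(2)[OF A]
  have "(\<Sum>i<m. (A $$ (i, m))\<^sup>2) \<ge> 0" by (rule sum_nonneg) auto
  then have "1\<^sup>2 \<le> ?d\<^sup>2" using col[OF A] by simp
  then show d1: "1 \<le> ?d" using d by (intro power2_le_imp_le[of 1 ?d]) auto
  have row: "(\<Sum>i<m. (A $$ (m, i))\<^sup>2) = ?d\<^sup>2 - 1"
  proof -
    have "(\<Sum>i<m. (adj m A $$ (i, m))\<^sup>2) = (\<Sum>i<m. (A $$ (m, i))\<^sup>2)"
      by (rule sum.cong) (auto simp: adj_index lsign_def)
    then show ?thesis using col[OF adj_in_SO_plus[OF A]] by simp
  qed
  have colj: "(\<Sum>i<m. (A $$ (i, j))\<^sup>2) = 1 + (A $$ (m, j))\<^sup>2" if "j < m"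
  proof -
    have "1 = (\<Sum>i\<le>m. lsign m i * A $$ (i, j) * A $$ (i, j))"
      using SO_plus_orth[OF A j j] that by (simp add: lsign_def)
    also have "\<dots> = lp m (\<lambda>i. A $$ (i, j)) (\<lambda>i. A $$ (i, j))" by (simp add: lp_alt)
    finally show ?thesis by (simp add: lp_self_eq)
  qed
  have "(A $$ (i, j))\<^sup>2 \<le> ?d\<^sup>2"
  proof -
    consider "i = m" "j = m" | "i < m" "j = m" | "i = m" "j < m" | "i < m" "j < m" using i j by linarith
    then show ?thesis
    proof cases
      case 2 then show ?thesis using le[of i "\<lambda>i. A $$ (i, m)"] col[OF A] by simp
    next
      case 3 then show ?thesis using le[of j "\<lambda>i. A $$ (m, i)"] row by simp
    next
      case 4 then show ?thesis
        using le[of i "\<lambda>i. A $$ (i, j)"] colj le[of j "\<lambda>i. A $$ (m, i)"] row by simp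
    qed auto
  qed
  then show "\<bar>A $$ (i, j)\<bar> \<le> ?d" using d by (simp add: abs_le_square_iff[symmetric])
qed

text \<open>Expands the squared difference after both time coordinates are scaled to 1. It turns
  values of the form into Euclidean distances between directions.\<close>

lemma lp_direction:
  fixes x y :: "nat \<Rightarrow> real"
  assumes "x m \<noteq> 0" "y m \<noteq> 0"
  shows "(\<Sum>i<m. (x i / x m - y i / y m)\<^sup>2)
    = lp m x x / (x m)\<^sup>2 + lp m y y / (y m)\<^sup>2 - 2 * lp m x y / (x m * y m)"
proof -
  let ?u = "\<lambda>i. 1 / x m * x i - 1 / y m * y i"
  have "(\<Sum>i<m. (x i / x m - y i / y m)\<^sup>2) = lp m ?u ?u"
    using assms by (simp add: lp_self_eq)
  also have "\<dots> = lp m x x / (x m)\<^sup>2 + lp m y y / (y m)\<^sup>2 - 2 * lp m x y / (x m * y m)"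
    unfolding lp_linear using lp_commute[of m y x]
    by (simp add: power2_eq_square algebra_simps)
  finally show ?thesis .
qed

lemma lp_causal_neg:
  fixes x y :: "nat \<Rightarrow> real"
  assumes "lp m x x < 0" "lp m y y \<le> 0" "x m > 0" "y m > 0"
  shows "lp m x y < 0"
proof -
  have "0 \<le> (\<Sum>i<m. (x i / x m - y i / y m)\<^sup>2)" by (rule sum_nonneg) auto
  also have "\<dots> = lp m x x / (x m)\<^sup>2 + lp m y y / (y m)\<^sup>2 - 2 * lp m x y / (x m * y m)"
    by (rule lp_direction) (use assms in auto)
  finally have "2 * lp m x y / (x m * y m) \<le> lp m x x / (x m)\<^sup>2 + lp m y y / (y m)\<^sup>2" by simp
  also have "\<dots> < 0"
  proof -
    have "lp m x x / (x m)\<^sup>2 < 0" "lp m y y / (y m)\<^sup>2 \<le> 0"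
      using assms by (auto simp: divide_less_0_iff divide_le_0_iff)
    then show ?thesis by simp
  qed
  finally show ?thesis using assms by (auto simp: divide_less_0_iff mult_less_0_iff zero_less_mult_iff)
qed

section \<open>Null rays\<close>

text \<open>Points of the sphere at infinity as null vectors with time coordinate 1. The zeros
  beyond \<open>m\<close> make the representative unique and the set compact among all
  functions.\<close>

definition nullray :: "nat \<Rightarrow> (nat \<Rightarrow> real) set" where
  "nullray m = {s. s m = 1 \<and> lp m s s = 0 \<and> (\<forall>i>m. s i = 0)}"

lemma nullrayD:
  assumes "s \<in> nullray m"
  shows "s m = 1" "lp m s s = 0" "i > m \<Longrightarrow> s i = 0" "(\<Sum>i<m. (s i)\<^sup>2) = 1"
  using assms by (auto simp: nullray_def lp_self_eq)

lemma nullray_abs_le: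
  assumes "s \<in> nullray m"
  shows "\<bar>s i\<bar> \<le> 1"
proof -
  consider "i < m" | "i = m" | "i > m" by linarith
  then show ?thesis
  proof cases
    case 1
    then have "(s i)\<^sup>2 \<le> (\<Sum>i<m. (s i)\<^sup>2)" by (intro member_le_sum) auto
    then show ?thesis using nullrayD(4)[OF assms] by (simp add: abs_square_le_1)
  qed (use nullrayD[OF assms] in auto)
qed

lemma nullray_lp:
  assumes "s \<in> nullray m" "t \<in> nullray m"
  shows "(\<Sum>i<m. (s i - t i)\<^sup>2) = - 2 * lp m s t"
  using lp_direction[of s m t] nullrayD[OF assms(1)] nullrayD[OF assms(2)] by simp

lemma nullray_lp_le:
  assumes "s \<in> nullray m" "t \<in> nullray m"
  shows "lp m s t \<le> 0"
  using nullray_lp[OF assms] sum_nonneg[of "{..<m}" "\<lambda>i. (s i - t i)\<^sup>2"] by simp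

lemma nullray_lp_eq_0:
  assumes "s \<in> nullray m" "t \<in> nullray m" "lp m s t = 0"
  shows "s = t"
proof
  fix i
  have "(\<Sum>i<m. (s i - t i)\<^sup>2) = 0" using nullray_lp[OF assms(1,2)] assms(3) by simp
  then have "\<forall>i\<in>{..<m}. (s i - t i)\<^sup>2 = 0" by (subst (asm) sum_nonneg_eq_0_iff) auto
  then show "s i = t i"
    using nullrayD[OF assms(1)] nullrayD[OF assms(2)] by (metis eq_iff_diff_eq_0 lessThan_iff linorder_neqE_nat power_eq_0_iff)
qed

lemma normalize_nullray:
  assumes "lp m x x = 0" "x m \<noteq> 0"
  shows "(\<lambda>i. if i \<le> m then x i / x m else 0) \<in> nullray m"
proof -
  have "lp m (\<lambda>i. if i \<le> m then x i / x m else 0) (\<lambda>i. if i \<le> m then x i / x m else 0)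
      = lp m (\<lambda>i. 1 / x m * x i) (\<lambda>i. 1 / x m * x i)"
    by (rule lp_cong) auto
  also have "\<dots> = 0" unfolding lp_linear using assms by simp
  finally show ?thesis using assms by (simp add: nullray_def)
qed

lemma continuous_on_lp [continuous_intros]:
  fixes f g :: "'b::topological_space \<Rightarrow> nat \<Rightarrow> 'a::{comm_ring_1, real_normed_algebra}"
  assumes "\<And>i. continuous_on S (\<lambda>x. f x i)" "\<And>i. continuous_on S (\<lambda>x. g x i)"
  shows "continuous_on S (\<lambda>x. lp m (f x) (g x))"
  unfolding lp_def by (intro continuous_intros assms)

lemma tendsto_lp [tendsto_intros]:
  fixes f g :: "'b \<Rightarrow> nat \<Rightarrow> 'a::{comm_ring_1, real_normed_algebra}"
  assumes "\<And>i. i \<le> m \<Longrightarrow> ((\<lambda>x. f x i) \<longlongrightarrow> a i) F" "\<And>i. i \<le> m \<Longrightarrow> ((\<lambda>x. g x i) \<longlongrightarrow> b i) F"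
  shows "((\<lambda>x. lp m (f x) (g x)) \<longlongrightarrow> lp m a b) F"
  unfolding lp_def by (intro tendsto_intros assms) auto

lemma compact_box: "compact {x :: nat \<Rightarrow> real. \<forall>i. \<bar>x i\<bar> \<le> r i}"
proof -
  have "compactin (product_topology (\<lambda>_. euclidean) UNIV) (PiE UNIV (\<lambda>i. {- r i..r i}))"
    unfolding compactin_PiE by simp
  moreover have "PiE UNIV (\<lambda>i. {- r i..r i}) = {x. \<forall>i. \<bar>x i\<bar> \<le> r i}"
    by (auto simp: PiE_def Pi_def abs_le_iff minus_le_iff)
  ultimately show ?thesis by (simp add: euclidean_product_topology)
qed

lemma compact_nullray: "compact (nullray m)"
proof -
  have "closed (nullray m)"
  proof -
    have "nullray m = {s. s m = 1} \<inter> {s. lp m s s = 0} \<inter> (\<Inter>i\<in>{m<..}. {s. s i = 0})"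
      by (auto simp: nullray_def)
    moreover have "closed {s::nat \<Rightarrow> real. s i = c}" for i c
      by (intro closed_Collect_eq continuous_on_component continuous_on_const)
    moreover have "closed {s::nat \<Rightarrow> real. lp m s s = 0}"
      by (intro closed_Collect_eq continuous_on_lp continuous_on_component continuous_on_const)
    ultimately show ?thesis by (simp only:) (intro closed_Int closed_INT ballI)
  qed
  moreover have "nullray m = {x. \<forall>i. \<bar>x i\<bar> \<le> (\<lambda>_. 1) i} \<inter> nullray m"
    using nullray_abs_le by auto
  ultimately show ?thesis using compact_Int_closed[OF compact_box[of "\<lambda>_. 1"]] by metis
qed

lemma nullray_tendsto_closed:
  assumes "\<And>k. s k \<in> nullray m" "\<And>i. i \<le> m \<Longrightarrow> (\<lambda>k. s k i) \<longlonglongrightarrow> t i" "\<And>i. i > m \<Longrightarrow> t i = 0"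
  shows "t \<in> nullray m"
proof -
  have "(\<lambda>k. s k i) \<longlonglongrightarrow> t i" for i
    using assms(2)[of i] assms(3)[of i] nullrayD(3)[OF assms(1)] by (cases "i \<le> m") auto
  then have "s \<longlonglongrightarrow> t" by (simp add: tendsto_fun_iff)
  then show ?thesis
    using closed_sequentially[OF compact_imp_closed[OF compact_nullray] assms(1)] by simp
qed

definition ray_dir :: "nat \<Rightarrow> nat \<Rightarrow> nat \<Rightarrow> real" where
  "ray_dir m k = (\<lambda>i. if i = k \<or> i = m then 1 else 0)"

lemma ray_dir_nullray: "k < m \<Longrightarrow> ray_dir m k \<in> nullray m"
proof -
  assume k: "k < m"
  then have "(\<Sum>i<m. ray_dir m k i * ray_dir m k i) = (\<Sum>i<m. if i = k then 1 else 0)"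
    by (intro sum.cong) (auto simp: ray_dir_def)
  also have "\<dots> = 1" using k by simp
  finally show ?thesis using k by (simp add: nullray_def lp_def) (simp add: ray_dir_def)
qed

definition antipode :: "nat \<Rightarrow> (nat \<Rightarrow> real) \<Rightarrow> nat \<Rightarrow> real" where
  "antipode m s = (\<lambda>i. if i < m then - s i else s i)"

lemma antipode_nullray: "s \<in> nullray m \<Longrightarrow> antipode m s \<in> nullray m"
  by (auto simp: nullray_def antipode_def lp_def)

text \<open>A ray and its antipode add up to twice the base vector. The average of a pairing over an
  opposite pair is thus known, and one of the two rays does at least as well as the average.\<close>

lemma lp_antipode: "s m = 1 \<Longrightarrow> lp m x s + lp m x (antipode m s) = - 2 * x m"
  by (simp add: lp_def antipode_def sum_negf)

context
  fixes m :: nat and A :: "real mat"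
  assumes A: "A \<in> carrier (SO_plus m)"
begin

abbreviation (input) row_vec :: "nat \<Rightarrow> real" where "row_vec \<equiv> mv m (adj m A) (em m)"

lemma lp_row: "lp m row_vec row_vec = - 1" "row_vec m = A $$ (m, m)"
  using lp_mv[OF adj_in_SO_plus[OF A], of "em m" "em m"] by (simp_all add: mv_em)

lemma lp_col: "lp m (mv m A (em m)) (mv m A (em m)) = (- 1 :: real)"
  by (simp add: lp_mv[OF A])

lemma SO_plus_diag_ge_1: "A $$ (m, m) \<ge> 1"
  using SO_plus_entry_bound(2)[OF A, of m m] by simp

lemma mv_time_pos:
  assumes "lp m x x \<le> 0" "x m > 0"
  shows "mv m A x m > (0::real)"
  unfolding mv_time using lp_causal_neg[of m row_vec x] lp_row assms SO_plus_carrierD(2)[OF A] by simp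

lemma mv_nullray_pos:
  assumes "s \<in> nullray m"
  shows "mv m A s m > 0"
  using mv_time_pos nullrayD[OF assms] by simp

text \<open>With d the corner entry, the ray in the spatial direction of \<open>row_vec\<close> is
  scaled by d - sqrt (d^2 - 1), the reciprocal of d + sqrt (d^2 - 1). If \<open>row_vec\<close> has
  no spatial part, then d = 1 and every ray has factor 1.\<close>

lemma ex_nullray_contracted:
  assumes "1 \<le> m"
  shows "\<exists>s\<in>nullray m. mv m A s m \<le> 1 / A $$ (m, m)"
proof -
  let ?r = row_vec and ?d = "A $$ (m, m)"
  define \<rho> where "\<rho> = sqrt (\<Sum>i<m. (?r i)\<^sup>2)"
  have \<rho>0: "\<rho> \<ge> 0" by (simp add: \<rho>_def sum_nonneg)
  have \<rho>: "\<rho>\<^sup>2 = (\<Sum>i<m. (?r i)\<^sup>2)" unfolding \<rho>_def by (simp add: sum_nonneg)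
  have \<rho>d: "\<rho>\<^sup>2 = ?d\<^sup>2 - 1" using lp_row unfolding lp_self_eq \<rho> by simp
  have d: "?d \<ge> 1" by (rule SO_plus_diag_ge_1)
  show ?thesis
  proof (cases "\<rho> = 0")
    case True
    have "\<forall>i\<in>{..<m}. (?r i)\<^sup>2 = 0"
      using True \<rho> by (subst sum_nonneg_eq_0_iff[symmetric]) auto
    then have "lp m ?r (ray_dir m 0) = - ?d"
      using lp_row(2) by (simp add: lp_def) (simp add: ray_dir_def)
    moreover have "?d = 1" using True \<rho>d d by (simp add: power2_eq_1_iff)
    ultimately show ?thesis using ray_dir_nullray[of 0 m] assms unfolding mv_time by force
  next
    case False
    define s where "s = (\<lambda>i. if i < m then ?r i / \<rho> else if i = m then 1 else 0)"
    have "lp m s s = (\<Sum>i<m. (?r i)\<^sup>2 / \<rho>\<^sup>2) - 1"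
      by (simp add: lp_self_eq s_def power_divide)
    also have "\<dots> = 0" using False by (simp flip: sum_divide_distrib \<rho>)
    finally have s: "s \<in> nullray m" by (auto simp: nullray_def s_def)
    have "lp m ?r s = (\<Sum>i<m. (?r i)\<^sup>2 / \<rho>) - ?d"
      using lp_row(2) by (simp add: lp_def s_def power2_eq_square)
    also have "\<dots> = \<rho> - ?d" using \<rho>[symmetric] False by (simp add: power2_eq_square flip: sum_divide_distrib)
    finally have "mv m A s m = ?d - \<rho>" unfolding mv_time by simp
    also have "\<dots> \<le> 1 / ?d"
    proof -
      have "(?d - \<rho>) * (?d + \<rho>) = 1" using \<rho>d by (simp add: algebra_simps power2_eq_square)
      then have "?d - \<rho> = 1 / (?d + \<rho>)" using d \<rho>0 by (simp add: field_simps)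
      also have "\<dots> \<le> 1 / ?d" using d \<rho>0 by (intro divide_left_mono) auto
      finally show ?thesis .
    qed
    finally show ?thesis using s by blast
  qed
qed

lemma ex_nullray_expanded:
  assumes "1 \<le> m"
  shows "\<exists>s\<in>nullray m. mv m A s m \<ge> A $$ (m, m)"
proof -
  define s where "s = ray_dir m 0"
  have s: "s \<in> nullray m" using assms ray_dir_nullray by (simp add: s_def)
  have "mv m A s m + mv m A (antipode m s) m = 2 * A $$ (m, m)"
    unfolding mv_time using lp_antipode[of s m row_vec] lp_row nullrayD(1)[OF s] by simp
  then show ?thesis using s antipode_nullray[OF s]
    by (cases "mv m A s m \<ge> A $$ (m, m)") force+
qed

text \<open>The action on normalised null rays. The factor \<open>mv m A s m\<close> that is divided
  out is the stretch of the null vector; its reciprocal is the conformal factor on the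
  sphere.\<close>

definition ray_act :: "(nat \<Rightarrow> real) \<Rightarrow> nat \<Rightarrow> real" where
  "ray_act s = (\<lambda>i. if i \<le> m then mv m A s i / mv m A s m else 0)"

lemma ray_act_nullray:
  assumes "s \<in> nullray m"
  shows "ray_act s \<in> nullray m"
  unfolding ray_act_def
  using normalize_nullray[of m "mv m A s"] mv_nullray_pos[OF assms] nullrayD(2)[OF assms] lp_mv[OF A, of s s] by simp

lemma mv_ray_act:
  assumes "s \<in> nullray m"
  shows "mv m A s = (\<lambda>i. mv m A s m * ray_act s i)"
  using mv_nullray_pos[OF assms] by (auto simp: ray_act_def mv_def)

end

lemma proj_act_pp_real:
  assumes "A \<in> carrier_mat (m + 1) (m + 1)"
  shows "proj_act A (pp m x) = pp m (mv m A (x :: nat \<Rightarrow> real))"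
proof -
  have "A *\<^sub>v (c \<cdot>\<^sub>v vec (m + 1) x) = c \<cdot>\<^sub>v vec (m + 1) (mv m A x)" for c
    by (simp only: mult_mat_vec[OF assms vec_carrier] mult_mat_vec_eq[OF assms])
  then show ?thesis
    unfolding pp_def proj_pt_def proj_act_def by (simp only: setcompr_eq_image image_image)
qed

section \<open>Discrete groups with full limit set\<close>

locale lorentz_lattice =
  fixes m :: nat and \<Gamma> :: "real mat set"
  assumes sub: "subgroup \<Gamma> (SO_plus m)" and disc: "discrete_matrices (m + 1) \<Gamma>"
begin

lemma G_SO: "A \<in> \<Gamma> \<Longrightarrow> A \<in> carrier (SO_plus m)"
  using sub subgroup.mem_carrier by metis

lemma G_mult: "A \<in> \<Gamma> \<Longrightarrow> B \<in> \<Gamma> \<Longrightarrow> A * B \<in> \<Gamma>"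
  using subgroup.m_closed[OF sub, of A B] by (simp add: SO_plus_def)

lemma G_one: "1\<^sub>m (m + 1) \<in> \<Gamma>"
  using subgroup.one_closed[OF sub] by (simp add: SO_plus_def)

lemma G_adj: "A \<in> \<Gamma> \<Longrightarrow> adj m A \<in> \<Gamma>"
  using subgroup.m_inv_closed[OF sub, of A] SO_plus_inv[OF G_SO] by simp

lemma G_mat: "A \<in> \<Gamma> \<Longrightarrow> A \<in> carrier_mat (m + 1) (m + 1)"
  using G_SO SO_plus_carrierD(1) by blast

lemma G_mv_mult: "A \<in> \<Gamma> \<Longrightarrow> B \<in> \<Gamma> \<Longrightarrow> mv m (A * B) x = mv m A (mv m B x)"
  using mv_mult G_mat by blast

lemma isolated_one:
  "\<exists>e>0. \<forall>A\<in>\<Gamma>. (\<forall>i\<le>m. \<forall>j\<le>m. \<bar>A $$ (i, j) - 1\<^sub>m (m + 1) $$ (i, j)\<bar> < e) \<longrightarrow> A = 1\<^sub>m (m + 1)"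
proof (rule ccontr)
  assume neg: "\<not> ?thesis"
  have "\<exists>A. A \<in> \<Gamma> \<and> (\<forall>i\<le>m. \<forall>j\<le>m. \<bar>A $$ (i, j) - 1\<^sub>m (m + 1) $$ (i, j)\<bar> < inverse (real (Suc k))) \<and> A \<noteq> 1\<^sub>m (m + 1)" for k
    using neg by (meson inverse_positive_iff_positive of_nat_0_less_iff zero_less_Suc)
  then obtain A where A: "\<And>k. A k \<in> \<Gamma>" "\<And>k. A k \<noteq> 1\<^sub>m (m + 1)"
    and close: "\<And>k i j. i \<le> m \<Longrightarrow> j \<le> m \<Longrightarrow> \<bar>A k $$ (i, j) - 1\<^sub>m (m + 1) $$ (i, j)\<bar> < inverse (real (Suc k))"
    by metis
  have "openin (subtopology (mat_topology (m + 1) (m + 1)) \<Gamma>) {1\<^sub>m (m + 1)}"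
    using disc G_one unfolding discrete_matrices_def by simp
  then obtain T where T: "openin (mat_topology (m + 1) (m + 1)) T" "T \<inter> \<Gamma> = {1\<^sub>m (m + 1)}"
    unfolding openin_subtopology by auto
  define one where "one = (\<lambda>(i, j). if i \<le> m \<and> j \<le> m then 1\<^sub>m (m + 1) $$ (i, j) else (0::real))"
  define F where "F = (\<lambda>k (i, j). if i \<le> m \<and> j \<le> m then A k $$ (i, j) else 0)"
  have "(\<lambda>k. F k (i, j)) \<longlonglongrightarrow> one (i, j)" for i j
  proof (cases "i \<le> m \<and> j \<le> m")
    case True
    have "(\<lambda>k. A k $$ (i, j) - 1\<^sub>m (m + 1) $$ (i, j)) \<longlonglongrightarrow> 0"
    proof (rule tendsto_rabs_zero_cancel, rule tendsto_sandwich[OF _ _ tendsto_const LIMSEQ_inverse_real_of_nat])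
      show "\<forall>\<^sub>F k in sequentially. \<bar>A k $$ (i, j) - 1\<^sub>m (m + 1) $$ (i, j)\<bar> \<le> inverse (real (Suc k))"
        using close True less_imp_le by (intro always_eventually allI) blast
    qed auto
    then show ?thesis using True by (simp add: F_def one_def LIM_zero_iff)
  next
    case False
    then have "F k (i, j) = 0" "one (i, j) = 0" for k by (auto simp: F_def one_def)
    then show ?thesis by simp
  qed
  then have "F \<longlonglongrightarrow> one" by (auto simp: tendsto_fun_iff)
  moreover have m1: "mat (m + 1) (m + 1) one = 1\<^sub>m (m + 1)" by (intro eq_matI) (auto simp: one_def)
  ultimately have "\<forall>\<^sub>F k in sequentially. F k \<in> {f. mat (m + 1) (m + 1) f \<in> T}"
    using T by (intro topological_tendstoD[OF _ open_mat_vimage[OF T(1)]]) auto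
  then obtain k where "mat (m + 1) (m + 1) (F k) \<in> T" by (auto simp: eventually_sequentially)
  moreover have "mat (m + 1) (m + 1) (F k) = A k"
    using G_mat[OF A(1), of k] by (intro eq_matI) (auto simp: F_def)
  ultimately have "A k \<in> T \<inter> \<Gamma>" using A(1) by simp
  then show False unfolding T(2) using A(2) by simp
qed

text \<open>A bounded corner entry bounds all entries. Two elements in the same cell of a grid of
  mesh \<delta> have a quotient close to the identity, hence coincide by
  \<open>isolated_one\<close>; a bounded region has finitely many cells.\<close>

lemma finite_bounded: "finite {A \<in> \<Gamma>. A $$ (m, m) \<le> C}"
proof -
  from isolated_one obtain e where e0: "e > 0" and
    e1: "\<forall>A\<in>\<Gamma>. (\<forall>i\<le>m. \<forall>j\<le>m. \<bar>A $$ (i, j) - 1\<^sub>m (m + 1) $$ (i, j)\<bar> < e) \<longrightarrow> A = 1\<^sub>m (m + 1)"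
    by blast
  define C' where "C' = max C 1"
  \<comment> \<open>The quotient differs from the identity by a sum of m + 1 terms, each at most
    \<open>\<delta> * C'\<close>; the factor m + 2 leaves room for a strict inequality.\<close>
  define \<delta> where "\<delta> = e / (real (m + 2) * C')"
  have C': "C' \<ge> 1" by (simp add: C'_def)
  then have \<delta>: "\<delta> > 0" using e0 by (simp add: \<delta>_def)
  let ?S = "{A \<in> \<Gamma>. A $$ (m, m) \<le> C}" and ?I = "{..m} \<times> {..m}"
  define \<phi> where "\<phi> = (\<lambda>A. \<lambda>p\<in>?I. \<lfloor>A $$ p / \<delta>\<rfloor>)"
  have "\<phi> A \<in> PiE ?I (\<lambda>_. {\<lfloor>- C' / \<delta>\<rfloor>..\<lfloor>C' / \<delta>\<rfloor>})" if "A \<in> ?S" for A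
  proof -
    have "\<bar>A $$ (i, j)\<bar> \<le> C'" if "i \<le> m" "j \<le> m" for i j
      using SO_plus_entry_bound(1)[OF G_SO that] \<open>A \<in> ?S\<close> unfolding C'_def by fastforce
    then have "- C' \<le> A $$ (i, j)" "A $$ (i, j) \<le> C'" if "i \<le> m" "j \<le> m" for i j
      using that by (simp_all add: abs_le_iff minus_le_iff)
    then have "- C' / \<delta> \<le> A $$ (i, j) / \<delta>" "A $$ (i, j) / \<delta> \<le> C' / \<delta>" if "i \<le> m" "j \<le> m" for i j
      using that \<delta> by (intro divide_right_mono; simp)+
    then have "\<lfloor>- C' / \<delta>\<rfloor> \<le> \<lfloor>A $$ (i, j) / \<delta>\<rfloor>" "\<lfloor>A $$ (i, j) / \<delta>\<rfloor> \<le> \<lfloor>C' / \<delta>\<rfloor>" if "i \<le> m" "j \<le> m" for i j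
      using that by (blast intro: floor_mono)+
    then show ?thesis by (simp add: \<phi>_def PiE_iff)
  qed
  then have "\<phi> ` ?S \<subseteq> PiE ?I (\<lambda>_. {\<lfloor>- C' / \<delta>\<rfloor>..\<lfloor>C' / \<delta>\<rfloor>})" by blast
  then have fin: "finite (\<phi> ` ?S)" by (rule finite_subset) (auto intro!: finite_PiE)
  have "inj_on \<phi> ?S"
  proof (rule inj_onI)
    fix A B assume AB: "A \<in> ?S" "B \<in> ?S" "\<phi> A = \<phi> B"
    note mA = G_mat[of A] and mB = G_mat[of B]
    have close: "\<bar>A $$ (i, j) - B $$ (i, j)\<bar> < \<delta>" if "i \<le> m" "j \<le> m" for i j
    proof -
      have "\<lfloor>A $$ (i, j) / \<delta>\<rfloor> = \<lfloor>B $$ (i, j) / \<delta>\<rfloor>"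
        using fun_cong[OF AB(3), of "(i, j)"] that by (simp add: \<phi>_def)
      then have "\<bar>A $$ (i, j) / \<delta> - B $$ (i, j) / \<delta>\<bar> < 1" by linarith
      then have "\<bar>A $$ (i, j) - B $$ (i, j)\<bar> / \<delta> < 1"
        using \<delta> by (simp add: diff_divide_distrib[symmetric] abs_divide)
      then show ?thesis using \<delta> by (simp add: field_simps)
    qed
    let ?B' = "adj m B"
    have B1: "B * ?B' = 1\<^sub>m (m + 1)" "?B' * B = 1\<^sub>m (m + 1)"
      using adj_mult_right[OF G_SO] adj_mult_left[OF G_SO] AB by auto
    have "A * ?B' = 1\<^sub>m (m + 1)"
    proof (rule e1[rule_format])
      show "A * ?B' \<in> \<Gamma>" using AB G_mult G_adj by blast
      fix i j assume ij: "i \<le> m" "j \<le> m"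
      have ent: "(X * ?B') $$ (i, j) = (\<Sum>k\<le>m. X $$ (i, k) * ?B' $$ (k, j))" if "X \<in> carrier_mat (m + 1) (m + 1)" for X
        using that ij adj_carrier[of m B] by (auto simp: scalar_prod_def atLeast0LessThan lessThan_Suc_atMost)
      have "\<bar>(A * ?B') $$ (i, j) - 1\<^sub>m (m + 1) $$ (i, j)\<bar> = \<bar>\<Sum>k\<le>m. (A $$ (i, k) - B $$ (i, k)) * ?B' $$ (k, j)\<bar>"
        using AB mA mB unfolding B1(1)[symmetric] by (simp only: ent mem_Collect_eq sum_subtractf left_diff_distrib)
      also have "\<dots> \<le> (\<Sum>k\<le>m. \<delta> * C')"
      proof (rule order_trans[OF sum_abs], rule sum_mono)
        fix k assume "k \<in> {..m}"
        then have "\<bar>?B' $$ (k, j)\<bar> \<le> C'"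
          using SO_plus_entry_bound(1)[OF G_SO[OF G_adj], of B k j] AB ij unfolding C'_def by fastforce
        then show "\<bar>(A $$ (i, k) - B $$ (i, k)) * ?B' $$ (k, j)\<bar> \<le> \<delta> * C'"
          using close[OF ij(1), of k] \<open>k \<in> {..m}\<close> \<delta> unfolding abs_mult by (intro mult_mono) auto
      qed
      also have "\<dots> < real (m + 2) * (\<delta> * C')" using \<delta> C' by simp
      also have "\<dots> = e" using C' by (simp add: \<delta>_def)
      finally show "\<bar>(A * ?B') $$ (i, j) - 1\<^sub>m (m + 1) $$ (i, j)\<bar> < e" .
    qed
    then have "A * ?B' * B = 1\<^sub>m (m + 1) * B" by simp
    moreover have "A * ?B' * B = A * (?B' * B)"
      using assoc_mult_mat[of A _ _ ?B' _ B] mA mB adj_carrier[of m B] AB by blast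
    ultimately show "A = B" using B1 mA mB AB
      by (metis (no_types, lifting) left_mult_one_mat mem_Collect_eq right_mult_one_mat)
  qed
  then show ?thesis using fin finite_imageD by blast
qed

end

lemma proj_derived_set_infinite:
  fixes U :: "'a::real_normed_field vec set set"
  assumes "x \<in> proj_space n derived_set_of S" "openin (proj_space n) U" "x \<in> U"
  shows "infinite (S \<inter> U)"
proof -
  have "proj_space n derived_set_of S
      = {x \<in> topspace (proj_space n). \<forall>U. x \<in> U \<and> openin (proj_space n) U \<longrightarrow> infinite (S \<inter> U)}"
    using t1_space_derived_set_of_infinite_openin[THEN iffD1, OF t1_space_proj] by blast
  then show ?thesis using assms by blast
qed

locale full_lorentz_lattice = lorentz_lattice +
  assumes m2: "2 \<le> m" and full: "limit_set m \<Gamma> = sphere_at_infinity m"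
begin

lemma nullray_limit:
  assumes s: "s \<in> nullray m"
  obtains x where "lp m x x < 0" "x m > 0"
    "pp m s \<in> proj_space m derived_set_of ((\<lambda>A. pp m (mv m A x)) ` \<Gamma>)"
proof -
  have snz: "s \<in> nz m" using nullrayD(1)[OF s] by (auto simp: nz_def)
  have "pp m s \<in> sphere_at_infinity m"
    unfolding sphere_at_infinity_def pp_def using snz nullrayD(2)[OF s]
    by (intro imageI) (simp add: vec_in_nonzero_vecs[simplified] lorentz_vec[simplified])
  then obtain z where z: "z \<in> hyp_space m" and d: "pp m s \<in> proj_space m derived_set_of ((\<lambda>A. proj_act A z) ` \<Gamma>)"
    using full unfolding limit_set_def by blast
  obtain v where v: "v \<in> nonzero_vecs (m + 1)" "lorentz m v v < 0" "z = proj_pt v"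
    using z unfolding hyp_space_def by blast
  define y where "y = vec_index v"
  have vy: "v = vec (m + 1) y" using v by (auto simp: y_def nonzero_vecs_def)
  then have zy: "z = pp m y" "y \<in> nz m" "lp m y y < 0"
    using v vec_in_nonzero_vecs lorentz_vec by (auto simp: pp_def)
  have ym: "y m \<noteq> 0"
  proof
    assume "y m = 0"
    then have "lp m y y \<ge> 0" by (simp add: lp_self_eq sum_nonneg)
    then show False using zy by simp
  qed
  define x where "x = (\<lambda>i. sgn (y m) * y i)"
  have "lp m x x = (sgn (y m) * sgn (y m)) * lp m y y"
    unfolding x_def lp_linear by simp
  then have "lp m x x < 0" using zy ym by (simp add: sgn_real_def)
  moreover have "x m > 0" using ym by (simp add: x_def sgn_real_def)
  moreover have "z = pp m x" using zy ym pp_scale[of "sgn (y m)" y m] by (simp add: x_def sgn_eq_0_iff)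
  moreover have "(\<lambda>A. proj_act A z) ` \<Gamma> = (\<lambda>A. pp m (mv m A x)) ` \<Gamma>"
    using \<open>z = pp m x\<close> proj_act_pp_real[OF G_mat] by (intro image_cong) auto
  ultimately show ?thesis using d that by metis
qed

text \<open>The orbit provided by \<open>nullray_limit\<close> starts at a point depending on
  \<open>s\<close>. It is traded for the orbit of the base vector: the form between the two images
  is constant while their time coordinates grow with \<open>A\<close>, so by
  \<open>lp_direction\<close> their directions merge.\<close>

lemma ex_attracting:
  assumes s: "s \<in> nullray m" and e: "e > 0"
  shows "\<exists>A\<in>\<Gamma>. C < A $$ (m, m) \<and> (\<forall>i<m. \<bar>A $$ (i, m) / A $$ (m, m) - s i\<bar> < e)"
proof -
  from nullray_limit[OF s] obtain x where x: "lp m x x < 0" "x m > 0"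
    and lim: "pp m s \<in> proj_space m derived_set_of ((\<lambda>A. pp m (mv m A x)) ` \<Gamma>)" .
  define \<sigma> where "\<sigma> = sqrt (- lp m x x)"
  have \<sigma>: "\<sigma> > 0" using x by (simp add: \<sigma>_def)
  \<comment> \<open>\<sigma> bounds the time coordinates along the orbit of \<open>x\<close> from
    below. The last entry of the maximum makes 2 x_m / (\<sigma> D) at most (e/2)^2.\<close>
  define D where "D = Max {1, C, 8 * x m / (\<sigma> * e\<^sup>2)}"
  define V where "V = {f :: nat \<Rightarrow> real. f m \<noteq> 0} \<inter> (\<Inter>i\<in>{..<m}. {f. \<bar>f i - s i * f m\<bar> < e / 2 * \<bar>f m\<bar>})"
  have "open {f :: nat \<Rightarrow> real. \<bar>f i - s i * f m\<bar> < e / 2 * \<bar>f m\<bar>}" for i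
    by (intro open_Collect_less continuous_intros continuous_on_component)
  moreover have "open {f :: nat \<Rightarrow> real. f m \<noteq> 0}"
    by (intro open_Collect_neq continuous_intros continuous_on_component)
  ultimately have "open V" unfolding V_def by (intro open_Int open_INT ballI) auto
  then have U: "openin (proj_space m) (pp m ` (V \<inter> nz m))" by (rule openin_pp_image)
  have "s \<in> V \<inter> nz m" using nullrayD(1)[OF s] e by (auto simp: V_def nz_def)
  then have "infinite ((\<lambda>A. pp m (mv m A x)) ` \<Gamma> \<inter> pp m ` (V \<inter> nz m))"
    by (intro proj_derived_set_infinite[OF lim U] imageI)
  \<comment> \<open>Elements of bounded size contribute finitely many orbit points, so the
    infinitely many points near \<open>s\<close> include one from a larger element.\<close>
  moreover have "finite ((\<lambda>A. pp m (mv m A x)) ` {A \<in> \<Gamma>. A $$ (m, m) \<le> D})"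
    using finite_bounded by blast
  ultimately obtain q where q: "q \<in> (\<lambda>A. pp m (mv m A x)) ` \<Gamma> \<inter> pp m ` (V \<inter> nz m)"
    "q \<notin> (\<lambda>A. pp m (mv m A x)) ` {A \<in> \<Gamma>. A $$ (m, m) \<le> D}"
    by (meson finite_subset subsetI)
  then obtain A where A: "A \<in> \<Gamma>" "q = pp m (mv m A x)" by blast
  then have A: "A \<in> \<Gamma>" "D < A $$ (m, m)" "pp m (mv m A x) \<in> pp m ` (V \<inter> nz m)"
    using q by (auto simp: not_le[symmetric])
  note SO = G_SO[OF A(1)]
  let ?y = "mv m A x" and ?c = "mv m A (em m) :: nat \<Rightarrow> real" and ?d = "A $$ (m, m)"
  have ym: "?y m > 0" using mv_time_pos[OF SO] x by simp
  have D: "D \<ge> 1" "D \<ge> C" "D \<ge> 8 * x m / (\<sigma> * e\<^sup>2)" by (simp_all add: D_def)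
  have "?y \<in> nz m" using ym by (auto simp: nz_def intro!: exI[of _ m])
  then obtain f c where f: "f \<in> V" "c \<noteq> 0" "\<forall>i\<le>m. ?y i = c * f i"
    using A(3) pp_eq_iff by blast
  have close1: "\<bar>?y i / ?y m - s i\<bar> < e / 2" if "i < m" for i
  proof -
    have "f m \<noteq> 0" "\<bar>f i - s i * f m\<bar> < e / 2 * \<bar>f m\<bar>" using f that by (auto simp: V_def)
    then have "\<bar>(f i - s i * f m) / f m\<bar> < e / 2" by (simp add: abs_divide field_simps)
    moreover have "(f i - s i * f m) / f m = ?y i / ?y m - s i"
      using f that \<open>f m \<noteq> 0\<close> by (simp add: field_simps)
    ultimately show ?thesis by simp
  qed
  have \<sigma>y: "\<sigma> \<le> ?y m"
  proof -
    have "(?y m)\<^sup>2 = (\<Sum>i<m. (?y i)\<^sup>2) - lp m x x" using lp_mv[OF SO, of x x] by (simp add: lp_self_eq)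
    then have "- lp m x x \<le> (?y m)\<^sup>2" by (simp add: sum_nonneg)
    then show ?thesis unfolding \<sigma>_def using ym by (intro real_le_lsqrt) auto
  qed
  have "\<bar>?y i / ?y m - ?c i / ?c m\<bar> \<le> e / 2" if "i < m" for i
  proof -
    have "(?y i / ?y m - ?c i / ?c m)\<^sup>2 \<le> (\<Sum>i<m. (?y i / ?y m - ?c i / ?c m)\<^sup>2)"
      by (rule member_le_sum) (use that in auto)
    also have "\<dots> = lp m x x / (?y m)\<^sup>2 + (- 1) / ?d\<^sup>2 - 2 * lp m x (em m) / (?y m * ?d)"
      using lp_direction[of ?y m ?c] ym D A by (simp add: lp_mv[OF SO] mv_em)
    also have "\<dots> \<le> 2 * x m / (?y m * ?d)"
    proof -
      have "lp m x x / (?y m)\<^sup>2 \<le> 0" "(- 1) / ?d\<^sup>2 \<le> 0" using x by (auto simp: divide_le_0_iff)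
      moreover have "2 * lp m x (em m) / (?y m * ?d) = - (2 * x m / (?y m * ?d))"
        by (simp add: lp_em_right)
      ultimately show ?thesis by linarith
    qed
    also have "\<dots> \<le> 2 * x m / (\<sigma> * D)"
      using x \<sigma> D A \<sigma>y by (intro divide_left_mono mult_mono) auto
    also have "\<dots> \<le> (e / 2)\<^sup>2"
    proof -
      have "8 * x m \<le> D * (\<sigma> * e\<^sup>2)" using D(3) \<sigma> e by (simp add: field_simps)
      then show ?thesis using \<sigma> D(1) e by (simp add: field_simps power2_eq_square)
    qed
    finally have "\<bar>?y i / ?y m - ?c i / ?c m\<bar> \<le> \<bar>e / 2\<bar>"
      by (simp only: abs_le_square_iff)
    then show ?thesis using e by simp
  qed
  note close2 = this
  have "\<bar>?c i / ?c m - s i\<bar> < e" if "i < m" for i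
    using close1[OF that] close2[OF that] by linarith
  then have "\<forall>i<m. \<bar>A $$ (i, m) / ?d - s i\<bar> < e" by (simp add: mv_em)
  then show ?thesis using A D by force
qed

end

section \<open>Fixed rays of large isometries\<close>

lemma square_le_of_le: "a\<^sup>2 \<le> b\<^sup>2 \<Longrightarrow> 0 \<le> b \<Longrightarrow> \<bar>a :: real\<bar> \<le> b"
  using abs_le_square_iff[of a b] by simp

lemma component_le_sum_squares:
  fixes g :: "nat \<Rightarrow> real"
  assumes "i < m" "(\<Sum>i<m. (g i)\<^sup>2) \<le> r\<^sup>2" "0 \<le> r"
  shows "\<bar>g i\<bar> \<le> r"
proof (rule square_le_of_le)
  have "(g i)\<^sup>2 \<le> (\<Sum>i<m. (g i)\<^sup>2)" by (rule member_le_sum) (use assms in auto)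
  then show "(g i)\<^sup>2 \<le> r\<^sup>2" using assms by simp
qed (use assms in simp)

lemma convergent_geometric:
  fixes x :: "nat \<Rightarrow> real"
  assumes "\<And>k. \<bar>x (Suc k) - x k\<bar> \<le> C * (1 / 2) ^ k"
  shows "convergent x"
proof -
  have "summable (\<lambda>k. x (Suc k) - x k)"
    by (rule summable_comparison_test'[of "\<lambda>k. C * (1 / 2) ^ k" 0])
      (use assms in \<open>auto intro!: summable_mult summable_geometric\<close>)
  then have "convergent (\<lambda>n. \<Sum>k<n. x (Suc k) - x k)" by (simp add: summable_iff_convergent)
  then have "convergent (\<lambda>n. x n - x 0)" by (simp add: sum_lessThan_telescope)
  then obtain l where "(\<lambda>n. x n - x 0) \<longlonglongrightarrow> l" by (auto simp: convergent_def)
  then have "(\<lambda>n. x n - x 0 + x 0) \<longlonglongrightarrow> l + x 0" by (intro tendsto_intros)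
  then show ?thesis by (auto simp: convergent_def)
qed

lemma tendsto_mv:
  fixes x :: "'b \<Rightarrow> nat \<Rightarrow> 'a::real_normed_field"
  assumes "\<And>i. i \<le> m \<Longrightarrow> ((\<lambda>k. x k i) \<longlongrightarrow> y i) F"
  shows "((\<lambda>k. mv m A (x k) i) \<longlongrightarrow> mv m A y i) F"
proof (cases "i \<le> m")
  case True
  then show ?thesis unfolding mv_def by (simp only: if_True) (intro tendsto_intros assms, simp)
qed (simp add: mv_def)

text \<open>The image of the base point in the ball model. For large \<open>A\<close> it is close to
  the sphere, at the attracting end for \<open>A\<close> and at the repelling end for
  \<open>adj m A\<close>.\<close>

definition col_dir :: "nat \<Rightarrow> real mat \<Rightarrow> nat \<Rightarrow> real" where
  "col_dir m A = (\<lambda>i. if i \<le> m then A $$ (i, m) / A $$ (m, m) else 0)"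

lemma col_dir_time: "A \<in> carrier (SO_plus m) \<Longrightarrow> col_dir m A m = 1"
  using SO_plus_diag_ge_1[of A m] by (simp add: col_dir_def)

lemma mv_em_col_dir:
  assumes A: "A \<in> carrier (SO_plus m)"
  shows "mv m A (em m) = (\<lambda>i. A $$ (m, m) * col_dir m A i)"
proof
  fix i
  show "mv m A (em m) i = A $$ (m, m) * col_dir m A i"
  proof (cases "i \<le> m")
    case True
    then show ?thesis using SO_plus_diag_ge_1[OF A] by (simp add: mv_em col_dir_def)
  next
    case False
    then show ?thesis by (simp add: mv_def col_dir_def)
  qed
qed

lemma lp_col_dir:
  assumes A: "A \<in> carrier (SO_plus m)"
  shows "lp m (col_dir m A) (col_dir m A) = - (1 / (A $$ (m, m))\<^sup>2)"
proof -
  have "(A $$ (m, m))\<^sup>2 * lp m (col_dir m A) (col_dir m A) = - 1"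
    using lp_col[OF A] unfolding mv_em_col_dir[OF A] lp_linear by (simp add: power2_eq_square mult.assoc)
  then show ?thesis using SO_plus_diag_ge_1[OF A] by (simp add: field_simps)
qed

lemma mv_time_col_dir:
  assumes A: "A \<in> carrier (SO_plus m)"
  shows "mv m A x m = - (A $$ (m, m) * lp m (col_dir m (adj m A)) x)"
  unfolding mv_time mv_em_col_dir[OF adj_in_SO_plus[OF A]] by (simp add: lp_linear)

lemma col_dir_sq:
  assumes A: "A \<in> carrier (SO_plus m)"
  shows "(\<Sum>i<m. (col_dir m A i)\<^sup>2) \<le> 1"
proof -
  have "0 \<le> 1 / (A $$ (m, m))\<^sup>2" by simp
  moreover have "(\<Sum>i<m. (col_dir m A i)\<^sup>2) - 1 = - (1 / (A $$ (m, m))\<^sup>2)"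
    using lp_col_dir[OF A] unfolding lp_self_eq col_dir_time[OF A] power_one .
  ultimately show ?thesis by linarith
qed

lemma lp_col_dir_diff:
  assumes A: "A \<in> carrier (SO_plus m)" and s: "s \<in> nullray m"
  shows "(\<Sum>i<m. (s i - col_dir m A i)\<^sup>2) \<le> - 2 * lp m s (col_dir m A)"
proof -
  have "0 \<le> 1 / (A $$ (m, m))\<^sup>2" by simp
  moreover have "(\<Sum>i<m. (s i - col_dir m A i)\<^sup>2) = - (1 / (A $$ (m, m))\<^sup>2) - 2 * lp m s (col_dir m A)"
    using lp_direction[of s m "col_dir m A"] col_dir_time[OF A] lp_col_dir[OF A] nullrayD[OF s] by simp
  ultimately show ?thesis by linarith
qed

lemma nullray_lp_ge:
  assumes "s \<in> nullray m" "t \<in> nullray m"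
  shows "- 2 \<le> lp m s t"
  using lp_antipode[of t m s] nullrayD(1)[OF assms(1)] nullrayD(1)[OF assms(2)]
    nullray_lp_le[OF assms(1) antipode_nullray[OF assms(2)]] by simp

text \<open>The form between \<open>s\<close> and the base vector is -1 and is preserved. Hence a
  ray is sent close to \<open>col_dir m A\<close> as soon as its stretch factor is not too
  small.\<close>

lemma act_close_to_col_dir:
  assumes A: "A \<in> carrier (SO_plus m)" and s: "s \<in> nullray m"
  shows "- lp m (ray_act m A s) (col_dir m A) = 1 / (mv m A s m * A $$ (m, m))"
proof -
  have "lp m (mv m A s) (mv m A (em m)) = - 1"
    using lp_mv[OF A, of s "em m"] nullrayD(1)[OF s] by (simp add: lp_em_right)
  then have "mv m A s m * (A $$ (m, m) * lp m (ray_act m A s) (col_dir m A)) = - 1"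
    unfolding mv_em_col_dir[OF A] by (subst (asm) mv_ray_act[OF A s]) (simp add: lp_linear)
  then show ?thesis using SO_plus_diag_ge_1[OF A] mv_nullray_pos[OF A s] by (simp add: field_simps)
qed

lemma lp_ray_act:
  assumes A: "A \<in> carrier (SO_plus m)" and s: "s \<in> nullray m" "t \<in> nullray m"
  shows "lp m (ray_act m A s) (ray_act m A t) = lp m s t / (mv m A s m * mv m A t m)"
proof -
  have "lp m s t = lp m (mv m A s) (mv m A t)" by (simp add: lp_mv[OF A])
  also have "\<dots> = mv m A s m * (mv m A t m * lp m (ray_act m A s) (ray_act m A t))"
    by (subst mv_ray_act[OF A s(1)], subst mv_ray_act[OF A s(2)]) (simp add: lp_linear)
  finally show ?thesis using mv_nullray_pos[OF A s(1)] mv_nullray_pos[OF A s(2)] by (simp add: field_simps)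
qed

text \<open>On the sphere at infinity an isometry multiplies squared chordal distances by
  \<open>1 / (\<kappa>(s) \<kappa>(t))\<close>, where \<open>\<kappa>\<close> is the time coordinate of the image; it therefore contracts the
  complement of a neighbourhood of its repelling direction into itself.\<close>

lemma ex_attracting_fixed_ray:
  assumes A: "A \<in> carrier (SO_plus m)" and m: "1 \<le> m"
    and \<eta>: "0 < \<eta>" "\<eta> \<le> 2" "\<eta> \<le> - lp m (col_dir m A) (col_dir m (adj m A))"
    and d: "8 / \<eta>\<^sup>2 \<le> A $$ (m, m)"
  shows "\<exists>s\<in>nullray m. \<exists>\<kappa>>1. mv m A s = (\<lambda>i. \<kappa> * s i) \<and>
    (\<Sum>i<m. (s i - col_dir m A i)\<^sup>2) \<le> 4 / (\<eta> * (A $$ (m, m))\<^sup>2)"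
proof -
  let ?d = "A $$ (m, m)" and ?\<tau> = "col_dir m A" and ?\<beta> = "col_dir m (adj m A)"
  let ?k = "\<lambda>s. mv m A s m"
  define R where "R = {s \<in> nullray m. \<eta> / 2 \<le> - lp m ?\<beta> s}"
  note A' = adj_in_SO_plus[OF A]
  have d1: "?d \<ge> 1" by (rule SO_plus_diag_ge_1[OF A])
  have d\<eta>: "8 / \<eta> \<le> ?d * \<eta>"
  proof -
    have "8 / \<eta> = (8 / \<eta>\<^sup>2) * \<eta>" using \<eta> by (simp add: power2_eq_square)
    also have "\<dots> \<le> ?d * \<eta>" using d \<eta> by (intro mult_right_mono) auto
    finally show ?thesis .
  qed
  have d2: "2 \<le> ?d * \<eta> / 2"
  proof -
    have "4 \<le> 8 / \<eta>" using \<eta> by (simp add: field_simps)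
    then show ?thesis using d\<eta> by simp
  qed
  have k: "?d * \<eta> / 2 \<le> ?k s" if "s \<in> R" for s
  proof -
    have "?d * (\<eta> / 2) \<le> ?d * (- lp m ?\<beta> s)"
      using that d1 by (intro mult_left_mono) (auto simp: R_def)
    then show ?thesis unfolding mv_time_col_dir[OF A] by simp
  qed
  have near: "(\<Sum>i<m. (ray_act m A s i - ?\<tau> i)\<^sup>2) \<le> 4 / (\<eta> * ?d\<^sup>2)" if "s \<in> R" for s
  proof -
    have s: "s \<in> nullray m" using that by (simp add: R_def)
    have "(\<Sum>i<m. (ray_act m A s i - ?\<tau> i)\<^sup>2) \<le> 2 / (?k s * ?d)"
      using lp_col_dir_diff[OF A ray_act_nullray[OF A s]] act_close_to_col_dir[OF A s] by simp
    also have "\<dots> \<le> 2 / (?d * \<eta> / 2 * ?d)"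
      using k[OF that] d1 \<eta> mv_nullray_pos[OF A s] by (intro divide_left_mono mult_right_mono mult_pos_pos) auto
    finally show ?thesis by (simp add: power2_eq_square mult_ac)
  qed
  \<comment> \<open>The image is close to \<open>?\<tau>\<close>, whose margin from the repelling
    direction is \<eta>; by Cauchy-Schwarz at most half of the margin is lost.\<close>
  have RR: "ray_act m A s \<in> R" if "s \<in> R" for s
  proof -
    have s: "s \<in> nullray m" using that by (simp add: R_def)
    let ?t = "ray_act m A s"
    have t: "?t \<in> nullray m" by (rule ray_act_nullray[OF A s])
    have e: "lp m ?\<beta> ?t = lp m ?\<beta> ?\<tau> + (\<Sum>i<m. ?\<beta> i * (?t i - ?\<tau> i))"
      using nullrayD(1)[OF t] col_dir_time[OF A]
      by (simp add: lp_def algebra_simps sum_subtractf)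
    have "\<bar>\<Sum>i<m. ?\<beta> i * (?t i - ?\<tau> i)\<bar> \<le> \<eta> / 2"
    proof (rule square_le_of_le)
      have "(\<Sum>i<m. ?\<beta> i * (?t i - ?\<tau> i))\<^sup>2 \<le> (\<Sum>i<m. (?\<beta> i)\<^sup>2) * (\<Sum>i<m. (?t i - ?\<tau> i)\<^sup>2)"
        by (rule Cauchy_Schwarz_ineq_sum)
      also have "\<dots> \<le> 1 * (4 / (\<eta> * ?d\<^sup>2))"
        by (intro mult_mono near[OF that] col_dir_sq[OF A']) (auto intro: sum_nonneg)
      also have "\<dots> \<le> (\<eta> / 2)\<^sup>2"
      proof -
        have "(8 / \<eta>) * (8 / \<eta>) \<le> (?d * \<eta>) * (?d * \<eta>)"
          using d\<eta> \<eta> d2 by (intro mult_mono) auto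
        then have "64 \<le> (?d * ?d) * (\<eta> * \<eta> * \<eta> * \<eta>)"
          using \<eta> by (simp add: field_simps)
        also have "\<dots> \<le> (?d * ?d) * (\<eta> * \<eta> * \<eta> * 2)"
          using \<eta> d1 by (intro mult_left_mono) auto
        also have "\<dots> = 2 * ((?d * ?d) * (\<eta> * \<eta> * \<eta>))" by simp
        finally have "16 \<le> (?d * ?d) * (\<eta> * \<eta> * \<eta>)" by linarith
        then show ?thesis using \<eta> d1 by (simp add: field_simps power2_eq_square)
      qed
      finally show "(\<Sum>i<m. ?\<beta> i * (?t i - ?\<tau> i))\<^sup>2 \<le> (\<eta> / 2)\<^sup>2" .
    qed (use \<eta> in simp)
    then have "\<eta> / 2 \<le> - lp m ?\<beta> ?t"
      using \<eta>(3) unfolding e lp_commute[of m ?\<tau> ?\<beta>] by linarith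
    then show ?thesis using t by (simp add: R_def)
  qed
  \<comment> \<open>The pairings of an opposite pair with \<open>?\<beta>\<close> add up to -2, so
    one is at most -1, while \<eta> / 2 is at most 1.\<close>
  obtain s0 where s0: "s0 \<in> R"
  proof -
    let ?r = "ray_dir m 0"
    have r: "?r \<in> nullray m" using m by (intro ray_dir_nullray) auto
    have "lp m ?\<beta> ?r + lp m ?\<beta> (antipode m ?r) = - 2"
      using lp_antipode[of ?r m ?\<beta>] nullrayD(1)[OF r] col_dir_time[OF A'] by simp
    then have "lp m ?\<beta> ?r \<le> - 1 \<or> lp m ?\<beta> (antipode m ?r) \<le> - 1" by linarith
    then show ?thesis using that r antipode_nullray[OF r] \<eta> unfolding R_def by fastforce
  qed
  define s where "s = (\<lambda>k. (ray_act m A ^^ k) s0)"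
  have sR: "s k \<in> R" for k by (induction k) (auto simp: s_def s0 RR)
  have sn: "s k \<in> nullray m" for k using sR by (simp add: R_def)
  have sS: "s (Suc k) = ray_act m A (s k)" for k by (simp add: s_def)
  \<comment> \<open>Both stretch factors in the denominator are at least 2, so the squared distance
    of consecutive iterates shrinks by a factor 4.\<close>
  have D: "- lp m (s k) (s (Suc k)) \<le> 2 * (1 / 4) ^ k" for k
  proof (induction k)
    case 0
    then show ?case using nullray_lp_ge[OF sn sn, of 0 1] by simp
  next
    case (Suc k)
    have "- lp m (s (Suc k)) (s (Suc (Suc k))) = - lp m (s k) (s (Suc k)) / (?k (s k) * ?k (s (Suc k)))"
      using lp_ray_act[OF A sn sn, of k "Suc k"] by (simp only: sS minus_divide_left)
    also have "\<dots> \<le> - lp m (s k) (s (Suc k)) / (2 * 2)"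
      using k[OF sR, of k] k[OF sR, of "Suc k"] d2 nullray_lp_le[OF sn sn, of k "Suc k"]
      by (intro divide_left_mono mult_mono) auto
    also have "\<dots> \<le> 2 * (1 / 4) ^ Suc k" using Suc by simp
    finally show ?case .
  qed
  have "convergent (\<lambda>k. s k i)" for i
  proof (cases "i < m")
    case True
    have "\<bar>s k i - s (Suc k) i\<bar> \<le> 2 * (1 / 2) ^ k" for k
    proof (rule component_le_sum_squares[OF True])
      have "(\<Sum>i<m. (s k i - s (Suc k) i)\<^sup>2) \<le> 2 * (2 * (1 / 4) ^ k)"
        using nullray_lp[OF sn sn, of k "Suc k"] D[of k] by simp
      also have "\<dots> = (2 * (1 / 2) ^ k)\<^sup>2"
      proof -
        have "(1 / 4 :: real) ^ k = (1 / 2) ^ k * (1 / 2) ^ k" by (simp flip: power_mult_distrib)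
        then show ?thesis by (simp add: power2_eq_square)
      qed
      finally show "(\<Sum>i<m. (s k i - s (Suc k) i)\<^sup>2) \<le> (2 * (1 / 2) ^ k)\<^sup>2" .
    qed simp
    then show ?thesis by (intro convergent_geometric[of _ 2]) (simp add: abs_minus_commute)
  next
    case False
    then have "s k i = (if i = m then 1 else 0)" for k using nullrayD(1)[OF sn, of k] nullrayD(3)[OF sn, of i k] by auto
    then show ?thesis by (simp add: convergent_const)
  qed
  then obtain t where t: "\<And>i. (\<lambda>k. s k i) \<longlonglongrightarrow> t i"
    unfolding convergent_def by metis
  have tn: "t \<in> nullray m"
  proof (rule nullray_tendsto_closed[OF sn t])
    fix i assume "i > m"
    then show "t i = 0" using t[of i] nullrayD(3)[OF sn] by (simp add: LIMSEQ_const_iff)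
  qed
  have "(\<lambda>k. lp m ?\<beta> (s k)) \<longlonglongrightarrow> lp m ?\<beta> t" by (intro tendsto_intros t)
  moreover have "lp m ?\<beta> (s k) \<le> - (\<eta> / 2)" for k using sR[of k] by (simp add: R_def)
  ultimately have "lp m ?\<beta> t \<le> - (\<eta> / 2)" by (intro LIMSEQ_le_const2) auto
  then have tR: "t \<in> R" using tn by (simp add: R_def)
  have kt: "?k t > 1" using k[OF tR] d2 by simp
  have "ray_act m A t = t"
  proof
    fix i
    show "ray_act m A t i = t i"
    proof (cases "i \<le> m")
      case True
      have "(\<lambda>k. mv m A (s k) i / ?k (s k)) \<longlonglongrightarrow> mv m A t i / ?k t"
        using kt by (intro tendsto_divide tendsto_mv t) auto
      moreover have "(\<lambda>k. s (Suc k) i) \<longlonglongrightarrow> t i" using t LIMSEQ_Suc by blast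
      ultimately show ?thesis
        using True LIMSEQ_unique by (auto simp: sS ray_act_def[OF A])
    next
      case False
      then show ?thesis using nullrayD(3)[OF tn] by (simp add: ray_act_def[OF A])
    qed
  qed
  then have "mv m A t = (\<lambda>i. ?k t * t i)" "(\<Sum>i<m. (t i - ?\<tau> i)\<^sup>2) \<le> 4 / (\<eta> * ?d\<^sup>2)"
    using mv_ray_act[OF A tn] near[OF tR] by simp_all
  then show ?thesis using tn kt by blast
qed

lemma adj_mult:
  assumes "A \<in> carrier_mat (m + 1) (m + 1)" "B \<in> carrier_mat (m + 1) (m + 1)"
  shows "adj m (A * B) = adj m B * adj m A"
proof (rule eq_matI)
  fix i j assume "i < dim_row (adj m B * adj m A)" "j < dim_col (adj m B * adj m A)"
  then have ij: "i \<le> m" "j \<le> m" by (auto simp: adj_def)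
  have prod: "(X * Y) $$ (i, j) = (\<Sum>k\<le>m. X $$ (i, k) * Y $$ (k, j))"
    if "X \<in> carrier_mat (m + 1) (m + 1)" "Y \<in> carrier_mat (m + 1) (m + 1)" "i \<le> m" "j \<le> m" for X Y :: "real mat" and i j
    using that by (auto simp: scalar_prod_def atLeast0LessThan lessThan_Suc_atMost)
  have "adj m (A * B) $$ (i, j) = lsign m i * lsign m j * (\<Sum>k\<le>m. A $$ (j, k) * B $$ (k, i))"
    using ij assms by (simp only: adj_index prod)
  also have "\<dots> = (\<Sum>k\<le>m. adj m B $$ (i, k) * adj m A $$ (k, j))"
    unfolding sum_distrib_left
    by (rule sum.cong) (use ij in \<open>auto simp: adj_index lsign_def\<close>)
  also have "\<dots> = (adj m B * adj m A) $$ (i, j)"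
    using ij by (simp only: prod adj_carrier)
  finally show "adj m (A * B) $$ (i, j) = (adj m B * adj m A) $$ (i, j)" .
qed (use assms in \<open>auto simp: adj_def\<close>)

lemma col_dir_abs_le:
  assumes "A \<in> carrier (SO_plus m)"
  shows "\<bar>col_dir m A i\<bar> \<le> 1"
proof -
  consider "i < m" | "i = m" | "i > m" by linarith
  then show ?thesis
  proof cases
    case 1
    then show ?thesis using component_le_sum_squares[of i m "col_dir m A" 1] col_dir_sq[OF assms] by simp
  next
    case 2
    then show ?thesis using col_dir_time[OF assms] by simp
  next
    case 3
    then show ?thesis by (simp add: col_dir_def)
  qed
qed

context lorentz_lattice
begin

text \<open>\<open>e\<close> is the attracting and \<open>e'\<close> the repelling fixed ray.
  Describing the latter through the inverse makes the notion symmetric under inversion.\<close>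

definition lox :: "real mat \<Rightarrow> (nat \<Rightarrow> real) \<Rightarrow> (nat \<Rightarrow> real) \<Rightarrow> bool" where
  "lox A e e' \<longleftrightarrow> A \<in> \<Gamma> \<and> e \<in> nullray m \<and> e' \<in> nullray m \<and>
     (\<exists>\<kappa>>1. mv m A e = (\<lambda>i. \<kappa> * e i)) \<and> (\<exists>\<kappa>>1. mv m (adj m A) e' = (\<lambda>i. \<kappa> * e' i))"

definition lox_near :: "(nat \<Rightarrow> real) \<Rightarrow> (nat \<Rightarrow> real) \<Rightarrow> bool" where
  "lox_near p q \<longleftrightarrow> (\<forall>\<epsilon>>0. \<exists>A e e'. lox A e e' \<and> (\<forall>i. \<bar>e i - p i\<bar> < \<epsilon> \<and> \<bar>e' i - q i\<bar> < \<epsilon>))"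

text \<open>Elements that escape to infinity and push the base point to \<open>p\<close>. The limit
  of the inverses, the repelling direction, is tracked separately.\<close>

definition attr_seq :: "(nat \<Rightarrow> real mat) \<Rightarrow> (nat \<Rightarrow> real) \<Rightarrow> bool" where
  "attr_seq A p \<longleftrightarrow> (\<forall>k. A k \<in> \<Gamma>) \<and> filterlim (\<lambda>k. A k $$ (m, m)) at_top sequentially \<and>
     (\<forall>i. (\<lambda>k. col_dir m (A k) i) \<longlonglongrightarrow> p i)"

text \<open>The bound 16 / (\<eta> \<epsilon>^2) puts the fixed ray within \<epsilon>/2 of
  \<open>col_dir m A\<close>; the other half of \<epsilon> is the distance from there to
  \<open>p\<close>.\<close>

lemma fixed_ray_near:
  assumes A: "A \<in> \<Gamma>" and m: "1 \<le> m" and e: "0 < \<epsilon>"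
    and \<eta>: "0 < \<eta>" "\<eta> \<le> 2" "\<eta> \<le> - lp m (col_dir m A) (col_dir m (adj m A))"
    and d: "8 / \<eta>\<^sup>2 \<le> A $$ (m, m)" "16 / (\<eta> * \<epsilon>\<^sup>2) \<le> A $$ (m, m)"
    and p: "\<And>i. \<bar>col_dir m A i - p i\<bar> < \<epsilon> / 2"
  shows "\<exists>s\<in>nullray m. (\<exists>\<kappa>>1. mv m A s = (\<lambda>i. \<kappa> * s i)) \<and> (\<forall>i. \<bar>s i - p i\<bar> < \<epsilon>)"
proof -
  note SO = G_SO[OF A]
  from ex_attracting_fixed_ray[OF SO m \<eta> d(1)] obtain s \<kappa> where s: "s \<in> nullray m" "\<kappa> > 1"
    "mv m A s = (\<lambda>i. \<kappa> * s i)" "(\<Sum>i<m. (s i - col_dir m A i)\<^sup>2) \<le> 4 / (\<eta> * (A $$ (m, m))\<^sup>2)"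
    by blast
  let ?d = "A $$ (m, m)"
  have d1: "?d \<ge> 1" by (rule SO_plus_diag_ge_1[OF SO])
  have "4 / (\<eta> * ?d\<^sup>2) \<le> 4 / (\<eta> * ?d)"
    using d1 \<eta> by (intro divide_left_mono mult_left_mono) (auto simp: power2_eq_square)
  also have "\<dots> \<le> (\<epsilon> / 2)\<^sup>2" using d(2) d1 \<eta> e by (simp add: field_simps power2_eq_square)
  finally have le: "(\<Sum>i<m. (s i - col_dir m A i)\<^sup>2) \<le> (\<epsilon> / 2)\<^sup>2" using s by simp
  have "\<bar>s i - col_dir m A i\<bar> \<le> \<epsilon> / 2" for i
  proof -
    consider "i < m" | "i = m" | "i > m" by linarith
    then show ?thesis
    proof cases
      case 1
      then show ?thesis using component_le_sum_squares[OF _ le] e by simp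
    next
      case 2
      then show ?thesis using nullrayD(1)[OF s(1)] col_dir_time[OF SO] e by simp
    next
      case 3
      then show ?thesis using nullrayD(3)[OF s(1)] e by (simp add: col_dir_def)
    qed
  qed
  then have "\<bar>s i - p i\<bar> < \<epsilon>" for i using p[of i] by (smt (verit) field_sum_of_halves)
  then show ?thesis using s by blast
qed

lemma eventually_close_all:
  fixes x :: "nat \<Rightarrow> nat \<Rightarrow> real"
  assumes "\<And>i. (\<lambda>k. x k i) \<longlonglongrightarrow> p i" "\<epsilon> > 0" "\<And>k i. i > m \<Longrightarrow> x k i = 0"
  shows "\<forall>\<^sub>F k in sequentially. \<forall>i. \<bar>x k i - p i\<bar> < \<epsilon>"
proof -
  have "\<forall>\<^sub>F k in sequentially. \<forall>i\<in>{..m}. \<bar>x k i - p i\<bar> < \<epsilon>"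
    using tendstoD[OF assms(1,2)] by (intro eventually_ball_finite) (auto simp: dist_real_def)
  then show ?thesis
  proof (rule eventually_mono)
    fix k assume le: "\<forall>i\<in>{..m}. \<bar>x k i - p i\<bar> < \<epsilon>"
    show "\<forall>i. \<bar>x k i - p i\<bar> < \<epsilon>"
    proof
      fix i
      show "\<bar>x k i - p i\<bar> < \<epsilon>"
      proof (cases "i \<le> m")
        case False
        then have "p i = 0" using assms(1)[of i] assms(3)[of i] by (simp add: LIMSEQ_const_iff)
        then show ?thesis using False assms by simp
      qed (use le in auto)
    qed
  qed
qed

lemma lox_nearI:
  assumes m: "1 \<le> m" and A: "attr_seq A p" and q: "\<And>i. (\<lambda>k. col_dir m (adj m (A k)) i) \<longlonglongrightarrow> q i"
    and pq: "p \<in> nullray m" "q \<in> nullray m" "p \<noteq> q"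
  shows "lox_near p q"
  unfolding lox_near_def
proof (intro allI impI)
  fix \<epsilon> :: real assume e: "\<epsilon> > 0"
  \<comment> \<open>Half the limiting separation of the two directions, so that it is eventually a
    strict lower bound; 2 is the cap demanded by the contraction argument.\<close>
  define \<eta> where "\<eta> = min 2 (- lp m p q / 2)"
  have "lp m p q < 0" using nullray_lp_le nullray_lp_eq_0 pq by (metis order_le_less)
  then have \<eta>: "0 < \<eta>" "\<eta> \<le> 2" "\<eta> < - lp m p q" by (auto simp: \<eta>_def)
  have A1: "A k \<in> \<Gamma>" for k using A by (simp add: attr_seq_def)
  have lim: "(\<lambda>k. - lp m (col_dir m (A k)) (col_dir m (adj m (A k)))) \<longlonglongrightarrow> - lp m p q"
    using A q by (intro tendsto_intros) (auto simp: attr_seq_def)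
  have "\<forall>\<^sub>F k in sequentially. max (8 / \<eta>\<^sup>2) (16 / (\<eta> * \<epsilon>\<^sup>2)) \<le> A k $$ (m, m)"
    using A unfolding attr_seq_def filterlim_at_top by blast
  moreover have "\<forall>\<^sub>F k in sequentially. \<eta> < - lp m (col_dir m (A k)) (col_dir m (adj m (A k)))"
    by (rule order_tendstoD(1)[OF lim \<eta>(3)])
  moreover have "\<forall>\<^sub>F k in sequentially. \<forall>i. \<bar>col_dir m (A k) i - p i\<bar> < \<epsilon> / 2"
    by (rule eventually_close_all) (use A e in \<open>auto simp: attr_seq_def col_dir_def\<close>)
  moreover have "\<forall>\<^sub>F k in sequentially. \<forall>i. \<bar>col_dir m (adj m (A k)) i - q i\<bar> < \<epsilon> / 2"
    by (rule eventually_close_all) (use q e in \<open>auto simp: col_dir_def\<close>)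
  ultimately have "\<forall>\<^sub>F k in sequentially. max (8 / \<eta>\<^sup>2) (16 / (\<eta> * \<epsilon>\<^sup>2)) \<le> A k $$ (m, m) \<and>
      \<eta> < - lp m (col_dir m (A k)) (col_dir m (adj m (A k))) \<and>
      (\<forall>i. \<bar>col_dir m (A k) i - p i\<bar> < \<epsilon> / 2) \<and> (\<forall>i. \<bar>col_dir m (adj m (A k)) i - q i\<bar> < \<epsilon> / 2)"
    by eventually_elim blast
  then obtain k where k: "8 / \<eta>\<^sup>2 \<le> A k $$ (m, m)" "16 / (\<eta> * \<epsilon>\<^sup>2) \<le> A k $$ (m, m)"
    "\<eta> \<le> - lp m (col_dir m (A k)) (col_dir m (adj m (A k)))"
    "\<And>i. \<bar>col_dir m (A k) i - p i\<bar> < \<epsilon> / 2" "\<And>i. \<bar>col_dir m (adj m (A k)) i - q i\<bar> < \<epsilon> / 2"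
    unfolding eventually_sequentially by (meson le_refl less_imp_le max.boundedE)
  from fixed_ray_near[OF A1 m e \<eta>(1,2) k(3,1,2,4)] obtain s where s: "s \<in> nullray m"
    "\<exists>\<kappa>>1. mv m (A k) s = (\<lambda>i. \<kappa> * s i)" "\<forall>i. \<bar>s i - p i\<bar> < \<epsilon>" by blast
  have "\<exists>t\<in>nullray m. (\<exists>\<kappa>>1. mv m (adj m (A k)) t = (\<lambda>i. \<kappa> * t i)) \<and> (\<forall>i. \<bar>t i - q i\<bar> < \<epsilon>)"
    by (rule fixed_ray_near[OF G_adj[OF A1] m e \<eta>(1,2)])
      (use k lp_commute[of m "col_dir m (A k)"] adj_adj[OF G_mat[OF A1]] in simp_all)
  then show "\<exists>A e e'. lox A e e' \<and> (\<forall>i. \<bar>e i - p i\<bar> < \<epsilon> \<and> \<bar>e' i - q i\<bar> < \<epsilon>)"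
    unfolding lox_def using s A1 by blast
qed

end

section \<open>Attracting and repelling limits of escaping sequences\<close>

lemma tendsto_zero_of_square_le:
  fixes x y :: "nat \<Rightarrow> real"
  assumes "\<forall>\<^sub>F k in sequentially. (x k)\<^sup>2 \<le> y k" "y \<longlonglongrightarrow> 0"
  shows "x \<longlonglongrightarrow> 0"
proof -
  have "(\<lambda>k. (x k)\<^sup>2) \<longlonglongrightarrow> 0"
    by (rule tendsto_sandwich[OF _ assms(1) tendsto_const assms(2)]) simp
  from tendsto_real_sqrt[OF this] show ?thesis by (simp add: tendsto_rabs_zero_iff)
qed

lemma bounded_fun_subseq:
  fixes x :: "nat \<Rightarrow> nat \<Rightarrow> real"
  assumes "\<And>k i. \<bar>x k i\<bar> \<le> r i"
  shows "\<exists>\<phi> b. strict_mono \<phi> \<and> (\<forall>i. (\<lambda>k. x (\<phi> k) i) \<longlonglongrightarrow> b i)"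
proof -
  have "\<forall>k. x k \<in> {y. \<forall>i. \<bar>y i\<bar> \<le> r i}" using assms by simp
  then obtain b \<phi> where "strict_mono \<phi>" "(x \<circ> \<phi>) \<longlonglongrightarrow> b"
    using seq_compactE[OF compact_imp_seq_compact[OF compact_box[of r]]] by metis
  then show ?thesis by (auto simp: tendsto_fun_iff o_def)
qed

lemma lp_mv_nullray_le:
  assumes A: "A \<in> carrier (SO_plus m)" and "s \<in> nullray m" "t \<in> nullray m"
  shows "lp m s (mv m A t) \<le> 0"
  by (subst mv_ray_act[OF A assms(3)])
    (use mv_nullray_pos[OF A assms(3)] nullray_lp_le[OF assms(2) ray_act_nullray[OF A assms(3)]] in
      \<open>simp add: lp_linear mult_nonneg_nonpos\<close>)

text \<open>Orthogonal null rays coincide, so the single equation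
  \<open>lp m s (mv m A s) = 0\<close> expresses that \<open>A\<close> fixes the ray
  \<open>s\<close>. Arguments on common fixed rays use this form.\<close>

lemma fixed_ray:
  assumes A: "A \<in> carrier (SO_plus m)" and s: "s \<in> nullray m" and "lp m s (mv m A s) = 0"
  shows "mv m A s = (\<lambda>i. mv m A s m * s i)" "mv m A s m > 0"
proof -
  show pos: "mv m A s m > 0" by (rule mv_nullray_pos[OF A s])
  have "mv m A s m * lp m s (ray_act m A s) = 0"
    using assms(3) by (subst (asm) mv_ray_act[OF A s]) (simp add: lp_linear)
  then have "s = ray_act m A s" using nullray_lp_eq_0[OF s ray_act_nullray[OF A s]] pos by simp
  then show "mv m A s = (\<lambda>i. mv m A s m * s i)" using mv_ray_act[OF A s] by simp
qed

lemma mv_adj_eigen: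
  assumes A: "A \<in> carrier (SO_plus m)" and s: "s \<in> nullray m" and "mv m A s = (\<lambda>i. \<kappa> * s i)"
  shows "\<kappa> > 0" "mv m (adj m A) s = (\<lambda>i. 1 / \<kappa> * s i)"
proof -
  show k: "\<kappa> > 0" using mv_nullray_pos[OF A s] assms(3) nullrayD(1)[OF s] by simp
  have e: "mv m (adj m A) (mv m A s) = (\<lambda>i. \<kappa> * mv m (adj m A) s i)"
    unfolding assms(3) by (rule mv_scale)
  show "mv m (adj m A) s = (\<lambda>i. 1 / \<kappa> * s i)"
  proof
    fix i
    show "mv m (adj m A) s i = 1 / \<kappa> * s i"
    proof (cases "i \<le> m")
      case True
      then have "s i = \<kappa> * mv m (adj m A) s i" using mv_adj_mv(1)[OF A True, of s] e by simp
      then show ?thesis using k by simp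
    next
      case False
      then show ?thesis using nullrayD(3)[OF s] by (simp add: mv_def)
    qed
  qed
qed

text \<open>Invariance of the form makes the factors of two distinct fixed rays reciprocal. A third
  fixed ray would be reciprocal to both, forcing \<mu> = \<nu>.\<close>

lemma no_third_fixed_ray:
  assumes A: "A \<in> carrier (SO_plus m)" and b: "b \<in> nullray m" and e: "e \<in> nullray m" and f: "f \<in> nullray m"
    and mb: "mv m A b = (\<lambda>i. \<mu> * b i)" and me: "mv m A e = (\<lambda>i. \<nu> * e i)" and "\<mu> \<noteq> \<nu>"
    and "lp m f (mv m A f) = 0"
  shows "f = b \<or> f = e"
proof (rule ccontr)
  assume n: "\<not> ?thesis"
  define c where "c = mv m A f m"
  have mf: "mv m A f = (\<lambda>i. c * f i)" using fixed_ray[OF A f assms(8)] by (simp add: c_def)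
  have "lp m f b = c * \<mu> * lp m f b" "lp m f e = c * \<nu> * lp m f e"
    using lp_mv[OF A, of f b] lp_mv[OF A, of f e] unfolding mf mb me lp_linear by simp_all
  moreover have "lp m f b \<noteq> 0" "lp m f e \<noteq> 0" using n nullray_lp_eq_0 f b e by blast+
  ultimately have "c * \<mu> = 1" "c * \<nu> = 1" by simp_all
  then show False using \<open>\<mu> \<noteq> \<nu>\<close> by (metis mult_cancel_left zero_neq_one mult_zero_left)
qed

context lorentz_lattice
begin

lemma G_pow: "A \<in> \<Gamma> \<Longrightarrow> A ^\<^sub>m k \<in> \<Gamma>"
proof (induction k)
  case 0
  then show ?case using G_mat[of A] G_one by simp
next
  case (Suc k)
  then show ?case using G_mult by simp
qed

lemma mv_pow_Suc: "A \<in> \<Gamma> \<Longrightarrow> mv m (A ^\<^sub>m Suc k) x = mv m (A ^\<^sub>m k) (mv m A x)"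
  using G_mv_mult[OF G_pow] by simp

lemma mv_pow_eigen:
  assumes "A \<in> \<Gamma>" "s \<in> nullray m" "mv m A s = (\<lambda>i. \<kappa> * s i)"
  shows "mv m (A ^\<^sub>m k) s = (\<lambda>i. \<kappa> ^ k * s i)"
proof (induction k)
  case 0
  have "mv m (1\<^sub>m (m + 1)) s i = s i" for i
    using mv_one[of i m s] nullrayD(3)[OF assms(2), of i] by (cases "i \<le> m") (auto simp: mv_def)
  then show ?case using G_mat[OF assms(1)] by auto
next
  case (Suc k)
  then show ?case by (simp add: mv_pow_Suc[OF assms(1)] assms(3) mv_scale del: pow_mat.simps) (simp add: mult_ac)
qed

end

context full_lorentz_lattice
begin

lemma m1: "1 \<le> m" using m2 by simp

lemma ex_attr_seq:
  assumes "p \<in> nullray m"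
  shows "\<exists>A. attr_seq A p"
proof -
  have "\<exists>A. A \<in> \<Gamma> \<and> real k < A $$ (m, m) \<and> (\<forall>i<m. \<bar>A $$ (i, m) / A $$ (m, m) - p i\<bar> < inverse (real (Suc k)))" for k
    using ex_attracting[OF assms, of "inverse (real (Suc k))" "real k"] by auto
  then obtain A where A: "\<And>k. A k \<in> \<Gamma>" "\<And>k. real k < A k $$ (m, m)"
    "\<And>k i. i < m \<Longrightarrow> \<bar>A k $$ (i, m) / A k $$ (m, m) - p i\<bar> < inverse (real (Suc k))"
    by metis
  have "filterlim (\<lambda>k. A k $$ (m, m)) at_top sequentially"
    by (rule filterlim_at_top_mono[OF filterlim_real_sequentially])
      (use A(2) in \<open>auto intro!: always_eventually less_imp_le\<close>)
  moreover have "(\<lambda>k. col_dir m (A k) i) \<longlonglongrightarrow> p i" for i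
  proof -
    consider "i < m" | "i = m" | "i > m" by linarith
    then show ?thesis
    proof cases
      case 1
      have "(\<lambda>k. A k $$ (i, m) / A k $$ (m, m) - p i) \<longlonglongrightarrow> 0"
      proof (rule tendsto_rabs_zero_cancel, rule tendsto_sandwich[OF _ _ tendsto_const LIMSEQ_inverse_real_of_nat])
        show "\<forall>\<^sub>F k in sequentially. \<bar>A k $$ (i, m) / A k $$ (m, m) - p i\<bar> \<le> inverse (real (Suc k))"
          using A(3)[OF 1] less_imp_le by (intro always_eventually allI) blast
      qed auto
      then show ?thesis using 1 by (simp add: col_dir_def LIM_zero_iff)
    next
      case 2
      then show ?thesis using col_dir_time[OF G_SO[OF A(1)]] nullrayD(1)[OF assms] by simp
    next
      case 3
      then show ?thesis using nullrayD(3)[OF assms] by (simp add: col_dir_def)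
    qed
  qed
  ultimately show ?thesis using A(1) unfolding attr_seq_def by blast
qed

lemma attr_seq_limit_nullray:
  assumes A: "\<And>k. A k \<in> \<Gamma>" "filterlim (\<lambda>k. A k $$ (m, m)) at_top sequentially"
    and b: "\<And>i. (\<lambda>k. col_dir m (A k) i) \<longlonglongrightarrow> b i"
  shows "b \<in> nullray m"
proof -
  have "(\<lambda>k. lp m (col_dir m (A k)) (col_dir m (A k))) \<longlonglongrightarrow> lp m b b" by (intro tendsto_intros b)
  moreover have "(\<lambda>k. - (1 / (A k $$ (m, m))\<^sup>2)) \<longlonglongrightarrow> - 0"
    by (intro tendsto_minus tendsto_divide_0[OF tendsto_const] filterlim_at_top_imp_at_infinity
        filterlim_pow_at_top A) auto
  ultimately have "lp m b b = 0"
    using LIMSEQ_unique unfolding lp_col_dir[OF G_SO[OF A(1)]] by fastforce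
  moreover have "b m = 1" using b[of m] col_dir_time[OF G_SO[OF A(1)]] by (simp add: LIMSEQ_const_iff)
  moreover have "b i = 0" if "i > m" for i using b[of i] that by (simp add: col_dir_def LIMSEQ_const_iff)
  ultimately show ?thesis by (simp add: nullray_def)
qed

text \<open>By compactness the inverses converge along a subsequence. Their limit \<open>b\<close>
  is not under control and may even equal \<open>p\<close>.\<close>

lemma ex_attr_repel:
  assumes "p \<in> nullray m"
  shows "\<exists>A b. attr_seq A p \<and> b \<in> nullray m \<and> (\<forall>i. (\<lambda>k. col_dir m (adj m (A k)) i) \<longlonglongrightarrow> b i)"
proof -
  obtain A where A: "attr_seq A p" using ex_attr_seq[OF assms] by blast
  have A1: "A k \<in> \<Gamma>" for k using A by (simp add: attr_seq_def)
  obtain b r where r: "strict_mono r" and b: "\<And>i. (\<lambda>k. col_dir m (adj m (A (r k))) i) \<longlonglongrightarrow> b i"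
    using bounded_fun_subseq[of "\<lambda>k. col_dir m (adj m (A k))" "\<lambda>_. 1"]
      col_dir_abs_le[OF G_SO[OF G_adj[OF A1]]] by metis
  have d: "filterlim (\<lambda>k. A (r k) $$ (m, m)) at_top sequentially"
    using A filterlim_compose[OF _ filterlim_subseq[OF r]] unfolding attr_seq_def by blast
  have "attr_seq (\<lambda>k. A (r k)) p"
    unfolding attr_seq_def using A1 d LIMSEQ_subseq_LIMSEQ[OF _ r] A
    by (auto simp: attr_seq_def o_def)
  moreover have "b \<in> nullray m"
    by (rule attr_seq_limit_nullray[of "\<lambda>k. adj m (A (r k))"]) (use A1 G_adj d b in auto)
  ultimately show ?thesis using b by blast
qed

text \<open>The inverse of \<open>B k\<close> moves the base point near \<open>b'\<close>,
  \<open>h\<close> carries it away from the repelling direction \<open>b\<close> of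
  \<open>A k\<close>, and \<open>A k\<close> therefore still pushes it to \<open>p\<close>. The
  inverse product has the same shape, which is how a repelling point can be prescribed as
  well.\<close>

lemma attr_seq_product:
  assumes A: "attr_seq A p" and b: "\<And>i. (\<lambda>k. col_dir m (adj m (A k)) i) \<longlonglongrightarrow> b i" "b \<in> nullray m"
    and B: "\<And>k. B k \<in> \<Gamma>" and b': "\<And>i. (\<lambda>k. col_dir m (adj m (B k)) i) \<longlonglongrightarrow> b' i" "b' \<in> nullray m"
    and h: "h \<in> \<Gamma>" "lp m b (mv m h b') \<noteq> 0"
  shows "attr_seq (\<lambda>k. A k * h * adj m (B k)) p"
proof -
  have A1: "A k \<in> \<Gamma>" and dA: "filterlim (\<lambda>k. A k $$ (m, m)) at_top sequentially"
    and Ap: "\<And>i. (\<lambda>k. col_dir m (A k) i) \<longlonglongrightarrow> p i" for k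
    using A by (auto simp: attr_seq_def)
  define C where "C = (\<lambda>k. A k * h * adj m (B k))"
  have C1: "C k \<in> \<Gamma>" for k unfolding C_def using A1 B h G_mult G_adj by blast
  note SOA = G_SO[OF A1] and SOB = G_SO[OF B] and SOC = G_SO[OF C1]
  define y where "y = (\<lambda>k. mv m h (col_dir m (adj m (B k))))"
  \<comment> \<open>Positive by the choice of \<open>h\<close>; half of it eventually bounds the
    pairing of \<open>y k\<close> with the repelling direction of \<open>A k\<close> away from
    0.\<close>
  define c where "c = - lp m b (mv m h b')"
  define Y where "Y = mv m h b' m + 1"
  have c: "c > 0" using lp_mv_nullray_le[OF G_SO[OF h(1)] b(2) b'(2)] h(2) by (simp add: c_def)
  have Y: "Y > 0" using mv_nullray_pos[OF G_SO[OF h(1)] b'(2)] by (simp add: Y_def)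
  have Cem: "mv m (C k) (em m) = (\<lambda>i. B k $$ (m, m) * mv m (A k) (y k) i)" for k
    unfolding C_def using A1 B h G_mult G_adj
    by (simp add: G_mv_mult mv_em_col_dir[OF adj_in_SO_plus[OF SOB]] mv_scale y_def)
  have dC: "C k $$ (m, m) = B k $$ (m, m) * (A k $$ (m, m) * (- lp m (col_dir m (adj m (A k))) (y k)))" for k
    using fun_cong[OF Cem[of k], of m] mv_time_col_dir[OF SOA, of k "y k"] by (simp add: mv_em)
  have ylim: "(\<lambda>k. y k i) \<longlonglongrightarrow> mv m h b' i" for i unfolding y_def by (intro tendsto_mv b')
  have "(\<lambda>k. - lp m (col_dir m (adj m (A k))) (y k)) \<longlonglongrightarrow> c"
    unfolding c_def by (intro tendsto_intros b ylim)
  then have ev1: "\<forall>\<^sub>F k in sequentially. c / 2 < - lp m (col_dir m (adj m (A k))) (y k)"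
    using c by (intro order_tendstoD(1)) auto
  have ev2: "\<forall>\<^sub>F k in sequentially. y k m < Y"
    using order_tendstoD(2)[OF ylim[of m], of Y] by (simp add: Y_def)
  have dC_ge: "c / 2 * A k $$ (m, m) \<le> C k $$ (m, m)"
    if "c / 2 < - lp m (col_dir m (adj m (A k))) (y k)" for k
  proof -
    have "c / 2 * A k $$ (m, m) = 1 * (A k $$ (m, m) * (c / 2))" by simp
    also have "\<dots> \<le> C k $$ (m, m)"
      unfolding dC using that c SO_plus_diag_ge_1[OF SOB, of k] SO_plus_diag_ge_1[OF SOA, of k]
      by (intro mult_mono) auto
    finally show ?thesis .
  qed
  have "filterlim (\<lambda>k. c / 2 * A k $$ (m, m)) at_top sequentially"
    by (rule filterlim_tendsto_pos_mult_at_top[OF tendsto_const _ dA]) (use c in simp)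
  then have limC: "filterlim (\<lambda>k. C k $$ (m, m)) at_top sequentially"
    by (rule filterlim_at_top_mono) (use ev1 dC_ge in \<open>auto elim: eventually_mono\<close>)
  have sq: "(\<Sum>i<m. (col_dir m (C k) i - col_dir m (A k) i)\<^sup>2) \<le> 4 * Y / c * (1 / A k $$ (m, m))"
    if k: "c / 2 < - lp m (col_dir m (adj m (A k))) (y k)" "y k m < Y" for k
  proof -
    let ?a = "A k $$ (m, m)" and ?c = "C k $$ (m, m)" and ?b = "B k $$ (m, m)"
    have d1: "?a \<ge> 1" "?c \<ge> 1" "?b \<ge> 1" using SO_plus_diag_ge_1[OF SOA] SO_plus_diag_ge_1[OF SOB] SO_plus_diag_ge_1[OF SOC] by auto
    \<comment> \<open>\<open>A k\<close> preserves the form between \<open>y k\<close> and the base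
      vector. Divided by the large corner entries, this constant-size value measures the distance
      between the directions of \<open>C k\<close> and \<open>A k\<close>.\<close>
    have "?b * lp m (y k) (em m) = lp m (mv m (C k) (em m)) (mv m (A k) (em m))"
      unfolding Cem lp_linear by (simp add: lp_mv[OF SOA])
    also have "\<dots> = ?c * ?a * lp m (col_dir m (C k)) (col_dir m (A k))"
      unfolding mv_em_col_dir[OF SOA] mv_em_col_dir[OF SOC] lp_linear by simp
    finally have "- lp m (col_dir m (C k)) (col_dir m (A k)) = ?b * y k m / (?c * ?a)"
      using d1 by (simp add: lp_em_right field_simps)
    moreover have "(\<Sum>i<m. (col_dir m (C k) i - col_dir m (A k) i)\<^sup>2)
        = - (1 / ?c\<^sup>2) - 1 / ?a\<^sup>2 - 2 * lp m (col_dir m (C k)) (col_dir m (A k))"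
      using lp_direction[of "col_dir m (C k)" m "col_dir m (A k)"]
        col_dir_time[OF SOC] col_dir_time[OF SOA] lp_col_dir[OF SOC] lp_col_dir[OF SOA] by simp
    moreover have "0 \<le> 1 / ?c\<^sup>2" "0 \<le> 1 / ?a\<^sup>2" by simp_all
    ultimately have "(\<Sum>i<m. (col_dir m (C k) i - col_dir m (A k) i)\<^sup>2) \<le> 2 * (?b * y k m / (?c * ?a))"
      by linarith
    also have "\<dots> \<le> 2 * (?b * Y / (?b * (?a * (c / 2)) * ?a))"
    proof (intro mult_left_mono frac_le)
      show "?b * (?a * (c / 2)) * ?a \<le> ?c * ?a"
        unfolding dC using k d1 c by (intro mult_right_mono mult_left_mono) auto
    qed (use k d1 c Y in auto)
    also have "\<dots> = 4 * Y / c * (1 / (?a * ?a))" using d1 c by (simp add: field_simps)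
    also have "\<dots> \<le> 4 * Y / c * (1 / ?a)"
      using d1 c Y by (intro mult_left_mono divide_left_mono) auto
    finally show ?thesis .
  qed
  have inv: "(\<lambda>k. 4 * Y / c * (1 / A k $$ (m, m))) \<longlonglongrightarrow> 4 * Y / c * 0"
    by (intro tendsto_mult tendsto_const tendsto_divide_0[OF tendsto_const] filterlim_at_top_imp_at_infinity dA)
  have "(\<lambda>k. col_dir m (C k) i) \<longlonglongrightarrow> p i" for i
  proof -
    consider "i < m" | "i = m" | "i > m" by linarith
    then show ?thesis
    proof cases
      case 1
      have "\<forall>\<^sub>F k in sequentially. (col_dir m (C k) i - col_dir m (A k) i)\<^sup>2 \<le> 4 * Y / c * (1 / A k $$ (m, m))"
        using ev1 ev2
      proof eventually_elim
        case (elim k)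
        have "(col_dir m (C k) i - col_dir m (A k) i)\<^sup>2 \<le> (\<Sum>i<m. (col_dir m (C k) i - col_dir m (A k) i)\<^sup>2)"
          by (rule member_le_sum) (use 1 in auto)
        then show ?case using sq[OF elim] by linarith
      qed
      then have "(\<lambda>k. col_dir m (C k) i - col_dir m (A k) i) \<longlonglongrightarrow> 0"
        by (rule tendsto_zero_of_square_le[OF _ inv[unfolded mult_zero_right]])
      from tendsto_add[OF this Ap[of i]] show ?thesis by simp
    next
      case 2
      then show ?thesis using Ap[of m] col_dir_time[OF SOC] col_dir_time[OF SOA] by simp
    next
      case 3
      then show ?thesis using Ap[of i] by (simp add: col_dir_def)
    qed
  qed
  then show ?thesis using C1 limC unfolding attr_seq_def C_def by blast
qed

end

section \<open>Absence of a common fixed ray, and density of pairs of fixed rays\<close>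

context full_lorentz_lattice
begin

text \<open>The factors of an element and of its inverse on the fixed ray \<open>b\<close> are
  reciprocal. In terms of column directions this is \<open>prod1\<close>, whose right-hand side
  tends to 0, so \<open>b\<close> is orthogonal to \<open>p\<close> or to the repelling limit. As
  \<open>p\<close> differs from \<open>b\<close>, the repelling limit is \<open>b\<close>.\<close>

lemma fixing_ex_lox:
  assumes b: "b \<in> nullray m" and fixb: "\<And>h. h \<in> \<Gamma> \<Longrightarrow> lp m b (mv m h b) = 0"
    and p: "p \<in> nullray m" "p \<noteq> b" and \<epsilon>: "\<epsilon> > 0"
  shows "\<exists>A\<in>\<Gamma>. \<exists>e\<in>nullray m. \<exists>\<kappa>>1. mv m A e = (\<lambda>i. \<kappa> * e i) \<and> (\<forall>i. \<bar>e i - p i\<bar> < \<epsilon>)"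
proof -
  obtain A b' where A: "attr_seq A p" and b': "b' \<in> nullray m"
    and lim: "\<And>i. (\<lambda>k. col_dir m (adj m (A k)) i) \<longlonglongrightarrow> b' i"
    using ex_attr_repel[OF p(1)] by metis
  have A1: "A k \<in> \<Gamma>" and dA: "filterlim (\<lambda>k. A k $$ (m, m)) at_top sequentially"
    and Ap: "\<And>i. (\<lambda>k. col_dir m (A k) i) \<longlonglongrightarrow> p i" for k
    using A by (auto simp: attr_seq_def)
  note SO = G_SO[OF A1] and SO' = G_SO[OF G_adj[OF A1]]
  have prod1: "lp m (col_dir m (adj m (A k))) b * lp m (col_dir m (A k)) b = 1 / (A k $$ (m, m))\<^sup>2" for k
  proof -
    have f: "mv m (A k) b = (\<lambda>i. mv m (A k) b m * b i)" using fixed_ray[OF SO b fixb[OF A1]] by simp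
    have "mv m (adj m (A k)) b m = 1 / mv m (A k) b m"
      using fun_cong[OF mv_adj_eigen(2)[OF SO b f], of m] nullrayD(1)[OF b] by simp
    then have "mv m (adj m (A k)) b m * mv m (A k) b m = 1"
      using mv_nullray_pos[OF SO b, of k] by simp
    then show ?thesis
      using mv_time_col_dir[OF SO, of k b] mv_time_col_dir[OF SO', of k b] adj_adj[OF G_mat[OF A1], of k]
        SO_plus_diag_ge_1[OF SO, of k]
      by (simp add: field_simps power2_eq_square)
  qed
  have "(\<lambda>k. lp m (col_dir m (adj m (A k))) b * lp m (col_dir m (A k)) b) \<longlonglongrightarrow> lp m b' b * lp m p b"
    by (intro tendsto_intros lim Ap)
  moreover have "(\<lambda>k. 1 / (A k $$ (m, m))\<^sup>2) \<longlonglongrightarrow> 0"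
    by (intro tendsto_divide_0[OF tendsto_const] filterlim_at_top_imp_at_infinity filterlim_pow_at_top dA) auto
  ultimately have "lp m b' b * lp m p b = 0" unfolding prod1 using LIMSEQ_unique by blast
  then have "b' = b" using nullray_lp_eq_0 b b' p by (metis mult_eq_0_iff)
  then have "lox_near p b" using lox_nearI[OF m1 A lim p(1) b'] p by simp
  then show ?thesis using \<epsilon> unfolding lox_near_def lox_def by blast
qed

text \<open>If every element fixed the ray \<open>b\<close>, the conjugates of a nontrivial commutator by powers of a
  loxodromic element \<open>A\<close> (with second fixed ray \<open>e\<close>) would stay bounded; they are pairwise distinct,
  against discreteness.\<close>

lemma no_fixed_ray:
  assumes b: "b \<in> nullray m"
  shows "\<exists>h\<in>\<Gamma>. lp m b (mv m h b) \<noteq> 0"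
proof (rule ccontr)
  assume "\<not> ?thesis"
  then have fixb: "\<And>h. h \<in> \<Gamma> \<Longrightarrow> lp m b (mv m h b) = 0" by blast
  have sep: "\<exists>\<epsilon>>0. \<forall>e. (\<forall>i. \<bar>e i - p i\<bar> < \<epsilon>) \<longrightarrow> e \<noteq> q" if "p \<noteq> q" for p q :: "nat \<Rightarrow> real"
  proof -
    from that obtain i where "p i \<noteq> q i" by blast
    then show ?thesis by (intro exI[of _ "\<bar>p i - q i\<bar>"]) (auto simp: abs_minus_commute)
  qed
  have rays: "\<exists>p\<in>nullray m. p \<noteq> b \<and> p \<noteq> e" for e
  proof -
    let ?r = "ray_dir m 0" and ?s = "ray_dir m 1" and ?t = "antipode m (ray_dir m 0)"
    have "?r 0 = 1" "?s 0 = 0" "?t 0 = - 1" using m2 by (simp_all add: ray_dir_def antipode_def)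
    then have "?r \<noteq> ?s" "?t \<noteq> ?s" "?t \<noteq> ?r" by auto
    moreover have "?r \<in> nullray m" "?s \<in> nullray m" "?t \<in> nullray m"
      using m2 by (simp_all add: ray_dir_nullray antipode_nullray)
    ultimately show ?thesis by metis
  qed
  have lox: "\<exists>A\<in>\<Gamma>. \<exists>e'\<in>nullray m. \<exists>\<kappa>>1. mv m A e' = (\<lambda>i. \<kappa> * e' i) \<and> mv m A b = (\<lambda>i. 1 / \<kappa> * b i) \<and> e' \<noteq> b \<and> e' \<noteq> e" for e
  proof -
    obtain p where p: "p \<in> nullray m" "p \<noteq> b" "p \<noteq> e" using rays by blast
    obtain \<epsilon>1 \<epsilon>2 where \<epsilon>: "\<epsilon>1 > 0" "\<forall>e'. (\<forall>i. \<bar>e' i - p i\<bar> < \<epsilon>1) \<longrightarrow> e' \<noteq> b"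
      "\<epsilon>2 > 0" "\<forall>e'. (\<forall>i. \<bar>e' i - p i\<bar> < \<epsilon>2) \<longrightarrow> e' \<noteq> e"
      using sep[OF p(2)] sep[OF p(3)] by metis
    then have "min \<epsilon>1 \<epsilon>2 > 0" by simp
    from fixing_ex_lox[OF b fixb p(1,2) this] obtain A e' \<kappa> where A: "A \<in> \<Gamma>" "e' \<in> nullray m" "\<kappa> > 1"
      "mv m A e' = (\<lambda>i. \<kappa> * e' i)" "\<forall>i. \<bar>e' i - p i\<bar> < min \<epsilon>1 \<epsilon>2" by blast
    have ne: "e' \<noteq> b" "e' \<noteq> e" using A(5) \<epsilon> by auto
    define \<mu> where "\<mu> = mv m A b m"
    have mb: "mv m A b = (\<lambda>i. \<mu> * b i)" using fixed_ray[OF G_SO[OF A(1)] b fixb[OF A(1)]] by (simp add: \<mu>_def)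
    have "lp m e' b = \<kappa> * \<mu> * lp m e' b"
      using lp_mv[OF G_SO[OF A(1)], of e' b] unfolding mb A(4) lp_linear by simp
    moreover have "lp m e' b \<noteq> 0" using ne nullray_lp_eq_0[OF A(2) b] by blast
    ultimately have "\<mu> = 1 / \<kappa>" using A(3) by (simp add: field_simps)
    then show ?thesis using A ne mb by blast
  qed
  from lox[of b] obtain A e \<kappa> where A: "A \<in> \<Gamma>" "e \<in> nullray m" "\<kappa> > 1" "mv m A e = (\<lambda>i. \<kappa> * e i)"
    "mv m A b = (\<lambda>i. 1 / \<kappa> * b i)" "e \<noteq> b" by blast
  from lox[of e] obtain B f \<nu> where B: "B \<in> \<Gamma>" "f \<in> nullray m" "\<nu> > 1" "mv m B f = (\<lambda>i. \<nu> * f i)"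
    "mv m B b = (\<lambda>i. 1 / \<nu> * b i)" "f \<noteq> b" "f \<noteq> e" by blast
  define A' B' where "A' = adj m A" and "B' = adj m B"
  have G': "A' \<in> \<Gamma>" "B' \<in> \<Gamma>" using A B G_adj by (auto simp: A'_def B'_def)
  note SO = G_SO[OF A(1)] G_SO[OF B(1)] G_SO[OF G'(1)] G_SO[OF G'(2)]
  have A'e: "mv m A' e = (\<lambda>i. 1 / \<kappa> * e i)" and A'b: "mv m A' b = (\<lambda>i. \<kappa> * b i)"
    and B'f: "mv m B' f = (\<lambda>i. 1 / \<nu> * f i)" and B'b: "mv m B' b = (\<lambda>i. \<nu> * b i)"
    using mv_adj_eigen(2)[OF SO(1) A(2,4)] mv_adj_eigen(2)[OF SO(1) b A(5)]
      mv_adj_eigen(2)[OF SO(2) B(2,4)] mv_adj_eigen(2)[OF SO(2) b B(5)] by (simp_all add: A'_def B'_def)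
  \<comment> \<open>In a commutator the factors on \<open>b\<close> cancel, so \<open>h\<close>
    fixes the vector \<open>b\<close> and not only its ray.\<close>
  define h where "h = A * (B * (A' * B'))"
  have h: "h \<in> \<Gamma>" unfolding h_def using A B G' G_mult by blast
  have mh: "mv m h x = mv m A (mv m B (mv m A' (mv m B' x)))" for x :: "nat \<Rightarrow> real"
    unfolding h_def using A B G' G_mult by (simp add: G_mv_mult)
  have hb: "mv m h b = b"
    using A(3) B(3) unfolding mh by (simp add: A'b B'b A(5) B(5) mv_scale fun_eq_iff)
  have "1 / \<kappa> < 1" "1 / \<nu> < 1" using A(3) B(3) by simp_all
  then have ne: "\<kappa> \<noteq> 1 / \<kappa>" "\<nu> \<noteq> 1 / \<nu>" using A(3) B(3) by linarith+
  define c where "c = lp m (mv m h e) e"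
  have c: "c \<noteq> 0"
  proof
    assume "c = 0"
    \<comment> \<open>Moving \<open>A\<close> and \<open>B\<close> across the form makes
      \<open>c\<close> a positive multiple of the form between \<open>g\<close> and its image under
      \<open>A'\<close>. If it vanished, \<open>g\<close> would be a fixed ray of \<open>A'\<close>,
      that is \<open>b\<close> or \<open>e\<close>; the first gives e = b, the second makes
      \<open>e\<close> a fixed ray of \<open>B'\<close>, that is \<open>b\<close> or
      \<open>f\<close>.\<close>
    define g where "g = ray_act m B' e"
    have g: "g \<in> nullray m" "mv m B' e = (\<lambda>i. mv m B' e m * g i)" "mv m B' e m > 0"
      unfolding g_def using ray_act_nullray[OF SO(4) A(2)] mv_ray_act[OF SO(4) A(2)] mv_nullray_pos[OF SO(4) A(2)] by auto
    have "c = lp m (mv m B (mv m A' (mv m B' e))) (mv m A' e)"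
      unfolding c_def mh lp_mv_adj[of m A] A'_def ..
    also have "\<dots> = 1 / \<kappa> * lp m (mv m A' (mv m B' e)) (mv m B' e)"
      unfolding A'e lp_linear lp_mv_adj[of m B] B'_def by simp
    also have "\<dots> = 1 / \<kappa> * (mv m B' e m * (mv m B' e m * lp m (mv m A' g) g))"
      by (subst (1 2) g(2)) (simp add: mv_scale lp_linear)
    finally have "lp m g (mv m A' g) = 0"
      using \<open>c = 0\<close> g(3) A(3) lp_commute[of m g] by simp
    then have "g = b \<or> g = e"
      by (intro no_third_fixed_ray[OF SO(3) b A(2) g(1) A'b A'e ne(1)])
    then show False
    proof
      assume "g = b"
      then have "lp m (mv m B' e) (mv m B' b) = 0"
        by (subst g(2)) (simp add: B'b lp_linear nullrayD(2)[OF b])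
      then show False using A(6) nullray_lp_eq_0[OF A(2) b] by (simp add: lp_mv[OF SO(4)])
    next
      assume "g = e"
      then have "lp m e (mv m B' e) = 0"
        by (subst g(2)) (simp add: lp_linear nullrayD(2)[OF A(2)])
      then have "e = b \<or> e = f"
        by (intro no_third_fixed_ray[OF SO(4) b B(2) A(2) B'b B'f ne(2)])
      then show False using A B by auto
    qed
  qed
  \<comment> \<open>A timelike vector on the axis of \<open>A\<close>. Its pairings with its images
    under the conjugates show both that these are distinct and that they are bounded.\<close>
  define y where "y = (\<lambda>i. b i + e i)"
  define D where "D = (\<lambda>k. A ^\<^sub>m k * (h * adj m (A ^\<^sub>m k)))"
  have P: "A ^\<^sub>m k \<in> \<Gamma>" "adj m (A ^\<^sub>m k) \<in> \<Gamma>" for k using G_pow[OF A(1)] G_adj by blast+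
  have D: "D k \<in> \<Gamma>" for k unfolding D_def using P h G_mult by blast
  define \<theta> where "\<theta> = (1 / \<kappa>)\<^sup>2"
  have \<theta>: "0 < \<theta>" "\<theta> < 1"     using A(3) mult_strict_mono[of "1 / \<kappa>" 1 "1 / \<kappa>" 1] by (simp_all add: \<theta>_def power2_eq_square)
  have val: "lp m (mv m (D k) y) y = 2 * lp m b e + \<theta> ^ k * c" for k
  proof -
    have pe: "mv m (A ^\<^sub>m k) b = (\<lambda>i. (1 / \<kappa>) ^ k * b i)" "mv m (A ^\<^sub>m k) e = (\<lambda>i. \<kappa> ^ k * e i)"
      using mv_pow_eigen A b by blast+
    have pe': "mv m (adj m (A ^\<^sub>m k)) b = (\<lambda>i. \<kappa> ^ k * b i)" "mv m (adj m (A ^\<^sub>m k)) e = (\<lambda>i. (1 / \<kappa>) ^ k * e i)"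
      using mv_adj_eigen(2)[OF G_SO[OF P(1)] b pe(1)] mv_adj_eigen(2)[OF G_SO[OF P(1)] A(2) pe(2)]
      by (simp_all add: power_divide)
    have mD: "mv m (D k) x = mv m (A ^\<^sub>m k) (mv m h (mv m (adj m (A ^\<^sub>m k)) x))" for x :: "nat \<Rightarrow> real"
      unfolding D_def using P h G_mult by (simp add: G_mv_mult)
    have Db: "mv m (D k) b = b"
      using A(3) unfolding mD pe' mv_scale hb pe by (simp add: power_divide)
    have De: "lp m (mv m (D k) e) e = \<theta> ^ k * c"
      unfolding mD lp_mv_adj[of m "A ^\<^sub>m k"] pe' mv_scale lp_linear c_def \<theta>_def
      by (simp add: power2_eq_square flip: power_mult_distrib)
    have Deb: "lp m (mv m (D k) e) b = lp m e b"
      using lp_mv[OF G_SO[OF D], of k e b] Db by simp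
    show ?thesis
      unfolding y_def mv_add lp_linear Db De Deb using nullrayD(2)[OF b] lp_commute[of m e b] by simp
  qed
  have "inj D"
  proof (rule injI)
    fix j k assume "D j = D k"
    then have "\<theta> ^ j = \<theta> ^ k" using val[of j] val[of k] c by simp
    then show "j = k" using \<theta> by (metis power_strict_decreasing linorder_neqE_nat less_irrefl)
  qed
  define \<mu> where "\<mu> = - lp m b e / 2"
  have \<mu>: "\<mu> > 0" using nullray_lp_le[OF b A(2)] nullray_lp_eq_0[OF b A(2)] A(6) by (auto simp: \<mu>_def)
  \<comment> \<open>A causal direction cannot be close to both \<open>b\<close> and
    \<open>e\<close>; the parallelogram inequality makes this a uniform bound on its pairing with
    \<open>y\<close>.\<close>
  have far: "\<mu> \<le> - lp m x y" if x: "x m = 1" "lp m x x \<le> 0" for x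
  proof -
    have sqd: "(\<Sum>i<m. (x i - s i)\<^sup>2) \<le> - 2 * lp m x s" if "s \<in> nullray m" for s
      using lp_direction[of x m s] x nullrayD[OF that] by simp
    have "(\<Sum>i<m. (b i - e i)\<^sup>2) \<le> (\<Sum>i<m. 2 * ((x i - b i)\<^sup>2 + (x i - e i)\<^sup>2))"
    proof (rule sum_mono)
      fix i
      have "2 * ((x i - b i)\<^sup>2 + (x i - e i)\<^sup>2) - (b i - e i)\<^sup>2 = (2 * x i - b i - e i)\<^sup>2"
        by (simp add: power2_eq_square algebra_simps)
      then show "(b i - e i)\<^sup>2 \<le> 2 * ((x i - b i)\<^sup>2 + (x i - e i)\<^sup>2)" by (smt (verit) zero_le_power2)
    qed
    also have "\<dots> = 2 * ((\<Sum>i<m. (x i - b i)\<^sup>2) + (\<Sum>i<m. (x i - e i)\<^sup>2))"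
      by (simp add: sum_distrib_left sum.distrib)
    also have "\<dots> \<le> 2 * (- 2 * lp m x b + - 2 * lp m x e)"
      by (intro mult_left_mono add_mono sqd b A(2)) auto
    finally have "- 2 * lp m b e \<le> 2 * (- 2 * lp m x b + - 2 * lp m x e)"
      unfolding nullray_lp[OF b A(2)] .
    then show ?thesis unfolding y_def lp_linear \<mu>_def by (simp add: field_simps)
  qed
  have ycausal: "lp m y y \<le> 0" "y m = 2"
    using nullrayD[OF b] nullrayD[OF A(2)] nullray_lp_le[OF b A(2)] lp_commute[of m e b]
    by (simp_all add: y_def lp_linear)
  \<comment> \<open>One factor \<mu> comes from \<open>far\<close> for the normalised image of
    \<open>y\<close>, the other from \<open>far\<close> for the column direction of the
    inverse.\<close>
  have bound: "D k $$ (m, m) \<le> (- 2 * lp m b e + \<bar>c\<bar>) / \<mu>\<^sup>2" for k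
  proof -
    note SD = G_SO[OF D, of k]
    let ?z = "mv m (D k) y"
    have z: "?z m > 0" "lp m ?z ?z \<le> 0"
      using mv_time_pos[OF SD] ycausal by (simp_all add: lp_mv[OF SD])
    have "\<mu> \<le> - lp m (\<lambda>i. 1 / ?z m * ?z i) y"
    proof (rule far)
      show "1 / ?z m * ?z m = 1" using z by simp
      show "lp m (\<lambda>i. 1 / ?z m * ?z i) (\<lambda>i. 1 / ?z m * ?z i) \<le> 0"
        unfolding lp_linear using z by (intro mult_nonneg_nonpos) auto
    qed
    then have 1: "?z m * \<mu> \<le> - lp m ?z y" unfolding lp_linear using z by (simp add: field_simps)
    have "\<mu> \<le> - lp m (col_dir m (adj m (D k))) y"
      by (rule far) (use col_dir_time[OF adj_in_SO_plus[OF SD]] lp_col_dir[OF adj_in_SO_plus[OF SD]] in auto)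
    then have 2: "D k $$ (m, m) * \<mu> \<le> ?z m"
      using SO_plus_diag_ge_1[OF SD] unfolding mv_time_col_dir[OF SD]
      by (metis mult_left_mono mult_minus_right order_trans zero_le_one)
    have "D k $$ (m, m) * \<mu> * \<mu> \<le> ?z m * \<mu>" using 2 \<mu> by (intro mult_right_mono) auto
    also have "\<dots> \<le> - lp m ?z y" by (rule 1)
    also have "\<dots> \<le> - 2 * lp m b e + \<bar>c\<bar>"
    proof -
      have "\<bar>\<theta> ^ k * c\<bar> \<le> 1 * \<bar>c\<bar>"
        unfolding abs_mult using \<theta> by (intro mult_right_mono) (auto simp: power_le_one)
      then show ?thesis unfolding val by linarith
    qed
    finally show ?thesis using \<mu> by (simp add: field_simps power2_eq_square)
  qed
  have "finite (range D)"
    by (rule finite_subset[OF _ finite_bounded]) (use D bound in blast)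
  then show False using \<open>inj D\<close> finite_imageD infinite_UNIV_nat by blast
qed

text \<open>The repelling limits \<open>b\<close> and \<open>b'\<close> may coincide; an element
  moving \<open>b\<close> off itself is then inserted between the two sequences. Inverting the
  product exchanges the roles of \<open>A\<close> and \<open>B\<close>, so a single sequence gets
  both prescribed limits.\<close>

lemma lox_dense:
  assumes p: "p \<in> nullray m" and q: "q \<in> nullray m" and "p \<noteq> q"
  shows "lox_near p q"
proof -
  obtain A b where A: "attr_seq A p" "b \<in> nullray m"
    "\<And>i. (\<lambda>k. col_dir m (adj m (A k)) i) \<longlonglongrightarrow> b i"
    using ex_attr_repel[OF p] by metis
  obtain B b' where B: "attr_seq B q" "b' \<in> nullray m"
    "\<And>i. (\<lambda>k. col_dir m (adj m (B k)) i) \<longlonglongrightarrow> b' i"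
    using ex_attr_repel[OF q] by metis
  have A1: "A k \<in> \<Gamma>" and B1: "B k \<in> \<Gamma>" for k using A B by (auto simp: attr_seq_def)
  obtain h where h: "h \<in> \<Gamma>" "lp m b (mv m h b') \<noteq> 0"
  proof (cases "b = b'")
    case True
    then show ?thesis using no_fixed_ray[OF A(2)] that by blast
  next
    case False
    have "lp m b (mv m (1\<^sub>m (m + 1)) b') = lp m b b'"
      using mv_one by (intro lp_cong) auto
    then show ?thesis using that[OF G_one] False nullray_lp_eq_0[OF A(2) B(2)] by auto
  qed
  have h': "adj m h \<in> \<Gamma>" "lp m b' (mv m (adj m h) b) \<noteq> 0"
    using h G_adj lp_mv_adj[of m h b' b] lp_commute[of m b] by auto
  let ?C = "\<lambda>k. A k * h * adj m (B k)"
  have C: "attr_seq ?C p" by (rule attr_seq_product[OF A(1,3,2) B1 B(3,2) h])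
  have "attr_seq (\<lambda>k. B k * adj m h * adj m (A k)) q"
    by (rule attr_seq_product[OF B(1,3,2) A1 A(3,2) h'])
  moreover have "B k * adj m h * adj m (A k) = adj m (?C k)" for k
  proof -
    have "adj m (?C k) = B k * (adj m h * adj m (A k))"
      using G_mat A1 B1 h G_mult G_adj by (simp add: adj_mult[simplified] adj_adj[simplified])
    then show ?thesis
      using assoc_mult_mat[OF G_mat[OF B1, of k] adj_carrier[of m h] adj_carrier[of m "A k"]] by simp
  qed
  ultimately have "(\<lambda>k. col_dir m (adj m (?C k)) i) \<longlonglongrightarrow> q i" for i
    by (simp add: attr_seq_def)
  then show ?thesis using lox_nearI[OF m1 C _ p q \<open>p \<noteq> q\<close>] by blast
qed

end

section \<open>The action on complex vectors\<close>

text \<open>Reindexes the coordinates touched by the embedded group, the last one from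
  \<open>n\<close> to \<open>m\<close>, so that \<open>mv\<close> and \<open>lp\<close> apply
  unchanged.\<close>

definition lor :: "nat \<Rightarrow> nat \<Rightarrow> (nat \<Rightarrow> 'a) \<Rightarrow> nat \<Rightarrow> 'a" where
  "lor m n f = (\<lambda>i. if i < m then f i else f n)"

definition cact :: "nat \<Rightarrow> nat \<Rightarrow> real mat \<Rightarrow> (nat \<Rightarrow> complex) \<Rightarrow> nat \<Rightarrow> complex" where
  "cact m n A f = (\<lambda>i. if i < m then mv m A (lor m n f) i else if i = n then mv m A (lor m n f) m else f i)"

text \<open>As \<open>s\<close> is real, this is the complex conjugate of the Hermitian product of
  \<open>s\<close> with \<open>f\<close>; it vanishes when \<open>f\<close> lies on the tangent
  hyperplane at \<open>s\<close>.\<close>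

definition pairing :: "nat \<Rightarrow> nat \<Rightarrow> (nat \<Rightarrow> real) \<Rightarrow> (nat \<Rightarrow> complex) \<Rightarrow> complex" where
  "pairing m n s f = lp m (\<lambda>i. of_real (s i)) (lor m n f)"

definition Om0 :: "nat \<Rightarrow> nat \<Rightarrow> (nat \<Rightarrow> complex) set" where
  "Om0 m n = {f. \<forall>s\<in>nullray m. pairing m n s f \<noteq> 0}"

definition norm1 :: "nat \<Rightarrow> (nat \<Rightarrow> complex) \<Rightarrow> real" where
  "norm1 n f = (\<Sum>i\<le>n. norm (f i))"

text \<open>All three terms are preserved by the action: the Hermitian and the bilinear value of the
  Lorentz part, and the coordinates left fixed. It is homogeneous of degree 2, so its quotient by
  the square of \<open>norm1\<close> lives on projective space.\<close>

definition inv_size :: "nat \<Rightarrow> nat \<Rightarrow> (nat \<Rightarrow> complex) \<Rightarrow> real" where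
  "inv_size m n f = norm (lp m (lor m n f) (\<lambda>i. cnj (lor m n f i))) + norm (lp m (lor m n f) (lor m n f))
     + (\<Sum>i\<in>{m..<n}. (norm (f i))\<^sup>2)"

definition embed_real :: "nat \<Rightarrow> nat \<Rightarrow> (nat \<Rightarrow> real) \<Rightarrow> nat \<Rightarrow> complex" where
  "embed_real m n x = (\<lambda>i. if i < m then of_real (x i) else if i = n then of_real (x m) else 0)"

lemma mv_of_real: "mv m A (\<lambda>i. of_real (x i)) = (\<lambda>i. of_real (mv m A x i) :: complex)"
  by (auto simp: mv_def)

lemma mv_cnj: "mv m A (\<lambda>i. cnj (x i)) = (\<lambda>i. cnj (mv m A x i))"
  by (auto simp: mv_def)

lemma lp_of_real: "lp m (\<lambda>i. of_real (x i)) (\<lambda>i. of_real (y i)) = (of_real (lp m x y) :: complex)"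
  by (simp add: lp_def)

lemma continuous_on_lor: "continuous_on UNIV (\<lambda>f::nat \<Rightarrow> 'a::topological_space. lor m n f i)"
  by (cases "i < m") (auto simp: lor_def continuous_on_component)

lemma continuous_on_pairing: "continuous_on UNIV (pairing m n s)"
  unfolding pairing_def by (intro continuous_on_lp continuous_on_lor continuous_on_const)

lemma continuous_on_norm1: "continuous_on UNIV (norm1 n)"
  unfolding norm1_def by (intro continuous_intros continuous_on_component)

lemma continuous_on_inv_size: "continuous_on UNIV (inv_size m n)"
  unfolding inv_size_def by (intro continuous_intros continuous_on_lp continuous_on_lor continuous_on_component)

lemma pairing_scale: "pairing m n s (\<lambda>i. c * f i) = c * pairing m n s f"
proof -
  have "lor m n (\<lambda>i. c * f i) = (\<lambda>i. c * lor m n f i)" by (auto simp: lor_def)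
  then show ?thesis unfolding pairing_def by (simp add: lp_linear)
qed

lemma pairing_scale_left: "pairing m n (\<lambda>i. c * s i) f = of_real c * pairing m n s f"
  unfolding pairing_def by (simp add: lp_linear)

lemma pairing_cong: "m \<le> n \<Longrightarrow> (\<And>i. i \<le> n \<Longrightarrow> f i = g i) \<Longrightarrow> pairing m n s f = pairing m n s g"
  unfolding pairing_def by (rule lp_cong) (auto simp: lor_def)

lemma lor_cact: "m \<le> n \<Longrightarrow> i \<le> m \<Longrightarrow> lor m n (cact m n A f) i = mv m A (lor m n f) i"
  by (auto simp: lor_def cact_def)

lemma lor_embed_real: "i \<le> m \<Longrightarrow> m \<le> n \<Longrightarrow> lor m n (embed_real m n x) i = of_real (x i)"
  by (auto simp: lor_def embed_real_def)

lemma pairing_cact: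
  assumes "m \<le> n"
  shows "pairing m n s (cact m n A f) = pairing m n (mv m (adj m A) s) f"
proof -
  have "pairing m n s (cact m n A f) = lp m (\<lambda>i. of_real (s i)) (mv m A (lor m n f))"
    unfolding pairing_def using lor_cact[OF assms] by (intro lp_cong) auto
  also have "\<dots> = lp m (mv m A (lor m n f)) (\<lambda>i. of_real (s i))" by (rule lp_commute)
  also have "\<dots> = lp m (lor m n f) (mv m (adj m A) (\<lambda>i. of_real (s i)))" by (rule lp_mv_adj)
  also have "\<dots> = lp m (mv m (adj m A) (\<lambda>i. of_real (s i))) (lor m n f)" by (rule lp_commute)
  finally show ?thesis by (simp add: pairing_def mv_of_real)
qed

lemma norm1_scale: "norm1 n (\<lambda>i. c * f i) = norm c * norm1 n f"
  by (simp add: norm1_def norm_mult sum_distrib_left)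

lemma norm1_nonneg: "0 \<le> norm1 n f"
  by (simp add: norm1_def sum_nonneg)

lemma norm1_cong: "(\<And>i. i \<le> n \<Longrightarrow> f i = g i) \<Longrightarrow> norm1 n f = norm1 n g"
  by (simp add: norm1_def)

lemma norm1_pos: "f \<in> nz n \<Longrightarrow> 0 < norm1 n f"
  unfolding norm1_def nz_def by (auto intro!: sum_pos2)

lemma norm_le_norm1: "i \<le> n \<Longrightarrow> norm (f i) \<le> norm1 n f"
  unfolding norm1_def by (rule member_le_sum) auto

lemma sum_le_norm1:
  assumes "m \<le> n"
  shows "(\<Sum>i<m. norm (f i)) + norm (f n) \<le> norm1 n f"
proof -
  have "(\<Sum>i<m. norm (f i)) + norm (f n) = (\<Sum>i\<in>insert n {..<m}. norm (f i))"
    using assms by (subst sum.insert) auto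
  also have "\<dots> \<le> norm1 n f" unfolding norm1_def by (rule sum_mono2) (use assms in auto)
  finally show ?thesis .
qed

lemma norm_lp_le:
  assumes "m \<le> n" "\<And>i. i \<le> m \<Longrightarrow> norm (x i) \<le> C" "0 \<le> C"
  shows "norm (lp m x (lor m n f)) \<le> C * norm1 n f"
proof -
  have "norm (lp m x (lor m n f)) \<le> norm (\<Sum>i<m. x i * f i) + norm (x m * f n)"
    unfolding lp_def by (simp add: lor_def norm_triangle_ineq4)
  also have "\<dots> \<le> (\<Sum>i<m. norm (x i) * norm (f i)) + norm (x m) * norm (f n)"
    by (intro add_mono order_trans[OF norm_sum] sum_mono) (auto simp: norm_mult)
  also have "\<dots> \<le> (\<Sum>i<m. C * norm (f i)) + C * norm (f n)"
    using assms by (intro add_mono sum_mono mult_right_mono) auto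
  also have "\<dots> = C * ((\<Sum>i<m. norm (f i)) + norm (f n))" by (simp add: sum_distrib_left algebra_simps)
  also have "\<dots> \<le> C * norm1 n f" using assms by (intro mult_left_mono sum_le_norm1) auto
  finally show ?thesis .
qed

lemma norm_pairing_le:
  assumes "m \<le> n" "s \<in> nullray m"
  shows "norm (pairing m n s f) \<le> norm1 n f"
  unfolding pairing_def using norm_lp_le[of m n "\<lambda>i. of_real (s i)" 1 f] nullray_abs_le[OF assms(2)] assms(1) by simp

lemma inv_size_cong: "m \<le> n \<Longrightarrow> (\<And>i. i \<le> n \<Longrightarrow> f i = g i) \<Longrightarrow> inv_size m n f = inv_size m n g"
proof -
  assume "m \<le> n" "\<And>i. i \<le> n \<Longrightarrow> f i = g i"
  then have "lor m n f i = lor m n g i" for i by (simp add: lor_def)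
  then show ?thesis unfolding inv_size_def
    using \<open>\<And>i. i \<le> n \<Longrightarrow> f i = g i\<close> by (intro arg_cong2[where f="(+)"] sum.cong) (auto simp: lp_def)
qed

lemma inv_size_scale: "inv_size m n (\<lambda>i. c * f i) = (norm c)\<^sup>2 * inv_size m n f"
proof -
  have "lor m n (\<lambda>i. c * f i) = (\<lambda>i. c * lor m n f i)" by (auto simp: lor_def)
  then show ?thesis unfolding inv_size_def
    by (simp add: lp_linear norm_mult power_mult_distrib sum_distrib_left distrib_left power2_eq_square mult_ac)
qed

lemma inv_size_cact:
  assumes A: "A \<in> carrier (SO_plus m)" and mn: "m \<le> n"
  shows "inv_size m n (cact m n A f) = inv_size m n f"
proof -
  have "lp m (lor m n (cact m n A f)) (\<lambda>i. cnj (lor m n (cact m n A f) i))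
      = lp m (mv m A (lor m n f)) (mv m A (\<lambda>i. cnj (lor m n f i)))"
    using lor_cact[OF mn] by (intro lp_cong) (auto simp: mv_cnj)
  moreover have "lp m (lor m n (cact m n A f)) (lor m n (cact m n A f)) = lp m (mv m A (lor m n f)) (mv m A (lor m n f))"
    using lor_cact[OF mn] by (intro lp_cong) auto
  ultimately show ?thesis unfolding inv_size_def by (simp add: lp_mv[OF A] cact_def)
qed

lemma inv_size_le:
  assumes "m \<le> n"
  shows "inv_size m n f \<le> 3 * (norm1 n f)\<^sup>2"
proof -
  have u: "norm (lor m n f i) \<le> norm1 n f" for i
    using norm_le_norm1[of i n f] norm_le_norm1[of n n f] assms by (auto simp: lor_def)
  have "norm (lp m (lor m n f) (\<lambda>i. cnj (lor m n f i))) \<le> norm1 n f * norm1 n f"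
    unfolding lp_commute[of m "lor m n f" "\<lambda>i. cnj (lor m n f i)"]
    using u norm1_nonneg by (intro norm_lp_le assms) auto
  moreover have "norm (lp m (lor m n f) (lor m n f)) \<le> norm1 n f * norm1 n f"
    using u norm1_nonneg by (intro norm_lp_le assms) auto
  moreover have "(\<Sum>i\<in>{m..<n}. (norm (f i))\<^sup>2) \<le> norm1 n f * norm1 n f"
  proof -
    have "(\<Sum>i\<in>{m..<n}. (norm (f i))\<^sup>2) \<le> (\<Sum>i\<in>{m..<n}. norm1 n f * norm (f i))"
      by (rule sum_mono) (auto simp: power2_eq_square intro!: mult_right_mono norm_le_norm1)
    also have "\<dots> = norm1 n f * (\<Sum>i\<in>{m..<n}. norm (f i))" by (simp add: sum_distrib_left)
    also have "\<dots> \<le> norm1 n f * norm1 n f"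
    proof (rule mult_left_mono[OF _ norm1_nonneg])
      show "(\<Sum>i\<in>{m..<n}. norm (f i)) \<le> norm1 n f" unfolding norm1_def by (rule sum_mono2) auto
    qed
    finally show ?thesis .
  qed
  ultimately show ?thesis unfolding inv_size_def power2_eq_square by linarith
qed

lemma embed_real_nz: "s \<in> nullray m \<Longrightarrow> m \<le> n \<Longrightarrow> embed_real m n s \<in> nz n"
  using nullrayD(1)[of s m] by (auto simp: nz_def embed_real_def intro!: exI[of _ n])

text \<open>The Hermitian equation forces a nonzero last coordinate. After scaling it to 1, the
  identity 4 (Im z)^2 = 2 z cnj z - z^2 - (cnj z)^2, summed over the coordinates, makes all
  imaginary parts vanish.\<close>

lemma inv_size_eq_0_imp:
  assumes f: "f \<in> nz n" and h: "inv_size m n f = 0" and mn: "m \<le> n"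
  shows "\<exists>s\<in>nullray m. pp n f = pp n (embed_real m n s)"
proof -
  have nonneg: "0 \<le> (\<Sum>i\<in>{m..<n}. (norm (f i))\<^sup>2)" by (rule sum_nonneg) auto
  let ?u = "lor m n f"
  have h1: "lp m ?u (\<lambda>i. cnj (?u i)) = 0" "lp m ?u ?u = 0" and w: "(\<Sum>i\<in>{m..<n}. (norm (f i))\<^sup>2) = 0"
    using h nonneg norm_ge_zero[of "lp m ?u (\<lambda>i. cnj (?u i))"] norm_ge_zero[of "lp m ?u ?u"]
    unfolding inv_size_def by (smt (verit) norm_eq_zero)+
  have w0: "f i = 0" if "m \<le> i" "i < n" for i
    using w that by (subst (asm) sum_nonneg_eq_0_iff) auto
  have fn: "f n \<noteq> 0"
  proof
    assume "f n = 0"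
    then have "(\<Sum>i<m. f i * cnj (f i)) = 0" using h1 by (simp add: lp_def lor_def)
    then have "complex_of_real (\<Sum>i<m. (norm (f i))\<^sup>2) = 0" by (simp add: complex_norm_square del: of_real_power) 
    then have "(\<Sum>i<m. (norm (f i))\<^sup>2) = 0" by (simp only: of_real_eq_0_iff)
    then have "f i = 0" if "i < m" for i using that by (subst (asm) sum_nonneg_eq_0_iff) auto
    then have "f i = 0" if "i \<le> n" for i using w0 \<open>f n = 0\<close> that by (metis le_neq_implies_less not_le)
    then show False using f by (auto simp: nz_def)
  qed
  define g where "g = (\<lambda>i. ?u i / f n)"
  have g1: "lp m g (\<lambda>i. cnj (g i)) = 0" "lp m g g = 0" "g m = 1"
  proof -
    have "g = (\<lambda>i. 1 / f n * ?u i)" "(\<lambda>i. cnj (g i)) = (\<lambda>i. 1 / cnj (f n) * cnj (?u i))" by (auto simp: g_def)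
    then show "lp m g (\<lambda>i. cnj (g i)) = 0" "lp m g g = 0" by (simp_all only: lp_linear h1 mult_zero_right)
    show "g m = 1" using fn by (simp add: g_def lor_def)
  qed
  have z: "lp m g (\<lambda>i. cnj (g i)) + lp m g (\<lambda>i. cnj (g i)) - lp m g g - lp m (\<lambda>i. cnj (g i)) (\<lambda>i. cnj (g i)) = 0"
  proof -
    have "lp m (\<lambda>i. cnj (g i)) (\<lambda>i. cnj (g i)) = cnj (lp m g g)" by (simp add: lp_def)
    then show ?thesis using g1 by simp
  qed
  have "(\<Sum>i<m. 4 * complex_of_real ((Im (g i))\<^sup>2)) = 0"
  proof -
    have e: "4 * complex_of_real ((Im (g i))\<^sup>2) = g i * cnj (g i) + g i * cnj (g i) - g i * g i - cnj (g i) * cnj (g i)" for i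
      by (simp add: complex_eq_iff power2_eq_square)
    show ?thesis unfolding e sum.distrib sum_subtractf using g1(3) z by (simp add: lp_def algebra_simps)
  qed
  then have "complex_of_real (\<Sum>i<m. 4 * (Im (g i))\<^sup>2) = 0" by simp
  then have "(\<Sum>i<m. 4 * (Im (g i))\<^sup>2) = 0" by (simp only: of_real_eq_0_iff)
  then have "Im (g i) = 0" if "i < m" for i using that by (subst (asm) sum_nonneg_eq_0_iff) auto
  then have gr: "g i = of_real (Re (g i))" if "i \<le> m" for i
    using that g1(3) by (cases "i = m") (auto simp: complex_eq_iff)
  define s where "s = (\<lambda>i. if i \<le> m then Re (g i) else 0)"
  have "complex_of_real (lp m s s) = lp m g g"
    unfolding lp_of_real[symmetric] using gr by (intro lp_cong) (auto simp: s_def)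
  then have s: "s \<in> nullray m" using g1 by (simp add: nullray_def s_def)
  have "f i = f n * embed_real m n s i" if i: "i \<le> n" for i
  proof -
    consider "i < m" | "i = n" | "m \<le> i" "i < n" using i by linarith
    then show ?thesis
    proof cases
      case 1
      then have "f i = f n * g i" using fn by (simp add: g_def lor_def)
      then show ?thesis using 1 gr[of i] by (simp add: embed_real_def s_def)
    next
      case 2
      then show ?thesis using g1 mn by (simp add: embed_real_def s_def)
    next
      case 3
      then show ?thesis using w0 by (simp add: embed_real_def)
    qed
  qed
  then have "pp n f = pp n (embed_real m n s)"
    using f embed_real_nz[OF s mn] fn pp_eq_iff by blast
  then show ?thesis using s by blast
qed

text \<open>The pairing has a positive minimum on the compact set of null rays, and
  \<open>norm1\<close> controls its variation with \<open>f\<close>. The relative bound is invariant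
  under scaling; the absolute one gives openness and estimates for a fixed vector.\<close>

lemma Om0_locally_uniform:
  assumes f0: "f0 \<in> Om0 m n" and m: "1 \<le> m" and mn: "m \<le> n"
  shows "\<exists>\<delta>>0. \<exists>V. open V \<and> f0 \<in> V \<and>
    (\<forall>f\<in>V. \<forall>s\<in>nullray m. \<delta> \<le> norm (pairing m n s f) \<and> \<delta> * norm1 n f \<le> norm (pairing m n s f))"
proof -
  have "continuous_on (nullray m) (\<lambda>s. norm (pairing m n s f0))"
    unfolding pairing_def by (intro continuous_on_norm continuous_on_lp continuous_on_const continuous_on_of_real continuous_on_component)
  moreover have "nullray m \<noteq> {}" using ray_dir_nullray[of 0 m] m by auto
  ultimately obtain t where t: "t \<in> nullray m" "\<forall>s\<in>nullray m. norm (pairing m n t f0) \<le> norm (pairing m n s f0)"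
    using continuous_attains_inf[OF compact_nullray] by blast
  define c where "c = norm (pairing m n t f0)"
  have c: "c > 0" using f0 t by (simp add: c_def Om0_def)
  define V where "V = {f. norm1 n (\<lambda>i. f i - f0 i) < c / 2}"
  have "open V"
    unfolding V_def norm1_def
    by (intro open_Collect_less continuous_intros continuous_on_component)
  define \<delta> where "\<delta> = min (c / 2) (c / (2 * (norm1 n f0 + c)))"
  have N0: "norm1 n f0 \<ge> 0" by (rule norm1_nonneg)
  have \<delta>: "\<delta> > 0" using c N0 by (simp add: \<delta>_def)
  have "\<delta> \<le> norm (pairing m n s f) \<and> \<delta> * norm1 n f \<le> norm (pairing m n s f)" if f: "f \<in> V" and s: "s \<in> nullray m" for f s
  proof -
    have "pairing m n s (\<lambda>i. f i - f0 i) = pairing m n s f - pairing m n s f0"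
    proof -
      have "lor m n (\<lambda>i. f i - f0 i) = (\<lambda>i. lor m n f i - lor m n f0 i)" by (auto simp: lor_def)
      then show ?thesis unfolding pairing_def by (simp add: lp_linear)
    qed
    then have "norm (pairing m n s f - pairing m n s f0) < c / 2"
      using norm_pairing_le[OF mn s, of "\<lambda>i. f i - f0 i"] f by (simp add: V_def)
    moreover have "c \<le> norm (pairing m n s f0)" using t s by (simp add: c_def)
    ultimately have p: "c / 2 \<le> norm (pairing m n s f)"
      using norm_triangle_ineq2[of "pairing m n s f0" "pairing m n s f"] by (simp add: norm_minus_commute)
    have "norm1 n f \<le> norm1 n (\<lambda>i. f i - f0 i) + norm1 n f0"
      unfolding norm1_def sum.distrib[symmetric]
      by (rule sum_mono) (metis diff_add_cancel norm_triangle_ineq)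
    then have "norm1 n f \<le> norm1 n f0 + c" using f c by (simp add: V_def)
    then have "\<delta> * norm1 n f \<le> c / (2 * (norm1 n f0 + c)) * (norm1 n f0 + c)"
      using \<delta> c N0 norm1_nonneg[of n f] by (intro mult_mono) (auto simp: \<delta>_def)
    also have "\<dots> = c / 2"
    proof -
      have "norm1 n f0 + c \<noteq> 0" using c N0 by linarith
      then show ?thesis by (simp add: field_simps del: distrib_left_numeral)
    qed
    finally show ?thesis using p by (simp add: \<delta>_def)
  qed
  moreover have "f0 \<in> V" using c by (simp add: V_def norm1_def)
  ultimately show ?thesis using \<open>open V\<close> \<delta> by blast
qed

lemma open_Om0: "1 \<le> m \<Longrightarrow> m \<le> n \<Longrightarrow> open (Om0 m n)"
proof (rule Topological_Spaces.openI)
  fix f0 assume "1 \<le> m" "m \<le> n" "f0 \<in> Om0 m n"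
  from Om0_locally_uniform[OF this(3,1,2)] obtain \<delta> V where "\<delta> > 0" "open V" "f0 \<in> V"
    and V: "\<forall>f\<in>V. \<forall>s\<in>nullray m. \<delta> \<le> norm (pairing m n s f)" by blast
  then have "V \<subseteq> Om0 m n" by (force simp: Om0_def)
  then show "\<exists>T. open T \<and> f0 \<in> T \<and> T \<subseteq> Om0 m n" using \<open>open V\<close> \<open>f0 \<in> V\<close> by blast
qed

lemma Om0_subset_nz: "1 \<le> m \<Longrightarrow> m \<le> n \<Longrightarrow> Om0 m n \<subseteq> nz n"
proof (rule subsetI, rule ccontr)
  fix f assume *: "1 \<le> m" "m \<le> n" "f \<in> Om0 m n" "f \<notin> nz n"
  then have "lor m n f i = 0" for i by (auto simp: lor_def nz_def)
  then have "pairing m n (ray_dir m 0) f = 0" by (simp add: pairing_def lp_def)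
  then show False using * ray_dir_nullray[of 0 m] by (auto simp: Om0_def)
qed

lemma pp_Om0_iff:
  assumes "1 \<le> m" "m \<le> n" "f \<in> nz n"
  shows "pp n f \<in> pp n ` Om0 m n \<longleftrightarrow> f \<in> Om0 m n"
proof
  assume "pp n f \<in> pp n ` Om0 m n"
  then obtain g where g: "g \<in> Om0 m n" "pp n f = pp n g" by blast
  then obtain c where c: "c \<noteq> 0" "\<forall>i\<le>n. f i = c * g i"
    using pp_eq_iff[of f n g] assms Om0_subset_nz by blast
  have "pairing m n s f = c * pairing m n s g" for s
    using pairing_cong[OF assms(2), of f "\<lambda>i. c * g i" s] c by (simp add: pairing_scale)
  then show "f \<in> Om0 m n" using g c by (simp add: Om0_def)
qed blast

lemma sum_atMost_split: "(\<Sum>j\<le>m::nat. g j) = (\<Sum>j<m. g j) + (g m :: 'a::comm_monoid_add)"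
  by (simp flip: lessThan_Suc_atMost)

lemma iota_mult_vec:
  assumes B: "B \<in> carrier_mat (m + 1) (m + 1)" and mn: "m \<le> n"
  shows "iota m n B *\<^sub>v vec (n + 1) f = vec (n + 1) (cact m n B f)"
proof (rule eq_vecI)
  note C = iota_carrier[OF B mn]
  show "dim_vec (iota m n B *\<^sub>v vec (n + 1) f) = dim_vec (vec (n + 1) (cact m n B f))"
    using C by simp
  fix i assume "i < dim_vec (vec (n + 1) (cact m n B f))"
  then have i: "i \<le> n" by simp
  have v: "(iota m n B *\<^sub>v vec (n + 1) f) $ i = (\<Sum>j\<le>n. iota m n B $$ (i, j) * f j)"
    using C i by (auto simp: scalar_prod_def atLeast0LessThan lessThan_Suc_atMost)
  show "(iota m n B *\<^sub>v vec (n + 1) f) $ i = vec (n + 1) (cact m n B f) $ i"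
  proof (cases "i < m \<or> i = n")
    case True
    define k where "k = (if i = n then m else i)"
    have k: "k \<le> m" "cact m n B f i = mv m B (lor m n f) k"
      using True mn by (auto simp: k_def cact_def)
    have "(\<Sum>j\<le>n. iota m n B $$ (i, j) * f j) = (\<Sum>j\<in>insert n {..<m}. iota m n B $$ (i, j) * f j)"
    proof (rule sum.mono_neutral_right)
      show "\<forall>j\<in>{..n} - insert n {..<m}. iota m n B $$ (i, j) * f j = 0"
        using True i by (auto simp: iota_index[OF B mn] Let_def)
    qed (use mn in auto)
    also have "\<dots> = (\<Sum>j<m. iota m n B $$ (i, j) * f j) + iota m n B $$ (i, n) * f n"
      using mn by (subst sum.insert) auto
    also have "(\<Sum>j<m. iota m n B $$ (i, j) * f j) = (\<Sum>j<m. of_real (B $$ (k, j)) * lor m n f j)"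
      using True i mn by (intro sum.cong) (auto simp: iota_index[OF B mn] Let_def k_def lor_def)
    also have "iota m n B $$ (i, n) = of_real (B $$ (k, m))"
      using True i by (auto simp: iota_index[OF B mn] Let_def k_def)
    also have "(\<Sum>j<m. of_real (B $$ (k, j)) * lor m n f j) + of_real (B $$ (k, m)) * f n = mv m B (lor m n f) k"
      using k by (simp add: mv_def sum_atMost_split) (simp add: lor_def)
    finally show ?thesis using v k i by simp
  next
    case False
    then have "(\<Sum>j\<le>n. iota m n B $$ (i, j) * f j) = (\<Sum>j\<le>n. if j = i then f i else 0)"
      using i by (intro sum.cong) (auto simp: iota_index[OF B mn] Let_def)
    then show ?thesis using v i False by (simp add: cact_def)
  qed
qed

lemma proj_act_iota:
  assumes B: "B \<in> carrier_mat (m + 1) (m + 1)" and mn: "m \<le> n"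
  shows "proj_act (iota m n B) (pp n f) = pp n (cact m n B f)"
proof -
  have "iota m n B *\<^sub>v (c \<cdot>\<^sub>v vec (n + 1) f) = c \<cdot>\<^sub>v vec (n + 1) (cact m n B f)" for c
    by (simp only: mult_mat_vec[OF iota_carrier[OF B mn] vec_carrier] iota_mult_vec[OF B mn])
  then show ?thesis
    unfolding pp_def proj_pt_def proj_act_def by (simp only: setcompr_eq_image image_image)
qed

lemma cact_adj:
  assumes A: "A \<in> carrier (SO_plus m)" and mn: "m \<le> n" and i: "i \<le> n"
  shows "cact m n (adj m A) (cact m n A f) i = f i"
proof -
  have "mv m (adj m A) (lor m n (cact m n A f)) = mv m (adj m A) (mv m A (lor m n f))"
    using lor_cact[OF mn] by (intro mv_cong) auto
  then show ?thesis using mv_adj_mv(1)[OF A, of _ "lor m n f"] by (auto simp: cact_def lor_def)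
qed

lemma cact_nz:
  assumes A: "A \<in> carrier (SO_plus m)" and mn: "m \<le> n" and f: "f \<in> nz n"
  shows "cact m n A f \<in> nz n"
proof (rule ccontr)
  assume "cact m n A f \<notin> nz n"
  then have z: "\<forall>i\<le>n. cact m n A f i = 0" by (simp add: nz_def)
  then have "lor m n (cact m n A f) j = 0" for j using mn by (auto simp: lor_def)
  then have "cact m n (adj m A) (cact m n A f) i = 0" if "i \<le> n" for i
    using z that by (auto simp: cact_def[of m n "adj m A"] mv_def)
  then show False using cact_adj[OF A mn] f by (auto simp: nz_def)
qed

lemma cact_in_Om0:
  assumes A: "A \<in> carrier (SO_plus m)" and mn: "m \<le> n" and f: "f \<in> Om0 m n"
  shows "cact m n A f \<in> Om0 m n"
proof -
  have "pairing m n s (cact m n A f) \<noteq> 0" if s: "s \<in> nullray m" for s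
  proof -
    note A' = adj_in_SO_plus[OF A]
    have "pairing m n s (cact m n A f) = of_real (mv m (adj m A) s m) * pairing m n (ray_act m (adj m A) s) f"
      unfolding pairing_cact[OF mn] by (subst mv_ray_act[OF A' s]) (simp only: pairing_scale_left)
    then show ?thesis
      using f ray_act_nullray[OF A' s] mv_nullray_pos[OF A' s] by (simp add: Om0_def)
  qed
  then show ?thesis by (simp add: Om0_def)
qed

lemma cact_embed_real: "m \<le> n \<Longrightarrow> cact m n A (embed_real m n x) = embed_real m n (mv m A x)"
proof -
  assume mn: "m \<le> n"
  have "mv m A (lor m n (embed_real m n x)) = mv m A (\<lambda>i. of_real (x i))"
    using mn by (intro mv_cong) (simp add: lor_embed_real)
  then show ?thesis by (auto simp: cact_def embed_real_def[of m n "mv m A x"] mv_of_real) (auto simp: embed_real_def)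
qed

lemma pairing_embed_real: "m \<le> n \<Longrightarrow> pairing m n s (embed_real m n x) = of_real (lp m s x)"
  unfolding pairing_def lp_of_real[symmetric] by (intro lp_cong) (simp_all add: lor_embed_real)

lemma embed_real_in_Om0:
  assumes "m \<le> n" "lp m x x < 0" "x m > 0"
  shows "embed_real m n x \<in> Om0 m n"
  unfolding Om0_def
proof (intro CollectI ballI)
  fix s assume "s \<in> nullray m"
  then have "lp m x s < 0" using lp_causal_neg[OF assms(2) _ assms(3), of s] nullrayD[of s m] by simp
  then show "pairing m n s (embed_real m n x) \<noteq> 0" using assms by (simp add: pairing_embed_real lp_commute[of m s x])
qed

section \<open>Proper discontinuity\<close>

locale kulkarni_setup = full_lorentz_lattice +
  fixes n :: nat
  assumes mn: "m \<le> n"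
begin

abbreviation "X \<equiv> (proj_space n :: complex vec set topology)"
abbreviation "GG \<equiv> iota m n ` \<Gamma>"
abbreviation "L0 \<equiv> kulkarni_L0 X GG proj_act"
abbreviation "L1 \<equiv> kulkarni_L1 X GG proj_act"
abbreviation "L2 \<equiv> kulkarni_L2 X GG proj_act"

definition Lam :: "complex vec set set" where
  "Lam = topspace X - pp n ` Om0 m n"

lemma act_pp: "A \<in> \<Gamma> \<Longrightarrow> proj_act (iota m n A) (pp n f) = pp n (cact m n A f)"
  using proj_act_iota[OF G_mat mn] .

lemma openin_Om0: "openin X (pp n ` Om0 m n)"
  using openin_pp_image[OF open_Om0[OF m1 mn], of n] Om0_subset_nz[OF m1 mn] by (simp add: Int_absorb2)

lemma closedin_Lam: "closedin X Lam"
  unfolding Lam_def using openin_Om0 by auto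

lemma pp_in_Lam_iff: "f \<in> nz n \<Longrightarrow> pp n f \<in> Lam \<longleftrightarrow> (\<exists>s\<in>nullray m. pairing m n s f = 0)"
  unfolding Lam_def using pp_Om0_iff[OF m1 mn] pp_in_topspace by (auto simp: Om0_def)

text \<open>Off the real null points the quotient of \<open>inv_size\<close> by the squared norm is
  positive. The open sets where it exceeds 1 / (k + 1) increase with k and cover
  \<open>K\<close>.\<close>

lemma inv_size_lower_bound:
  assumes K: "compactin X K" and disj: "\<And>s. s \<in> nullray m \<Longrightarrow> pp n (embed_real m n s) \<notin> K"
  shows "\<exists>\<epsilon>>0. \<forall>f\<in>nz n. pp n f \<in> K \<longrightarrow> \<epsilon> * (norm1 n f)\<^sup>2 \<le> inv_size m n f"
proof -
  define V where "V = (\<lambda>k. {f. (norm1 n f)\<^sup>2 < real (Suc k) * inv_size m n f})"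
  define W where "W = (\<lambda>k. pp n ` (V k \<inter> nz n))"
  have "open (V k)" for k
    unfolding V_def by (intro open_Collect_less continuous_intros continuous_on_norm1 continuous_on_inv_size)
  then have W: "openin X (W k)" for k unfolding W_def by (rule openin_pp_image)
  have Viff: "f \<in> V k" if f: "f \<in> nz n" "pp n f \<in> W k" for f k
  proof -
    obtain g where g: "g \<in> V k" "g \<in> nz n" "pp n f = pp n g" using f by (auto simp: W_def)
    then obtain c where c: "c \<noteq> 0" "\<forall>i\<le>n. f i = c * g i" using pp_eq_iff f by blast
    have "norm1 n f = norm c * norm1 n g" "inv_size m n f = (norm c)\<^sup>2 * inv_size m n g"
      using norm1_cong[of n f "\<lambda>i. c * g i"] inv_size_cong[OF mn, of f "\<lambda>i. c * g i"] c
      by (simp_all add: norm1_scale inv_size_scale)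
    then show ?thesis using g c by (simp add: V_def power_mult_distrib mult.left_commute)
  qed
  have cover: "K \<subseteq> \<Union>(range W)"
  proof
    fix x assume x: "x \<in> K"
    then have "x \<in> topspace X" using K compactin_subset_topspace by blast
    then obtain f where f: "f \<in> nz n" "x = pp n f" by (auto simp: topspace_proj_pp)
    have "inv_size m n f \<noteq> 0" using inv_size_eq_0_imp[OF f(1) _ mn] disj x f by metis
    moreover have "inv_size m n f \<ge> 0" unfolding inv_size_def by (intro add_nonneg_nonneg sum_nonneg) auto
    ultimately have h: "inv_size m n f > 0" by simp
    obtain k where "(norm1 n f)\<^sup>2 / inv_size m n f < real k" using reals_Archimedean2 by blast
    then have "(norm1 n f)\<^sup>2 < real (Suc k) * inv_size m n f" using h by (simp add: field_simps)
    then have "f \<in> V k" by (simp add: V_def)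
    then show "x \<in> \<Union>(range W)" using f by (auto simp: W_def)
  qed
  have "\<exists>\<F>. finite \<F> \<and> \<F> \<subseteq> range W \<and> K \<subseteq> \<Union>\<F>"
    using K W cover unfolding compactin_def by (metis (no_types, lifting) imageE)
  then obtain I where I: "finite I" "K \<subseteq> \<Union>(W ` I)"
    by (metis finite_subset_image)
  define N where "N = Max (insert 0 I)"
  have "1 / real (Suc N) * (norm1 n f)\<^sup>2 \<le> inv_size m n f" if f: "f \<in> nz n" "pp n f \<in> K" for f
  proof -
    obtain k where k: "k \<in> I" "pp n f \<in> W k" using I f by blast
    then have "(norm1 n f)\<^sup>2 < real (Suc k) * inv_size m n f" using Viff[OF f(1)] by (simp add: V_def)
    also have "\<dots> \<le> real (Suc N) * inv_size m n f"
    proof (rule mult_right_mono)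
      show "real (Suc k) \<le> real (Suc N)" unfolding N_def using I k by simp
      show "0 \<le> inv_size m n f" unfolding inv_size_def by (intro add_nonneg_nonneg sum_nonneg) auto
    qed
    finally show ?thesis by (simp add: field_simps)
  qed
  then show ?thesis by (intro exI[of _ "1 / real (Suc N)"]) auto
qed

text \<open>Near a point of \<open>Om0\<close> every pairing with a null ray is large; contracting one null ray by
  the inverse of \<open>A\<close> forces the image under \<open>A\<close> to be short, while \<open>inv_size\<close> is invariant.\<close>

lemma finite_meeting:
  assumes f0: "f0 \<in> Om0 m n" and K: "compactin X K"
    and disj: "\<And>s. s \<in> nullray m \<Longrightarrow> pp n (embed_real m n s) \<notin> K"
  shows "\<exists>U. openin X U \<and> pp n f0 \<in> U \<and> finite {g \<in> GG. U \<inter> proj_act g ` K \<noteq> {}}"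
proof -
  from Om0_locally_uniform[OF f0 m1 mn] obtain \<delta> V where \<delta>: "\<delta> > 0" "open V" "f0 \<in> V"
    and V: "\<forall>f\<in>V. \<forall>s\<in>nullray m. \<delta> \<le> norm (pairing m n s f) \<and> \<delta> * norm1 n f \<le> norm (pairing m n s f)" by blast
  from inv_size_lower_bound[OF K disj] obtain \<epsilon> where \<epsilon>: "\<epsilon> > 0"
    "\<forall>f\<in>nz n. pp n f \<in> K \<longrightarrow> \<epsilon> * (norm1 n f)\<^sup>2 \<le> inv_size m n f" by blast
  define U where "U = pp n ` (V \<inter> nz n)"
  have "openin X U" unfolding U_def by (rule openin_pp_image[OF \<delta>(2)])
  moreover have "pp n f0 \<in> U" unfolding U_def using \<delta> f0 Om0_subset_nz[OF m1 mn] by blast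
  moreover have "finite {g \<in> GG. U \<inter> proj_act g ` K \<noteq> {}}"
  proof (rule finite_subset)
    show "finite (iota m n ` {A \<in> \<Gamma>. A $$ (m, m) \<le> 3 / (\<epsilon> * \<delta>\<^sup>2)})" using finite_bounded by blast
    have "A $$ (m, m) \<le> 3 / (\<epsilon> * \<delta>\<^sup>2)" if A: "A \<in> \<Gamma>" and ne: "U \<inter> proj_act (iota m n A) ` K \<noteq> {}" for A
    proof -
      let ?d = "A $$ (m, m)"
      note SO = G_SO[OF A]
      note SO' = adj_in_SO_plus[OF SO]
      have d1: "?d \<ge> 1" by (rule SO_plus_diag_ge_1[OF SO])
      from ne obtain x where x: "x \<in> K" "proj_act (iota m n A) x \<in> U" by blast
      then have "x \<in> topspace X" using K compactin_subset_topspace by blast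
      then obtain f where f: "f \<in> nz n" "x = pp n f" by (auto simp: topspace_proj_pp)
      let ?g = "cact m n A f"
      have gz: "?g \<in> nz n" by (rule cact_nz[OF SO mn f(1)])
      have "pp n ?g \<in> U" using x f act_pp[OF A] by simp
      then obtain h where h: "h \<in> V" "h \<in> nz n" "pp n ?g = pp n h" by (auto simp: U_def)
      then obtain c where c: "c \<noteq> 0" "\<forall>i\<le>n. ?g i = c * h i" using pp_eq_iff gz by blast
      have lower: "\<delta> * norm1 n ?g \<le> norm (pairing m n s ?g)" if "s \<in> nullray m" for s
      proof -
        have "norm1 n ?g = norm c * norm1 n h" "pairing m n s ?g = c * pairing m n s h"
          using norm1_cong[of n ?g "\<lambda>i. c * h i"] pairing_cong[OF mn, of ?g "\<lambda>i. c * h i"] c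
          by (simp_all add: norm1_scale pairing_scale)
        moreover have "norm c * (\<delta> * norm1 n h) \<le> norm c * norm (pairing m n s h)"
          using V h that by (intro mult_left_mono) auto
        ultimately show ?thesis by (simp add: norm_mult mult.left_commute)
      qed
      \<comment> \<open>A ray contracted by the inverse of \<open>A\<close>: its pairing with the
        image is the pairing of a short vector with \<open>f\<close>, hence at most
        \<open>norm1 n f / ?d\<close>. Near \<open>f0\<close> the same pairing is at least \<delta>
        times the norm of the image.\<close>
      obtain s where s: "s \<in> nullray m" "mv m (adj m A) s m \<le> 1 / ?d"
        using ex_nullray_contracted[OF SO' m1] by auto
      have "pairing m n s ?g = of_real (mv m (adj m A) s m) * pairing m n (ray_act m (adj m A) s) f"
        unfolding pairing_cact[OF mn] by (subst mv_ray_act[OF SO' s(1)]) (simp only: pairing_scale_left)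
      then have "norm (pairing m n s ?g) = mv m (adj m A) s m * norm (pairing m n (ray_act m (adj m A) s) f)"
        using mv_nullray_pos[OF SO' s(1)] by (simp add: norm_mult)
      also have "\<dots> \<le> 1 / ?d * norm1 n f"
        using s mv_nullray_pos[OF SO' s(1)] norm_pairing_le[OF mn ray_act_nullray[OF SO' s(1)]] d1
        by (intro mult_mono) auto
      finally have "\<delta> * norm1 n ?g \<le> norm1 n f / ?d" using lower[OF s(1)] by simp
      then have Ng: "norm1 n ?g \<le> norm1 n f / (\<delta> * ?d)" using \<delta> d1 by (simp add: field_simps)
      \<comment> \<open>The invariant is squeezed between \<epsilon> times the squared norm of
        \<open>f\<close> and 3 times the squared norm of its short image; 3 counts the terms of
        \<open>inv_size\<close>.\<close>
      have "\<epsilon> * (norm1 n f)\<^sup>2 \<le> inv_size m n ?g" using \<epsilon> f x inv_size_cact[OF SO mn] by simp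
      also have "\<dots> \<le> 3 * (norm1 n ?g)\<^sup>2" by (rule inv_size_le[OF mn])
      also have "\<dots> \<le> 3 * (norm1 n f / (\<delta> * ?d))\<^sup>2"
        using Ng norm1_nonneg by (intro mult_left_mono power_mono) auto
      finally have le: "\<epsilon> * (norm1 n f)\<^sup>2 \<le> 3 * (norm1 n f / (\<delta> * ?d))\<^sup>2" .
      have N: "(norm1 n f)\<^sup>2 > 0" using norm1_pos[OF f(1)] by simp
      have "3 * (norm1 n f / (\<delta> * ?d))\<^sup>2 = 3 / (\<delta> * ?d)\<^sup>2 * (norm1 n f)\<^sup>2" by (simp add: power_divide)
      then have "\<epsilon> * (norm1 n f)\<^sup>2 \<le> 3 / (\<delta> * ?d)\<^sup>2 * (norm1 n f)\<^sup>2" using le by argo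
      then have "\<epsilon> \<le> 3 / (\<delta> * ?d)\<^sup>2" using N by (rule mult_right_le_imp_le)
      then have "?d\<^sup>2 \<le> 3 / (\<epsilon> * \<delta>\<^sup>2)" using \<delta> \<epsilon> d1 by (simp add: field_simps power_mult_distrib)
      moreover have "?d \<le> ?d\<^sup>2" using d1 by (simp add: power2_eq_square)
      ultimately show ?thesis by linarith
    qed
    then show "{g \<in> GG. U \<inter> proj_act g ` K \<noteq> {}} \<subseteq> iota m n ` {A \<in> \<Gamma>. A $$ (m, m) \<le> 3 / (\<epsilon> * \<delta>\<^sup>2)}"
      by blast
  qed
  ultimately show ?thesis by blast
qed

lemma embed_real_in_Lam: "s \<in> nullray m \<Longrightarrow> pp n (embed_real m n s) \<in> Lam"
  using pp_in_Lam_iff[OF embed_real_nz[OF _ mn]] pairing_embed_real[OF mn, of s s] nullrayD(2) by force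

lemma finite_meeting_point:
  assumes f0: "f0 \<in> Om0 m n" and z: "z \<in> topspace X - Lam"
  shows "\<exists>U. openin X U \<and> pp n f0 \<in> U \<and> finite {g \<in> GG. proj_act g z \<in> U}"
proof -
  have "compactin X {z}" using z by simp
  moreover have "pp n (embed_real m n s) \<notin> {z}" if "s \<in> nullray m" for s
    using z embed_real_in_Lam[OF that] by auto
  ultimately obtain U where "openin X U" "pp n f0 \<in> U" "finite {g \<in> GG. U \<inter> proj_act g ` {z} \<noteq> {}}"
    using finite_meeting[OF f0, of "{z}"] by blast
  then show ?thesis by auto
qed

lemma L0_subset_Lam: "L0 \<subseteq> Lam"
  unfolding kulkarni_L0_def
proof (rule closure_of_minimal[OF _ closedin_Lam], rule subsetI, rule ccontr)
  fix x assume x: "x \<in> {x \<in> topspace X. infinite {g \<in> GG. proj_act g x = x}}" "x \<notin> Lam"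
  then have "x \<in> pp n ` Om0 m n" by (auto simp: Lam_def)
  then obtain f where f: "f \<in> Om0 m n" "x = pp n f" by blast
  from finite_meeting_point[OF f(1), of x] x obtain U where
    U: "pp n f \<in> U" "finite {g \<in> GG. proj_act g x \<in> U}" by blast
  have "{g \<in> GG. proj_act g x = x} \<subseteq> {g \<in> GG. proj_act g x \<in> U}" using U f by auto
  then show False using U x finite_subset by blast
qed

lemma act_Lam: "g \<in> GG \<Longrightarrow> z \<in> Lam \<Longrightarrow> proj_act g z \<in> Lam"
proof -
  assume g: "g \<in> GG" and z: "z \<in> Lam"
  obtain A where A: "A \<in> \<Gamma>" "g = iota m n A" using g by blast
  obtain f where f: "f \<in> nz n" "z = pp n f" using z by (auto simp: Lam_def topspace_proj_pp)
  have nzg: "cact m n A f \<in> nz n" by (rule cact_nz[OF G_SO[OF A(1)] mn f(1)])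
  have "cact m n A f \<notin> Om0 m n"
  proof
    assume "cact m n A f \<in> Om0 m n"
    then have "cact m n (adj m A) (cact m n A f) \<in> Om0 m n"
      using cact_in_Om0[OF G_SO[OF G_adj[OF A(1)]] mn] by blast
    moreover have "pairing m n s (cact m n (adj m A) (cact m n A f)) = pairing m n s f" for s
      using cact_adj[OF G_SO[OF A(1)] mn] by (intro pairing_cong mn) auto
    ultimately have "f \<in> Om0 m n" by (simp add: Om0_def)
    then show False using z f by (auto simp: Lam_def)
  qed
  then show ?thesis
    unfolding A f act_pp[OF A(1)] Lam_def using nzg pp_Om0_iff[OF m1 mn nzg] pp_in_topspace by blast
qed

text \<open>An orbit starting in \<open>Lam\<close> stays in this closed invariant set; an orbit
  starting outside visits a small neighbourhood of \<open>y\<close> for finitely many group elements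
  only.\<close>

lemma L1_subset_Lam: "L1 \<subseteq> Lam"
  unfolding kulkarni_L1_def
proof (rule closure_of_minimal[OF _ closedin_Lam], rule subsetI, rule ccontr)
  fix y assume "y \<in> (\<Union>z\<in>topspace X - L0. X derived_set_of (\<lambda>g. proj_act g z) ` GG)" and y: "y \<notin> Lam"
  then obtain z where z: "z \<in> topspace X" and d: "y \<in> X derived_set_of (\<lambda>g. proj_act g z) ` GG" by blast
  have "y \<in> topspace X" by (rule subsetD[OF derived_set_of_subset_topspace d])
  then obtain f where f: "f \<in> Om0 m n" "y = pp n f" using y by (auto simp: Lam_def)
  show False
  proof (cases "z \<in> Lam")
    case True
    then have "(\<lambda>g. proj_act g z) ` GG \<subseteq> Lam" using act_Lam by blast
    then have "X derived_set_of (\<lambda>g. proj_act g z) ` GG \<subseteq> Lam"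
      using derived_set_of_mono[of "(\<lambda>g. proj_act g z) ` GG" Lam X]
        closedin_contains_derived_set[of X Lam] closedin_Lam by blast
    then show False using d y by blast
  next
    case False
    from finite_meeting_point[OF f(1), of z] z False obtain U where
      U: "openin X U" "y \<in> U" "finite {g \<in> GG. proj_act g z \<in> U}" using f by blast
    have "(\<lambda>g. proj_act g z) ` GG \<inter> U \<subseteq> (\<lambda>g. proj_act g z) ` {g \<in> GG. proj_act g z \<in> U}" by blast
    then have "finite ((\<lambda>g. proj_act g z) ` GG \<inter> U)" using U(3) by (meson finite_imageI finite_subset)
    then show False using proj_derived_set_infinite[OF d U(1,2)] by blast
  qed
qed

text \<open>The compact sets in the definition of L_2 avoid L_1. Through this lemma they avoid the
  real null points, which is what \<open>finite_meeting\<close> asks of them.\<close>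

lemma nullray_in_L1:
  assumes s: "s \<in> nullray m"
  shows "pp n (embed_real m n s) \<in> L1"
proof -
  from nullray_limit[OF s] obtain x where x: "lp m x x < 0" "x m > 0"
    and lim: "pp m s \<in> proj_space m derived_set_of ((\<lambda>A. pp m (mv m A x)) ` \<Gamma>)" .
  let ?z = "pp n (embed_real m n x)"
  have xz: "embed_real m n x \<in> Om0 m n" by (rule embed_real_in_Om0[OF mn x])
  then have znz: "embed_real m n x \<in> nz n" using Om0_subset_nz[OF m1 mn] by blast
  have "?z \<notin> Lam" using xz by (auto simp: Lam_def)
  then have z: "?z \<in> topspace X - L0" using L0_subset_Lam znz by blast
  have "pp n (embed_real m n s) \<in> X derived_set_of (\<lambda>g. proj_act g ?z) ` GG"
    unfolding in_derived_set_of
  proof (intro conjI allI impI)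
    show "pp n (embed_real m n s) \<in> topspace X" using embed_real_nz[OF s mn] by blast
    fix T assume T: "pp n (embed_real m n s) \<in> T \<and> openin X T"
    define P where "P = {y. embed_real m n y \<in> {f \<in> nz n. pp n f \<in> T}}"
    have "open {f \<in> nz n. pp n f \<in> T}" using T openin_proj_iff by blast
    moreover have "continuous_on UNIV (embed_real m n)"
    proof (rule continuous_on_coordinatewise_then_product)
      fix i
      show "continuous_on UNIV (\<lambda>x. embed_real m n x i)"
        by (cases "i < m"; cases "i = n")
          (auto simp: embed_real_def intro!: continuous_on_of_real continuous_on_component)
    qed
    ultimately have "open (embed_real m n -` {f \<in> nz n. pp n f \<in> T})" by (rule open_vimage)
    then have "open P" unfolding P_def vimage_def .
    then have "openin (proj_space m) (pp m ` (P \<inter> nz m))" by (rule openin_pp_image)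
    moreover have "s \<in> P \<inter> nz m"
      using T embed_real_nz[OF s mn] nullrayD(1)[OF s] by (auto simp: P_def nz_def)
    ultimately have "infinite ((\<lambda>A. pp m (mv m A x)) ` \<Gamma> \<inter> pp m ` (P \<inter> nz m))"
      by (intro proj_derived_set_infinite[OF lim]) auto
    \<comment> \<open>Accumulation asks for an orbit point other than the limit; an infinite set
      still contains one.\<close>
    then have "\<not> (\<lambda>A. pp m (mv m A x)) ` \<Gamma> \<inter> pp m ` (P \<inter> nz m) \<subseteq> {pp m s}"
      using finite_subset by blast
    then obtain A where A: "A \<in> \<Gamma>" "pp m (mv m A x) \<noteq> pp m s" "pp m (mv m A x) \<in> pp m ` (P \<inter> nz m)"
      by blast
    then obtain y where y: "y \<in> P" "y \<in> nz m" "pp m (mv m A x) = pp m y" by blast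
    have pos: "mv m A x m > 0" using mv_time_pos[OF G_SO[OF A(1)]] x by simp
    then have Axnz: "mv m A x \<in> nz m" by (auto simp: nz_def)
    then obtain c where c: "c \<noteq> 0" "\<forall>i\<le>m. mv m A x i = c * y i" using y pp_eq_iff by blast
    have Axn: "embed_real m n (mv m A x) \<in> nz n" using pos by (auto simp: nz_def embed_real_def intro!: exI[of _ n]) (use mn in auto)
    have "pp n (embed_real m n (mv m A x)) = pp n (embed_real m n y)"
    proof -
      have "embed_real m n y \<in> nz n" using y by (simp add: P_def)
      moreover have "\<forall>i\<le>n. embed_real m n (mv m A x) i = of_real c * embed_real m n y i" using c by (auto simp: embed_real_def)
      ultimately show ?thesis using pp_eq_iff[OF Axn] c by (metis of_real_eq_0_iff)
    qed
    then have "pp n (embed_real m n (mv m A x)) \<in> T" using y by (simp add: P_def)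
    moreover have "pp n (embed_real m n (mv m A x)) \<noteq> pp n (embed_real m n s)"
    proof
      assume "pp n (embed_real m n (mv m A x)) = pp n (embed_real m n s)"
      then obtain c where c: "\<forall>i\<le>n. embed_real m n (mv m A x) i = c * embed_real m n s i"
        using pp_eq_iff[OF Axn embed_real_nz[OF s mn]] by blast
      have "c = of_real (mv m A x m)" using c nullrayD(1)[OF s] mn by (auto simp: embed_real_def dest!: spec[of _ n])
      then have "complex_of_real (mv m A x i) = of_real (mv m A x m * s i)" if "i < m" for i
        using c that mn by (auto simp: embed_real_def dest!: spec[of _ i])
      then have "mv m A x i = mv m A x m * s i" if "i < m" for i
        using that by (simp only: of_real_eq_iff)
      then have all: "\<forall>i\<le>m. mv m A x i = mv m A x m * s i"
        using nullrayD(1)[OF s] by (metis le_neq_implies_less mult.right_neutral)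
      have "s \<in> nz m" using nullrayD(1)[OF s] by (auto simp: nz_def)
      moreover have "mv m A x m \<noteq> 0" using pos by simp
      ultimately have "pp m (mv m A x) = pp m s" using pp_eq_iff[OF Axnz] all by blast
      then show False using A by simp
    qed
    moreover have "pp n (embed_real m n (mv m A x)) \<in> (\<lambda>g. proj_act g ?z) ` GG"
      using A act_pp[OF A(1), of "embed_real m n x"] cact_embed_real[OF mn] by (metis imageI image_eqI)
    ultimately show "\<exists>y. y \<noteq> pp n (embed_real m n s) \<and> y \<in> (\<lambda>g. proj_act g ?z) ` GG \<and> y \<in> T" by blast
  qed
  then have "pp n (embed_real m n s) \<in> (\<Union>z\<in>topspace X - L0. X derived_set_of (\<lambda>g. proj_act g z) ` GG)"
    using z by blast
  moreover have "(\<Union>z\<in>topspace X - L0. X derived_set_of (\<lambda>g. proj_act g z) ` GG) \<subseteq> L1"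
    unfolding kulkarni_L1_def
    by (intro closure_of_subset UN_least derived_set_of_subset_topspace)
  ultimately show ?thesis by blast
qed

lemma L2_subset_Lam: "L2 \<subseteq> Lam"
  unfolding kulkarni_L2_def
proof (rule closure_of_minimal[OF _ closedin_Lam], rule subsetI, rule ccontr)
  fix y assume "y \<in> (\<Union>K\<in>{K. compactin X K \<and> K \<subseteq> topspace X - (L0 \<union> L1)}. cluster_points X GG (\<lambda>g. proj_act g ` K))"
    and y: "y \<notin> Lam"
  then obtain K where K: "compactin X K" "K \<subseteq> topspace X - (L0 \<union> L1)"
    and c: "y \<in> cluster_points X GG (\<lambda>g. proj_act g ` K)" by blast
  have "y \<in> topspace X" using c by (simp add: cluster_points_def)
  then obtain f where f: "f \<in> Om0 m n" "y = pp n f" using y by (auto simp: Lam_def)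
  have "pp n (embed_real m n s) \<notin> K" if "s \<in> nullray m" for s using K nullray_in_L1[OF that] by blast
  from finite_meeting[OF f(1) K(1) this] obtain U where
    "openin X U" "y \<in> U" "finite {g \<in> GG. U \<inter> proj_act g ` K \<noteq> {}}" using f by blast
  then show False using c by (auto simp: cluster_points_def)
qed

lemma limit_set_subset_Lam: "kulkarni_limit_set X GG proj_act \<subseteq> Lam"
  unfolding kulkarni_limit_set_def using L0_subset_Lam L1_subset_Lam L2_subset_Lam by blast

lemma Om0_subset_region: "pp n ` Om0 m n \<subseteq> kulkarni_region X GG proj_act"
  unfolding kulkarni_region_def
  using limit_set_subset_Lam openin_subset[OF openin_Om0] unfolding Lam_def by blast

end

section \<open>Points orthogonal to two null rays\<close>

lemma closedin_proj_eventually: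
  fixes F :: "nat \<Rightarrow> nat \<Rightarrow> 'a::real_normed_field"
  assumes "closedin (proj_space n) C" "F \<longlonglongrightarrow> f" "f \<in> nz n" "\<forall>\<^sub>F k in sequentially. pp n (F k) \<in> C"
  shows "pp n f \<in> C"
proof (rule ccontr)
  assume "pp n f \<notin> C"
  then have "openin (proj_space n) (topspace (proj_space n) - C)" "pp n f \<in> topspace (proj_space n) - C"
    using assms by auto
  from limitinD[OF limitin_proj_space[OF assms(2,3)] this] assms(4)
  have "\<forall>\<^sub>F k in sequentially. False" by eventually_elim blast
  then show False by simp
qed

lemma tendsto_of_less_inverse:
  fixes x :: "nat \<Rightarrow> real"
  assumes "\<And>k. \<bar>x k - l\<bar> < inverse (real (Suc k))"
  shows "x \<longlonglongrightarrow> l"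
proof -
  have "(\<lambda>k. x k - l) \<longlonglongrightarrow> 0"
  proof (rule tendsto_rabs_zero_cancel, rule tendsto_sandwich[OF _ _ tendsto_const LIMSEQ_inverse_real_of_nat])
    show "\<forall>\<^sub>F k in sequentially. \<bar>x k - l\<bar> \<le> inverse (real (Suc k))"
      using assms less_imp_le by (intro always_eventually allI) blast
  qed auto
  then show ?thesis by (simp add: LIM_zero_iff)
qed

lemma Re_pairing: "Re (pairing m n s f) = lp m s (\<lambda>i. Re (lor m n f i))"
  and Im_pairing: "Im (pairing m n s f) = lp m s (\<lambda>i. Im (lor m n f i))"
  by (simp_all add: pairing_def lp_def)

text \<open>Orthogonality to both rays makes the time coordinate of \<open>v\<close> its scalar
  product with the midpoint of the rays, which has squared length 1 + \<open>lp m e e' / 2\<close>,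
  less than 1 for distinct rays. Cauchy-Schwarz turns this into definiteness.\<close>

lemma lp_pos_on_perp:
  assumes e: "e \<in> nullray m" and e': "e' \<in> nullray m" and v: "lp m e v = 0" "lp m e' v = 0"
  shows "- lp m e e' / 2 * (\<Sum>i<m. (v i)\<^sup>2) \<le> lp m v v" "(v m)\<^sup>2 \<le> (\<Sum>i<m. (v i)\<^sup>2)"
proof -
  let ?S = "\<Sum>i<m. (v i)\<^sup>2" and ?c = "\<lambda>i. (e i + e' i) / 2"
  have "v m = (\<Sum>i<m. e i * v i)" "v m = (\<Sum>i<m. e' i * v i)"
    using v nullrayD(1)[OF e] nullrayD(1)[OF e'] by (simp_all add: lp_def)
  then have "v m = ((\<Sum>i<m. e i * v i) + (\<Sum>i<m. e' i * v i)) / 2" by simp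
  also have "\<dots> = (\<Sum>i<m. ?c i * v i)"
    by (simp add: sum_divide_distrib sum.distrib[symmetric] algebra_simps add_divide_distrib)
  finally have vm: "(v m)\<^sup>2 \<le> (\<Sum>i<m. (?c i)\<^sup>2) * ?S" using Cauchy_Schwarz_ineq_sum by metis
  have "(\<Sum>i<m. (?c i)\<^sup>2) = (\<Sum>i<m. ((e i)\<^sup>2 + (e' i)\<^sup>2 + 2 * (e i * e' i)) / 4)"
    by (rule sum.cong) (simp_all add: power2_eq_square field_simps)
  also have "\<dots> = ((\<Sum>i<m. (e i)\<^sup>2) + (\<Sum>i<m. (e' i)\<^sup>2) + 2 * (\<Sum>i<m. e i * e' i)) / 4"
    by (simp add: sum.distrib sum_distrib_left flip: sum_divide_distrib)
  also have "\<dots> = 1 + lp m e e' / 2"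
    using nullrayD[OF e] nullrayD[OF e'] by (simp add: lp_def field_simps)
  finally have c: "(\<Sum>i<m. (?c i)\<^sup>2) = 1 + lp m e e' / 2" .
  have S0: "?S \<ge> 0" by (simp add: sum_nonneg)
  show "- lp m e e' / 2 * ?S \<le> lp m v v"
    using vm unfolding c lp_self_eq by (simp add: algebra_simps)
  have "(1 + lp m e e' / 2) * ?S \<le> 1 * ?S"
    using nullray_lp_le[OF e e'] S0 by (intro mult_right_mono) auto
  then show "(v m)\<^sup>2 \<le> ?S" using vm unfolding c by simp
qed

context lorentz_lattice
begin

lemma mv_pow_add:
  assumes "A \<in> \<Gamma>"
  shows "mv m (A ^\<^sub>m (a + b)) x = mv m (A ^\<^sub>m a) (mv m (A ^\<^sub>m b) x)"
proof (induction b arbitrary: x)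
  case 0
  have "mv m (A ^\<^sub>m 0) x i = x i" if "i \<le> m" for i
    using mv_one[OF that, of x] G_mat[OF assms] by simp
  then show ?case using mv_cong[of m "mv m (A ^\<^sub>m 0) x" x] by (simp del: pow_mat.simps)
next
  case (Suc b)
  show ?case unfolding add_Suc_right mv_pow_Suc[OF assms] by (rule Suc.IH)
qed

lemma pow_perp:
  assumes A: "A \<in> \<Gamma>" and e: "e \<in> nullray m" "mv m A e = (\<lambda>i. \<kappa> * e i)" and v: "lp m e v = 0"
  shows "lp m e (mv m (A ^\<^sub>m k) v) = 0"
proof -
  have "lp m (mv m (A ^\<^sub>m k) e) (mv m (A ^\<^sub>m k) v) = 0" using v by (simp add: lp_mv[OF G_SO[OF G_pow[OF A]]])
  then show ?thesis
    unfolding mv_pow_eigen[OF A e] lp_linear using mv_adj_eigen(1)[OF G_SO[OF A] e] by simp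
qed

text \<open>On the orthogonal complement of the two fixed rays a loxodromic element acts by isometries of
  a definite form, hence with recurrent powers.\<close>

lemma recurrent_powers:
  assumes lox: "lox A e e'" and ne: "e \<noteq> e'"
    and v: "lp m e v = 0" "lp m e' v = 0" and w: "lp m e w = 0" "lp m e' w = 0"
  shows "\<exists>\<phi>. (\<forall>k. k \<le> \<phi> k) \<and> (\<forall>i\<le>m. (\<lambda>k. mv m (A ^\<^sub>m \<phi> k) v i) \<longlonglongrightarrow> v i)
    \<and> (\<forall>i\<le>m. (\<lambda>k. mv m (A ^\<^sub>m \<phi> k) w i) \<longlonglongrightarrow> w i)"
proof -
  from lox obtain \<kappa> \<kappa>' where A: "A \<in> \<Gamma>" and e: "e \<in> nullray m" "mv m A e = (\<lambda>i. \<kappa> * e i)"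
    and e': "e' \<in> nullray m" "mv m (adj m A) e' = (\<lambda>i. \<kappa>' * e' i)" unfolding lox_def by blast
  have e'A: "mv m A e' = (\<lambda>i. 1 / \<kappa>' * e' i)"
    using mv_adj_eigen(2)[OF G_SO[OF G_adj[OF A]] e'] adj_adj[OF G_mat[OF A]] by simp
  define c where "c = - lp m e e' / 2"
  have c: "c > 0" using nullray_lp_le[OF e(1) e'(1)] nullray_lp_eq_0[OF e(1) e'(1)] ne by (auto simp: c_def)
  have comp: "\<bar>u i\<bar> \<le> sqrt (lp m u u / c)" if u: "lp m e u = 0" "lp m e' u = 0" and i: "i \<le> m" for u i
  proof -
    have "(u i)\<^sup>2 \<le> (\<Sum>i<m. (u i)\<^sup>2)"
    proof (cases "i = m")
      case True
      then show ?thesis using lp_pos_on_perp(2)[OF e(1) e'(1) u] by simp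
    next
      case False
      then show ?thesis using i by (intro member_le_sum) auto
    qed
    also have "\<dots> \<le> lp m u u / c"
      using lp_pos_on_perp(1)[OF e(1) e'(1) u] c unfolding c_def[symmetric] by (simp add: field_simps)
    finally have "\<bar>u i\<bar> = sqrt ((u i)\<^sup>2) \<and> (u i)\<^sup>2 \<le> lp m u u / c" by simp
    then show ?thesis using real_sqrt_le_mono by metis
  qed
  \<comment> \<open>Packs both orbits into one sequence, that of \<open>w\<close> in positions m + 1
    to 2 m + 1, so that one subsequence serves both.\<close>
  define Y where "Y = (\<lambda>k j. if j \<le> m then mv m (A ^\<^sub>m k) v j else if j \<le> 2 * m + 1 then mv m (A ^\<^sub>m k) w (j - (m + 1)) else 0)"
  have perp: "lp m e (mv m (A ^\<^sub>m k) u) = 0" "lp m e' (mv m (A ^\<^sub>m k) u) = 0"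
    if "lp m e u = 0" "lp m e' u = 0" for k u
    using pow_perp[OF A e] pow_perp[OF A e'(1) e'A] that by blast+
  have "\<bar>mv m (A ^\<^sub>m k) u j\<bar> \<le> sqrt (lp m u u / c)" if "lp m e u = 0" "lp m e' u = 0" "j \<le> m" for k u j
    using comp[OF perp[OF that(1,2)] that(3), of k] by (simp add: lp_mv[OF G_SO[OF G_pow[OF A]]])
  then have bnd: "\<bar>Y k j\<bar> \<le> max (sqrt (lp m v v / c)) (max (sqrt (lp m w w / c)) 0)" for k j
    using v w unfolding Y_def by (auto simp: le_max_iff_disj)
  obtain r b where r: "strict_mono r" "\<And>j. (\<lambda>k. Y (r k) j) \<longlonglongrightarrow> b j"
    using bounded_fun_subseq[of Y "\<lambda>_. max (sqrt (lp m v v / c)) (max (sqrt (lp m w w / c)) 0)"] bnd by blast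
  have rec: "\<exists>k\<ge>N. \<forall>i\<le>m. \<bar>mv m (A ^\<^sub>m k) v i - v i\<bar> < \<epsilon> \<and> \<bar>mv m (A ^\<^sub>m k) w i - w i\<bar> < \<epsilon>" if \<epsilon>: "\<epsilon> > 0" for \<epsilon> N
  proof -
    \<comment> \<open>Chosen so that \<open>(m + 1) * \<delta>\<^sup>2\<close> is half of
      \<open>\<epsilon>\<^sup>2 * c\<close>, the size that \<open>comp\<close> has to stay
      below.\<close>
    define \<delta> where "\<delta> = \<epsilon> * sqrt (c / (2 * (real m + 1)))"
    have \<delta>: "\<delta> > 0" using \<epsilon> c by (simp add: \<delta>_def)
    have "\<forall>\<^sub>F k in sequentially. \<forall>j\<in>{..2 * m + 1}. \<bar>Y (r k) j - b j\<bar> < \<delta> / 2"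
      using tendstoD[OF r(2), of "\<delta> / 2"] \<delta> by (intro eventually_ball_finite) (auto simp: dist_real_def)
    then obtain K where K: "\<And>k j. k \<ge> K \<Longrightarrow> j \<le> 2 * m + 1 \<Longrightarrow> \<bar>Y (r k) j - b j\<bar> < \<delta> / 2"
      unfolding eventually_sequentially by auto
    have rK: "r K + N \<le> r (K + N)"
    proof (induction N)
      case (Suc N)
      then show ?case using strict_monoD[OF r(1), of "K + N" "K + Suc N"] by simp
    qed simp
    \<comment> \<open>Two late terms of a convergent subsequence are close. Undoing the earlier
      power, which preserves the definite form, turns their difference of exponents into a return
      time of at least \<open>N\<close>.\<close>
    define k where "k = r (K + N) - r K"
    have k: "k \<ge> N" "r (K + N) = r K + k" using rK by (auto simp: k_def)
    have Yc: "\<bar>Y (r K + k) j - Y (r K) j\<bar> < \<delta>" if "j \<le> 2 * m + 1" for j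
      using K[of "K + N" j] K[of K j] that k(2) by (simp add: abs_if split: if_splits)
    have close: "\<bar>mv m (A ^\<^sub>m k) u i - u i\<bar> < \<epsilon>"
      if u: "lp m e u = 0" "lp m e' u = 0" and d: "\<And>i. i \<le> m \<Longrightarrow> \<bar>mv m (A ^\<^sub>m (r K + k)) u i - mv m (A ^\<^sub>m r K) u i\<bar> < \<delta>"
        and i: "i \<le> m" for u i
    proof -
      let ?x = "\<lambda>i. mv m (A ^\<^sub>m k) u i - u i"
      have x: "lp m e ?x = 0" "lp m e' ?x = 0" unfolding lp_linear using perp[OF u] u by simp_all
      let ?y = "mv m (A ^\<^sub>m r K) ?x"
      have y: "?y i = mv m (A ^\<^sub>m (r K + k)) u i - mv m (A ^\<^sub>m r K) u i" for i
        unfolding mv_pow_add[OF A] mv_diff by simp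
      have "lp m ?x ?x = lp m ?y ?y" by (simp add: lp_mv[OF G_SO[OF G_pow[OF A]]])
      also have "\<dots> \<le> (\<Sum>i<m. (?y i)\<^sup>2)" by (simp add: lp_self_eq)
      also have "\<dots> \<le> (\<Sum>i<m. \<delta>\<^sup>2)"
        using d y \<delta> by (intro sum_mono) (metis abs_le_square_iff abs_of_pos lessThan_iff less_imp_le)
      also have "\<dots> < (real m + 1) * \<delta>\<^sup>2" using \<delta> by simp
      finally have "lp m ?x ?x < (real m + 1) * \<delta>\<^sup>2" .
      also have "\<dots> = \<epsilon>\<^sup>2 * c / 2" using c by (simp add: \<delta>_def power_mult_distrib field_simps)
      also have "\<dots> < \<epsilon>\<^sup>2 * c" using c \<epsilon> by simp
      finally have "lp m ?x ?x / c < \<epsilon>\<^sup>2" using c by (simp add: field_simps)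
      then have "sqrt (lp m ?x ?x / c) < sqrt (\<epsilon>\<^sup>2)" by (simp only: real_sqrt_less_iff)
      then show ?thesis using comp[OF x i] \<epsilon> by simp
    qed
    have "\<bar>mv m (A ^\<^sub>m (r K + k)) v i - mv m (A ^\<^sub>m r K) v i\<bar> < \<delta>" if "i \<le> m" for i
      using Yc[of i] that by (simp add: Y_def)
    then have "\<bar>mv m (A ^\<^sub>m k) v i - v i\<bar> < \<epsilon>" if "i \<le> m" for i using close[OF v _ that] by blast
    moreover have "\<bar>mv m (A ^\<^sub>m (r K + k)) w i - mv m (A ^\<^sub>m r K) w i\<bar> < \<delta>" if "i \<le> m" for i
      using Yc[of "m + 1 + i"] that by (simp add: Y_def)
    then have "\<bar>mv m (A ^\<^sub>m k) w i - w i\<bar> < \<epsilon>" if "i \<le> m" for i using close[OF w _ that] by blast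
    ultimately show ?thesis using k by blast
  qed
  have "\<exists>k'\<ge>k. \<forall>i\<le>m. \<bar>mv m (A ^\<^sub>m k') v i - v i\<bar> < inverse (real (Suc k)) \<and> \<bar>mv m (A ^\<^sub>m k') w i - w i\<bar> < inverse (real (Suc k))" for k
    by (rule rec) simp
  then obtain \<phi> where \<phi>: "\<And>k. k \<le> \<phi> k"
    "\<And>k i. i \<le> m \<Longrightarrow> \<bar>mv m (A ^\<^sub>m \<phi> k) v i - v i\<bar> < inverse (real (Suc k))"
    "\<And>k i. i \<le> m \<Longrightarrow> \<bar>mv m (A ^\<^sub>m \<phi> k) w i - w i\<bar> < inverse (real (Suc k))"
    by metis
  have "(\<lambda>k. mv m (A ^\<^sub>m \<phi> k) v i) \<longlonglongrightarrow> v i" "(\<lambda>k. mv m (A ^\<^sub>m \<phi> k) w i) \<longlonglongrightarrow> w i" if "i \<le> m" for i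
    by (rule tendsto_of_less_inverse, rule \<phi>(2)[OF that], rule tendsto_of_less_inverse, rule \<phi>(3)[OF that])
  then show ?thesis using \<phi>(1) by blast
qed

end

context kulkarni_setup
begin

lemma cact_tendsto:
  assumes "\<And>i. i \<le> m \<Longrightarrow> (\<lambda>k. mv m (A k) (\<lambda>i. Re (lor m n f i)) i) \<longlonglongrightarrow> Re (lor m n g i)"
    and "\<And>i. i \<le> m \<Longrightarrow> (\<lambda>k. mv m (A k) (\<lambda>i. Im (lor m n f i)) i) \<longlonglongrightarrow> Im (lor m n g i)"
    and "\<And>i. \<not> (i < m \<or> i = n) \<Longrightarrow> f i = g i"
  shows "(\<lambda>k. cact m n (A k) f) \<longlonglongrightarrow> g"
  unfolding tendsto_fun_iff
proof
  fix i
  have ri: "Re (mv m (A k) u j) = mv m (A k) (\<lambda>i. Re (u i)) j" "Im (mv m (A k) u j) = mv m (A k) (\<lambda>i. Im (u i)) j" for k u j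
    by (simp_all add: mv_def)
  have "(\<lambda>k. mv m (A k) (lor m n f) j) \<longlonglongrightarrow> lor m n g j" if "j \<le> m" for j
    unfolding tendsto_complex_iff ri using assms(1,2)[OF that] by blast
  note lim = this
  consider "i < m" | "i = n" "\<not> i < m" | "\<not> i < m" "i \<noteq> n" by blast
  then show "(\<lambda>k. cact m n (A k) f i) \<longlonglongrightarrow> g i"
  proof cases
    case 1
    then show ?thesis using lim[of i] by (simp add: cact_def lor_def[of m n g])
  next
    case 2
    then show ?thesis using lim[of m] by (simp add: cact_def lor_def[of m n g])
  next
    case 3
    then show ?thesis using assms(3)[of i] by (simp add: cact_def)
  qed
qed

text \<open>Different powers scale \<open>e\<close> differently. Infinitely many exponents are thus
  infinitely many group elements, as counted in L_0 and L_2.\<close>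

lemma pow_iota_inj:
  assumes lox: "lox A e e'"
  shows "inj (\<lambda>k. iota m n (A ^\<^sub>m k))"
proof (rule injI)
  from lox obtain \<kappa> where A: "A \<in> \<Gamma>" and e: "e \<in> nullray m" "\<kappa> > 1" "mv m A e = (\<lambda>i. \<kappa> * e i)"
    unfolding lox_def by blast
  fix j k assume eq: "iota m n (A ^\<^sub>m j) = iota m n (A ^\<^sub>m k)"
  have "vec (n + 1) (cact m n (A ^\<^sub>m j) (embed_real m n e)) = vec (n + 1) (cact m n (A ^\<^sub>m k) (embed_real m n e))"
    using eq iota_mult_vec[OF G_mat[OF G_pow[OF A]] mn] by metis
  then have "embed_real m n (mv m (A ^\<^sub>m j) e) n = embed_real m n (mv m (A ^\<^sub>m k) e) n"
    unfolding cact_embed_real[OF mn] by (simp add: vec_eq_iff)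
  then have "\<kappa> ^ j = \<kappa> ^ k"
    using mn nullrayD(1)[OF e(1)]
    by (simp add: embed_real_def mv_pow_eigen[OF A e(1,3)] del: of_real_power)
  then show "j = k" using e(2) by simp
qed

text \<open>If the point is not in L_0, only finitely many powers fix it. The remaining recurrent
  powers give orbit points that differ from it and converge to it, so its orbit accumulates at the
  point itself.\<close>

lemma lox_perp_in_limit_set:
  assumes lox: "lox A e e'" and ne: "e \<noteq> e'" and f: "f \<in> nz n" "pairing m n e f = 0" "pairing m n e' f = 0"
  shows "pp n f \<in> L0 \<union> L1"
proof (rule ccontr)
  assume notin: "\<not> ?thesis"
  have A: "A \<in> \<Gamma>" using lox by (simp add: lox_def)
  let ?z = "pp n f"
  have ztop: "?z \<in> topspace X" using f by blast
  have "{x \<in> topspace X. infinite {g \<in> GG. proj_act g x = x}} \<subseteq> L0"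
    unfolding kulkarni_L0_def by (rule closure_of_subset) blast
  then have fin: "finite {g \<in> GG. proj_act g ?z = ?z}" using notin ztop by blast
  have "finite ((\<lambda>k. iota m n (A ^\<^sub>m k)) -` {g \<in> GG. proj_act g ?z = ?z})"
    by (rule finite_vimageI[OF fin pow_iota_inj[OF lox]])
  then obtain N where N: "\<And>k. proj_act (iota m n (A ^\<^sub>m k)) ?z = ?z \<Longrightarrow> k < N"
    using G_pow[OF A] unfolding finite_nat_set_iff_bounded by auto
  have v: "lp m e (\<lambda>i. Re (lor m n f i)) = 0" "lp m e' (\<lambda>i. Re (lor m n f i)) = 0"
    "lp m e (\<lambda>i. Im (lor m n f i)) = 0" "lp m e' (\<lambda>i. Im (lor m n f i)) = 0"
    using f Re_pairing Im_pairing by (metis zero_complex.simps)+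
  obtain \<phi> where \<phi>: "\<And>k. k \<le> \<phi> k"
    "\<And>i. i \<le> m \<Longrightarrow> (\<lambda>k. mv m (A ^\<^sub>m \<phi> k) (\<lambda>i. Re (lor m n f i)) i) \<longlonglongrightarrow> Re (lor m n f i)"
    "\<And>i. i \<le> m \<Longrightarrow> (\<lambda>k. mv m (A ^\<^sub>m \<phi> k) (\<lambda>i. Im (lor m n f i)) i) \<longlonglongrightarrow> Im (lor m n f i)"
    using recurrent_powers[OF lox ne v] by blast
  have lim: "(\<lambda>k. cact m n (A ^\<^sub>m \<phi> k) f) \<longlonglongrightarrow> f" by (rule cact_tendsto[OF \<phi>(2,3)]) auto
  have "?z \<in> X derived_set_of (\<lambda>g. proj_act g ?z) ` GG"
    unfolding in_derived_set_of
  proof (intro conjI allI impI)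
    fix T assume T: "?z \<in> T \<and> openin X T"
    then have "\<forall>\<^sub>F k in sequentially. pp n (cact m n (A ^\<^sub>m \<phi> k) f) \<in> T"
      using limitinD[OF limitin_proj_space[OF lim f(1)]] by blast
    then obtain k where k: "k \<ge> N" "pp n (cact m n (A ^\<^sub>m \<phi> k) f) \<in> T"
      unfolding eventually_sequentially by (meson nat_le_linear)
    have "proj_act (iota m n (A ^\<^sub>m \<phi> k)) ?z \<noteq> ?z" using N \<phi>(1)[of k] k by (meson leD le_trans)
    then show "\<exists>y. y \<noteq> ?z \<and> y \<in> (\<lambda>g. proj_act g ?z) ` GG \<and> y \<in> T"
      using k act_pp[OF G_pow[OF A]] G_pow[OF A] by (metis (no_types, lifting) imageI)
  qed (rule ztop)
  then have "?z \<in> (\<Union>z\<in>topspace X - L0. X derived_set_of (\<lambda>g. proj_act g z) ` GG)"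
    using notin ztop by blast
  moreover have "(\<Union>z\<in>topspace X - L0. X derived_set_of (\<lambda>g. proj_act g z) ` GG) \<subseteq> L1"
    unfolding kulkarni_L1_def
    by (intro closure_of_subset UN_least derived_set_of_subset_topspace)
  ultimately show False using notin by blast
qed

lemma lox_near_seq:
  assumes "lox_near p q"
  shows "\<exists>A e e'. (\<forall>k. lox (A k) (e k) (e' k)) \<and> (\<forall>i. (\<lambda>k. e k i) \<longlonglongrightarrow> p i) \<and> (\<forall>i. (\<lambda>k. e' k i) \<longlonglongrightarrow> q i)"
proof -
  have "\<exists>A e e'. lox A e e' \<and> (\<forall>i. \<bar>e i - p i\<bar> < inverse (real (Suc k)) \<and> \<bar>e' i - q i\<bar> < inverse (real (Suc k)))" for k
    using assms unfolding lox_near_def by (metis inverse_positive_iff_positive of_nat_0_less_iff zero_less_Suc)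
  then obtain A e e' where *: "\<And>k. lox (A k) (e k) (e' k)" "\<And>k i. \<bar>e k i - p i\<bar> < inverse (real (Suc k))"
    "\<And>k i. \<bar>e' k i - q i\<bar> < inverse (real (Suc k))" by metis
  have "(\<lambda>k. e k i) \<longlonglongrightarrow> p i" "(\<lambda>k. e' k i) \<longlonglongrightarrow> q i" for i
    by (rule tendsto_of_less_inverse, rule *(2), rule tendsto_of_less_inverse, rule *(3))
  then show ?thesis using *(1) by blast
qed

text \<open>Density provides loxodromic pairs near \<open>p\<close> and \<open>q\<close>. A small
  correction makes \<open>f\<close> orthogonal to such a pair, and the closed set L_0 \<union> L_1
  contains the limit.\<close>

lemma two_null_perp_in_limit_set:
  assumes f: "f \<in> nz n" and p: "p \<in> nullray m" and q: "q \<in> nullray m" and "p \<noteq> q"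
    and "pairing m n p f = 0" "pairing m n q f = 0"
  shows "pp n f \<in> L0 \<union> L1"
proof -
  obtain A e e' where lox: "\<And>k. lox (A k) (e k) (e' k)"
    and ep: "\<And>i. (\<lambda>k. e k i) \<longlonglongrightarrow> p i" and eq: "\<And>i. (\<lambda>k. e' k i) \<longlonglongrightarrow> q i"
    using lox_near_seq[OF lox_dense[OF p q \<open>p \<noteq> q\<close>]] by blast
  have en: "e k \<in> nullray m" "e' k \<in> nullray m" for k using lox[of k] by (simp_all add: lox_def)
  define D where "D = (\<lambda>k. lp m (e k) (e' k))"
  \<comment> \<open>As both rays are null, subtracting a multiple of one changes only the pairing
    with the other among these two, so the linear system for the correction is diagonal.\<close>
  define a where "a = (\<lambda>k. pairing m n (e' k) f / of_real (D k))"
  define b where "b = (\<lambda>k. pairing m n (e k) f / of_real (D k))"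
  define F where "F = (\<lambda>k i. f i - (a k * embed_real m n (e k) i + b k * embed_real m n (e' k) i))"
  have pq: "lp m p q \<noteq> 0" using nullray_lp_eq_0[OF p q] \<open>p \<noteq> q\<close> by blast
  have D: "D \<longlonglongrightarrow> lp m p q" unfolding D_def by (intro tendsto_intros ep eq)
  have prlim: "(\<lambda>k. pairing m n (e k) f) \<longlonglongrightarrow> 0" "(\<lambda>k. pairing m n (e' k) f) \<longlonglongrightarrow> 0"
  proof -
    have "(\<lambda>k. pairing m n (e k) f) \<longlonglongrightarrow> pairing m n p f" "(\<lambda>k. pairing m n (e' k) f) \<longlonglongrightarrow> pairing m n q f"
      unfolding pairing_def by (intro tendsto_lp tendsto_of_real ep eq tendsto_const)+
    then show "(\<lambda>k. pairing m n (e k) f) \<longlonglongrightarrow> 0" "(\<lambda>k. pairing m n (e' k) f) \<longlonglongrightarrow> 0" using assms(5,6) by simp_all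
  qed
  have a0: "a \<longlonglongrightarrow> 0" and b0: "b \<longlonglongrightarrow> 0"
    unfolding a_def b_def using tendsto_divide[OF prlim(2) tendsto_of_real[OF D]]
      tendsto_divide[OF prlim(1) tendsto_of_real[OF D]] pq by simp_all
  have emb: "(\<lambda>k. embed_real m n (x k) i) \<longlonglongrightarrow> embed_real m n y i" if "\<And>i. (\<lambda>k. x k i) \<longlonglongrightarrow> y i" for x y i
    unfolding embed_real_def using that by (cases "i < m"; cases "i = n") (auto intro: tendsto_of_real)
  have Flim: "F \<longlonglongrightarrow> f"
    unfolding tendsto_fun_iff
  proof
    fix i
    have "(\<lambda>k. F k i) \<longlonglongrightarrow> f i - (0 * embed_real m n p i + 0 * embed_real m n q i)"
      unfolding F_def by (intro tendsto_intros a0 b0 emb ep eq)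
    then show "(\<lambda>k. F k i) \<longlonglongrightarrow> f i" by simp
  qed
  have pF: "pairing m n s (F k) = pairing m n s f - (a k * of_real (lp m s (e k)) + b k * of_real (lp m s (e' k)))" for s k
  proof -
    have "lor m n (F k) = (\<lambda>i. lor m n f i - (a k * lor m n (embed_real m n (e k)) i + b k * lor m n (embed_real m n (e' k)) i))"
      by (auto simp: F_def lor_def)
    then have "pairing m n s (F k) = pairing m n s f - (a k * pairing m n s (embed_real m n (e k)) + b k * pairing m n s (embed_real m n (e' k)))"
      unfolding pairing_def by (simp add: lp_linear)
    then show ?thesis by (simp add: pairing_embed_real[OF mn])
  qed
  have "\<forall>\<^sub>F k in sequentially. F k \<in> nz n" using topological_tendstoD[OF Flim open_nz f] .
  moreover have "\<forall>\<^sub>F k in sequentially. D k \<noteq> 0" using tendsto_imp_eventually_ne[OF D pq] .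
  ultimately have "\<forall>\<^sub>F k in sequentially. pp n (F k) \<in> L0 \<union> L1"
  proof eventually_elim
    case (elim k)
    have "e k \<noteq> e' k" using elim(2) nullrayD(2)[OF en(1), of k] by (auto simp: D_def)
    moreover have "pairing m n (e k) (F k) = 0" "pairing m n (e' k) (F k) = 0"
      unfolding pF using elim(2) nullrayD(2)[OF en(1), of k] nullrayD(2)[OF en(2), of k] lp_commute[of m "e' k" "e k"]
      by (simp_all add: a_def b_def D_def)
    ultimately show ?case using lox_perp_in_limit_set[OF lox _ elim(1)] by blast
  qed
  then show ?thesis
    by (intro closedin_proj_eventually[OF _ Flim f]) (auto simp: kulkarni_L0_def kulkarni_L1_def)
qed

end

section \<open>The case of higher dimension\<close>

text \<open>Not invariant under scaling: a projective point counts as soon as one representative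
  qualifies. Testing real parts alone keeps the future half convex.\<close>

definition timelike :: "nat \<Rightarrow> nat \<Rightarrow> (nat \<Rightarrow> complex) set" where
  "timelike m n = {f. (\<Sum>i<m. (Re (f i))\<^sup>2) < (Re (f n))\<^sup>2}"

lemma connected_of_segments:
  fixes S :: "(nat \<Rightarrow> complex) set"
  assumes "\<And>f g t. f \<in> S \<Longrightarrow> g \<in> S \<Longrightarrow> 0 \<le> t \<Longrightarrow> t \<le> 1 \<Longrightarrow> (\<lambda>i. of_real (1 - t) * f i + of_real t * g i) \<in> S"
  shows "connected S"
proof (subst connected_iff_connected_component, intro ballI)
  fix f g assume fg: "f \<in> S" "g \<in> S"
  let ?h = "\<lambda>t i. complex_of_real (1 - t) * f i + of_real t * g i"
  have "continuous_on {0..1} ?h"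
    by (rule continuous_on_coordinatewise_then_product)
      (intro continuous_on_add continuous_on_mult continuous_on_of_real continuous_on_diff continuous_on_const continuous_on_id)
  from connected_continuous_image[OF this connected_Icc] have "connected (?h ` {0..1})" .
  moreover have "?h ` {0..1} \<subseteq> S" using assms[OF fg] by auto
  moreover have "f \<in> ?h ` {0..1}" "g \<in> ?h ` {0..1}"
    by (rule image_eqI[of _ _ 0], simp, simp, rule image_eqI[of _ _ 1], simp, simp)
  ultimately show "connected_component S f g" unfolding connected_component_def by blast
qed

lemma timelike_iff_lp: "m \<le> n \<Longrightarrow> f \<in> timelike m n \<longleftrightarrow> lp m (\<lambda>i. Re (lor m n f i)) (\<lambda>i. Re (lor m n f i)) < 0"
  by (simp add: timelike_def lp_self_eq) (simp add: lor_def)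

lemma timelike_time_nonzero: "f \<in> timelike m n \<Longrightarrow> Re (f n) \<noteq> 0"
  unfolding timelike_def using sum_nonneg[of "{..<m}" "\<lambda>i. (Re (f i))\<^sup>2"] by auto

lemma timelike_subset_Om0:
  assumes "m \<le> n"
  shows "timelike m n \<subseteq> Om0 m n"
proof
  fix f assume f: "f \<in> timelike m n"
  let ?x = "\<lambda>i. Re (lor m n f i)"
  have x: "lp m ?x ?x < 0" using f timelike_iff_lp[OF assms] by simp
  have xm: "?x m \<noteq> 0" using timelike_time_nonzero[OF f] by (simp add: lor_def)
  have "lp m s ?x \<noteq> 0" if s: "s \<in> nullray m" for s
  proof (cases "?x m > 0")
    case True
    then show ?thesis using lp_causal_neg[OF x _ True, of s] nullrayD[OF s] lp_commute[of m s ?x] by simp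
  next
    case False
    let ?y = "\<lambda>i. - 1 * ?x i"
    have "lp m ?y ?y = lp m ?x ?x" unfolding lp_linear by simp
    then have "lp m ?y s < 0" using lp_causal_neg[of m ?y s] x xm False nullrayD[OF s] by simp
    then show ?thesis unfolding lp_linear using lp_commute[of m s ?x] by simp
  qed
  then have "pairing m n s f \<noteq> 0" if "s \<in> nullray m" for s
    using that Re_pairing[of m n s f] by force
  then show "f \<in> Om0 m n" by (simp add: Om0_def)
qed

lemma open_timelike: "open (timelike m n)"
  unfolding timelike_def by (intro open_Collect_less continuous_intros continuous_on_component)

lemma connected_pp_timelike:
  assumes "1 \<le> m" "m \<le> n"
  shows "connectedin (proj_space n) (pp n ` timelike m n)"
proof -
  \<comment> \<open>Two future timelike vectors pair negatively, so the future half is convex; the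
    factor -1 identifies it with the past half projectively.\<close>
  define T where "T = {f \<in> timelike m n. 0 < Re (f n)}"
  have "connected T"
  proof (rule connected_of_segments)
    fix f g and t :: real assume fg: "f \<in> T" "g \<in> T" and t: "0 \<le> t" "t \<le> 1"
    let ?h = "\<lambda>i. of_real (1 - t) * f i + of_real t * g i"
    let ?x = "\<lambda>f i. Re (lor m n f i)"
    have x: "lp m (?x f) (?x f) < 0" "lp m (?x g) (?x g) < 0" "?x f m > 0" "?x g m > 0"
      using fg timelike_iff_lp[OF assms(2)] by (auto simp: T_def lor_def)
    have "?x ?h = (\<lambda>i. (1 - t) * ?x f i + t * ?x g i)" by (auto simp: lor_def)
    then have "lp m (?x ?h) (?x ?h) = (1 - t)\<^sup>2 * lp m (?x f) (?x f) + t\<^sup>2 * lp m (?x g) (?x g)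
        + 2 * ((1 - t) * t) * lp m (?x f) (?x g)"
      using lp_commute[of m "?x g" "?x f"] by (simp only: lp_linear) (simp add: power2_eq_square algebra_simps)
    also have "\<dots> < 0"
    proof -
      have "lp m (?x f) (?x g) < 0" using lp_causal_neg[of m "?x f" "?x g"] x by simp
      then have 1: "2 * ((1 - t) * t) * lp m (?x f) (?x g) \<le> 0" using t by (intro mult_nonneg_nonpos) auto
      have 2: "t\<^sup>2 * lp m (?x g) (?x g) \<le> 0" "(1 - t)\<^sup>2 * lp m (?x f) (?x f) \<le> 0"
        using x by (auto intro!: mult_nonneg_nonpos)
      have "t\<^sup>2 * lp m (?x g) (?x g) < 0 \<or> (1 - t)\<^sup>2 * lp m (?x f) (?x f) < 0"
      proof (cases "t = 0")
        case False
        then show ?thesis using x by (intro disjI1 mult_pos_neg) auto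
      qed (use x in simp)
      then show ?thesis using 1 2 by linarith
    qed
    finally have "?h \<in> timelike m n" using timelike_iff_lp[OF assms(2)] by simp
    moreover have "0 < Re (?h n)"
    proof -
      have "(1 - t) * Re (f n) + t * Re (g n) > 0"
      proof (cases "t = 0")
        case False
        then show ?thesis using t fg by (intro add_nonneg_pos mult_nonneg_nonneg mult_pos_pos) (auto simp: T_def)
      qed (use fg in \<open>simp add: T_def\<close>)
      then show ?thesis by simp
    qed
    ultimately show "?h \<in> T" by (simp add: T_def)
  qed
  moreover have T: "T \<subseteq> nz n" using Om0_subset_nz[OF assms] timelike_subset_Om0[OF assms(2)] by (auto simp: T_def)
  ultimately have "connectedin (proj_space n) (pp n ` T)" by (rule connectedin_pp)
  moreover have "pp n ` timelike m n = pp n ` T"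
  proof (intro equalityI image_subsetI)
    fix f assume f: "f \<in> timelike m n"
    show "pp n f \<in> pp n ` T"
    proof (cases "0 < Re (f n)")
      case False
      let ?g = "\<lambda>i. - 1 * f i"
      have "?g \<in> T" using f False timelike_time_nonzero[OF f] by (simp add: T_def timelike_def)
      moreover have "pp n ?g = pp n f"
        using f Om0_subset_nz[OF assms] timelike_subset_Om0[OF assms(2)] by (intro pp_scale) auto
      ultimately show ?thesis by (metis imageI)
    qed (use f in \<open>auto simp: T_def\<close>)
  qed (auto simp: T_def)
  ultimately show ?thesis by simp
qed

text \<open>Equality in Cauchy-Schwarz makes real and imaginary parts proportional. Multiplication
  by P - \<i> R gives the imaginary parts P b - R a, whose squares sum to 0.\<close>

lemma gram_degenerate:
  fixes a b :: "nat \<Rightarrow> real"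
  assumes "(\<Sum>i<m. (a i)\<^sup>2) * (\<Sum>i<m. (b i)\<^sup>2) = (\<Sum>i<m. a i * b i)\<^sup>2"
  shows "\<exists>c. c \<noteq> 0 \<and> (\<forall>i<m. Im (c * Complex (a i) (b i)) = 0)"
proof -
  define P Q R where "P = (\<Sum>i<m. (a i)\<^sup>2)" and "Q = (\<Sum>i<m. (b i)\<^sup>2)" and "R = (\<Sum>i<m. a i * b i)"
  show ?thesis
  proof (cases "P = 0")
    case True
    then have "\<forall>i\<in>{..<m}. (a i)\<^sup>2 = 0" unfolding P_def by (subst (asm) sum_nonneg_eq_0_iff) auto
    then show ?thesis by (intro exI[of _ \<i>]) auto
  next
    case False
    have "(\<Sum>i<m. (P * b i - R * a i)\<^sup>2) = (\<Sum>i<m. P\<^sup>2 * (b i)\<^sup>2 - 2 * P * R * (a i * b i) + R\<^sup>2 * (a i)\<^sup>2)"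
      by (rule sum.cong) (simp_all add: power2_eq_square algebra_simps)
    also have "\<dots> = P\<^sup>2 * Q - 2 * P * R * R + R\<^sup>2 * P"
      unfolding sum.distrib sum_subtractf sum_distrib_left[symmetric] P_def[symmetric] Q_def[symmetric] R_def[symmetric] ..
    also have "\<dots> = P * (P * Q - R\<^sup>2)" by (simp add: power2_eq_square algebra_simps)
    also have "\<dots> = 0" using assms by (simp add: P_def Q_def R_def)
    finally have "\<forall>i\<in>{..<m}. (P * b i - R * a i)\<^sup>2 = 0" by (subst (asm) sum_nonneg_eq_0_iff) auto
    then show ?thesis using False by (intro exI[of _ "Complex P (- R)"]) (auto simp: complex_eq_iff)
  qed
qed

lemma gram_solve:
  fixes a b :: "nat \<Rightarrow> real"
  assumes "(\<Sum>i<m. (a i)\<^sup>2) * (\<Sum>i<m. (b i)\<^sup>2) \<noteq> (\<Sum>i<m. a i * b i)\<^sup>2"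
  shows "\<exists>\<alpha> \<beta>. (\<Sum>i<m. (\<alpha> * a i + \<beta> * b i) * a i) = x \<and> (\<Sum>i<m. (\<alpha> * a i + \<beta> * b i) * b i) = y"
proof -
  define P Q R where "P = (\<Sum>i<m. (a i)\<^sup>2)" and "Q = (\<Sum>i<m. (b i)\<^sup>2)" and "R = (\<Sum>i<m. a i * b i)"
  define D where "D = P * Q - R\<^sup>2"
  have D: "D \<noteq> 0" using assms by (simp add: D_def P_def Q_def R_def)
  have s: "(\<Sum>i<m. (\<alpha> * a i + \<beta> * b i) * a i) = \<alpha> * P + \<beta> * R" "(\<Sum>i<m. (\<alpha> * a i + \<beta> * b i) * b i) = \<alpha> * R + \<beta> * Q" for \<alpha> \<beta>
    unfolding P_def Q_def R_def sum_distrib_left sum.distrib[symmetric]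
    by (auto intro!: sum.cong simp: power2_eq_square algebra_simps)
  show ?thesis
    unfolding s
  proof (intro exI conjI)
    have "(x * Q - y * R) * P + (y * P - x * R) * R = x * D" by (simp add: D_def power2_eq_square algebra_simps)
    then show "(x * Q - y * R) / D * P + (y * P - x * R) / D * R = x"
      using D by (simp add: field_simps)
    have "(x * Q - y * R) * R + (y * P - x * R) * Q = y * D" by (simp add: D_def power2_eq_square algebra_simps)
    then show "(x * Q - y * R) / D * R + (y * P - x * R) / D * Q = y"
      using D by (simp add: field_simps)
  qed
qed

text \<open>Stereographic projection from \<open>s\<close>: the null rays other than \<open>s\<close> are spanned by
  \<open>(- s + t + |t|\<^sup>2/4 s, 1 + |t|\<^sup>2/4)\<close> with \<open>t\<close> orthogonal to \<open>s\<close>. Orthogonality to \<open>f\<close> is a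
  pair of linear equations for \<open>t\<close>, solvable unless real and imaginary part of \<open>f\<close> are dependent
  modulo \<open>s\<close>; in that case \<open>f\<close> is a limit of timelike points.\<close>

lemma null_perp_cases:
  assumes mn: "m \<le> n" and s: "s \<in> nullray m" and f: "pairing m n s f = 0"
  shows "(\<exists>q\<in>nullray m. q \<noteq> s \<and> pairing m n q f = 0) \<or>
    (\<exists>c F. c \<noteq> 0 \<and> F \<longlonglongrightarrow> (\<lambda>i. c * f i) \<and> (\<forall>k. F k \<in> timelike m n))"
proof -
  \<comment> \<open>Subtracting the multiple of \<open>s\<close> with the same last coordinate
    leaves the part of \<open>f\<close> tangent to the sphere at \<open>s\<close>.\<close>
  define g where "g = (\<lambda>i. f i - f n * of_real (s i))"
  define a b where "a = (\<lambda>i. Re (g i))" and "b = (\<lambda>i. Im (g i))"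
  have sm: "s m = 1" "(\<Sum>i<m. (s i)\<^sup>2) = 1" using nullrayD[OF s] by auto
  have "(\<Sum>i<m. of_real (s i) * g i) = (\<Sum>i<m. of_real (s i) * f i - f n * of_real ((s i)\<^sup>2))"
    by (rule sum.cong) (auto simp: g_def algebra_simps power2_eq_square)
  also have "\<dots> = (\<Sum>i<m. of_real (s i) * f i) - f n * of_real (\<Sum>i<m. (s i)\<^sup>2)"
    by (simp add: sum_subtractf sum_distrib_left)
  also have "\<dots> = pairing m n s f" using sm by (simp add: pairing_def lp_def lor_def)
  finally have sg: "(\<Sum>i<m. of_real (s i) * g i) = 0" using f by simp
  then have sa: "(\<Sum>i<m. s i * a i) = 0" and sb: "(\<Sum>i<m. s i * b i) = 0"
    unfolding a_def b_def by (simp_all add: complex_eq_iff)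
  show ?thesis
  proof (cases "(\<Sum>i<m. (a i)\<^sup>2) * (\<Sum>i<m. (b i)\<^sup>2) = (\<Sum>i<m. a i * b i)\<^sup>2")
    case False
    obtain \<alpha> \<beta> where ab: "(\<Sum>i<m. (\<alpha> * a i + \<beta> * b i) * a i) = 2 * Re (f n)"
      "(\<Sum>i<m. (\<alpha> * a i + \<beta> * b i) * b i) = 2 * Im (f n)"
      using gram_solve[OF False] by blast
    define t where "t = (\<lambda>i. \<alpha> * a i + \<beta> * b i)"
    define \<tau> where "\<tau> = (\<Sum>i<m. (t i)\<^sup>2) / 4"
    have \<tau>: "\<tau> \<ge> 0" by (simp add: \<tau>_def sum_nonneg)
    define q where "q = (\<lambda>i. if i < m then t i + (\<tau> - 1) * s i else if i = m then 1 + \<tau> else 0)"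
    have st: "(\<Sum>i<m. s i * t i) = 0"
    proof -
      have "(\<Sum>i<m. s i * t i) = \<alpha> * (\<Sum>i<m. s i * a i) + \<beta> * (\<Sum>i<m. s i * b i)"
        unfolding t_def sum_distrib_left sum.distrib[symmetric] by (rule sum.cong) (auto simp: algebra_simps)
      then show ?thesis using sa sb by simp
    qed
    have "(\<Sum>i<m. (q i)\<^sup>2) = (\<Sum>i<m. (t i)\<^sup>2 + 2 * (\<tau> - 1) * (s i * t i) + (\<tau> - 1)\<^sup>2 * (s i)\<^sup>2)"
      by (rule sum.cong) (auto simp: q_def power2_eq_square algebra_simps)
    also have "\<dots> = 4 * \<tau> + 2 * (\<tau> - 1) * (\<Sum>i<m. s i * t i) + (\<tau> - 1)\<^sup>2 * (\<Sum>i<m. (s i)\<^sup>2)"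
      unfolding sum.distrib sum_distrib_left[symmetric] by (simp add: \<tau>_def)
    also have "\<dots> = (q m)\<^sup>2" unfolding st sm by (simp add: q_def power2_eq_square algebra_simps)
    finally have qq: "lp m q q = 0" by (simp add: lp_self_eq)
    have qm: "q m > 0" using \<tau> by (simp add: q_def)
    define r where "r = (\<lambda>i. if i \<le> m then q i / q m else 0)"
    have r: "r \<in> nullray m" unfolding r_def by (rule normalize_nullray[OF qq]) (use qm in simp)
    have "(\<Sum>i<m. s i * q i) = (\<Sum>i<m. s i * t i + (\<tau> - 1) * (s i)\<^sup>2)"
      by (rule sum.cong) (auto simp: q_def power2_eq_square algebra_simps)
    also have "\<dots> = (\<Sum>i<m. s i * t i) + (\<tau> - 1) * (\<Sum>i<m. (s i)\<^sup>2)"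
      unfolding sum.distrib sum_distrib_left[symmetric] ..
    finally have "lp m s q = (\<Sum>i<m. s i * t i) + (\<tau> - 1) * (\<Sum>i<m. (s i)\<^sup>2) - s m * q m"
      by (simp add: lp_def)
    moreover have "q m = 1 + \<tau>" by (simp add: q_def)
    ultimately have "lp m s q = - 2" using st sm by simp
    moreover have "lp m s q = q m * lp m s r"
    proof -
      have "lp m s q = lp m s (\<lambda>i. q m * r i)" using qm by (intro lp_cong) (auto simp: r_def)
      then show ?thesis by (simp add: lp_linear)
    qed
    ultimately have "r \<noteq> s" using nullrayD(2)[OF s] by auto
    moreover have "pairing m n r f = 0"
    proof -
      have "(\<Sum>i<m. t i * Re (g i)) = 2 * Re (f n)" "(\<Sum>i<m. t i * Im (g i)) = 2 * Im (f n)"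
        using ab by (simp_all add: t_def a_def b_def)
      then have tg: "(\<Sum>i<m. of_real (t i) * g i) = 2 * f n" by (simp add: complex_eq_iff)
      have "pairing m n q f = (\<Sum>i<m. of_real (q i) * f i) - of_real (q m) * f n"
        by (simp add: pairing_def lp_def lor_def)
      also have "(\<Sum>i<m. of_real (q i) * f i) = (\<Sum>i<m. of_real (t i) * g i + (of_real (\<tau> - 1) * (of_real (s i) * g i)
          + (f n * of_real (s i * t i) + of_real (\<tau> - 1) * f n * of_real ((s i)\<^sup>2))))"
        by (rule sum.cong) (auto simp: q_def g_def algebra_simps power2_eq_square)
      also have "\<dots> = 2 * f n + (of_real (\<tau> - 1) * 0 + (f n * of_real 0 + of_real (\<tau> - 1) * f n * of_real 1))"
        unfolding sum.distrib sum_distrib_left[symmetric] tg sg of_real_sum[symmetric] st sm(2) ..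
      finally have "pairing m n q f = 0" by (simp add: q_def algebra_simps)
      moreover have "pairing m n q f = of_real (q m) * pairing m n r f"
      proof -
        have "pairing m n q f = pairing m n (\<lambda>i. q m * r i) f"
          unfolding pairing_def using qm by (intro lp_cong) (auto simp: r_def)
        then show ?thesis by (simp add: pairing_scale_left)
      qed
      ultimately show ?thesis using qm by simp
    qed
    ultimately show ?thesis using r by blast
  next
    case True
    obtain c where c: "c \<noteq> 0" "\<forall>i<m. Im (c * g i) = 0"
      using gram_degenerate[OF True] by (auto simp: a_def b_def)
    define y where "y = Im (c * f n)"
    \<comment> \<open>The sign for which the perturbation of the last coordinate increases the
      absolute value of its real part.\<close>
    define \<sigma> where "\<sigma> = (if y \<ge> 0 then 1 else - 1 :: real)"
    let ?c = "- \<i> * c"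
    define F where "F = (\<lambda>k i. ?c * f i + (if i = n then of_real (\<sigma> * inverse (real (Suc k))) else 0))"
    have Ref: "Re (?c * f i) = y * s i" if "i < m" for i
    proof -
      have "c * f i = c * g i + c * f n * of_real (s i)" by (simp add: g_def algebra_simps)
      then have "Im (c * f i) = Im (c * g i) + y * s i" by (simp add: y_def)
      then show ?thesis using c that by simp
    qed
    have "F k \<in> timelike m n" for k
    proof -
      have "(\<Sum>i<m. (Re (F k i))\<^sup>2) = (\<Sum>i<m. y\<^sup>2 * (s i)\<^sup>2)"
      proof (rule sum.cong)
        fix i assume "i \<in> {..<m}"
        then have "F k i = ?c * f i" "i < m" using mn by (auto simp: F_def)
        then show "(Re (F k i))\<^sup>2 = y\<^sup>2 * (s i)\<^sup>2" using Ref[of i] by (simp add: power_mult_distrib)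
      qed simp
      also have "\<dots> = y\<^sup>2" using sm by (simp flip: sum_distrib_left)
      also have "\<dots> < (Re (F k n))\<^sup>2"
      proof -
        have R: "Re (F k n) = y + \<sigma> * inverse (real (Suc k))" by (simp add: F_def y_def del: of_real_mult of_nat_Suc)
        have "\<bar>y\<bar> < \<bar>Re (F k n)\<bar>" unfolding R \<sigma>_def by (auto simp: abs_if field_simps)
        then show ?thesis by (metis abs_le_square_iff not_less)
      qed
      finally show ?thesis by (simp add: timelike_def)
    qed
    moreover have "F \<longlonglongrightarrow> (\<lambda>i. ?c * f i)"
      unfolding tendsto_fun_iff
    proof
      fix i
      have "(\<lambda>k. complex_of_real (\<sigma> * inverse (real (Suc k)))) \<longlonglongrightarrow> of_real (\<sigma> * 0)"
        by (intro tendsto_intros LIMSEQ_inverse_real_of_nat)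
      from tendsto_add[OF tendsto_const[of "?c * f i"] this]
      show "(\<lambda>k. F k i) \<longlonglongrightarrow> ?c * f i" unfolding F_def by (cases "i = n") simp_all
    qed
    moreover have "?c \<noteq> 0" using c by simp
    ultimately show ?thesis by blast
  qed
qed

section \<open>Vectors not orthogonal to any null ray\<close>

lemma complete_to_null:
  fixes a u :: "nat \<Rightarrow> real"
  assumes "(\<Sum>i<m. (a i)\<^sup>2) \<le> 1" "(\<Sum>i<m. (u i)\<^sup>2) > 0" "(\<Sum>i<m. a i * u i) = 0"
  shows "\<exists>\<mu>. (\<lambda>i. if i < m then a i + \<mu> * u i else if i = m then 1 else 0) \<in> nullray m"
proof -
  define \<mu> where "\<mu> = sqrt ((1 - (\<Sum>i<m. (a i)\<^sup>2)) / (\<Sum>i<m. (u i)\<^sup>2))"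
  have \<mu>: "\<mu>\<^sup>2 * (\<Sum>i<m. (u i)\<^sup>2) = 1 - (\<Sum>i<m. (a i)\<^sup>2)"
    unfolding \<mu>_def using assms by (subst real_sqrt_pow2) auto
  have "(\<Sum>i<m. (a i + \<mu> * u i)\<^sup>2) = (\<Sum>i<m. (a i)\<^sup>2 + 2 * \<mu> * (a i * u i) + \<mu>\<^sup>2 * (u i)\<^sup>2)"
    by (rule sum.cong) (auto simp: power2_eq_square algebra_simps)
  also have "\<dots> = (\<Sum>i<m. (a i)\<^sup>2) + 2 * \<mu> * (\<Sum>i<m. a i * u i) + \<mu>\<^sup>2 * (\<Sum>i<m. (u i)\<^sup>2)"
    unfolding sum.distrib sum_distrib_left[symmetric] ..
  also have "\<dots> = 1" using \<mu> assms by simp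
  finally have "(\<Sum>i<m. (a i + \<mu> * u i)\<^sup>2) = 1" .
  then show ?thesis by (intro exI[of _ \<mu>]) (simp add: nullray_def lp_self_eq)
qed

lemma sum_supported:
  fixes u x :: "nat \<Rightarrow> real"
  assumes "3 \<le> m" "\<And>i. 3 \<le> i \<Longrightarrow> u i = 0"
  shows "(\<Sum>i<m. u i * x i) = u 0 * x 0 + u 1 * x 1 + u 2 * x 2"
proof -
  have "(\<Sum>i<m. u i * x i) = (\<Sum>i<3. u i * x i)"
    by (rule sum.mono_neutral_right) (use assms in auto)
  then show ?thesis by (simp add: eval_nat_numeral)
qed

text \<open>The cross product of the first three entries works; when it vanishes, the entries are
  dependent and a vector orthogonal to their common line is used. This is the dimension count that
  separates m > 2 from m = 2.\<close>

lemma ex_perp_two: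
  fixes x y :: "nat \<Rightarrow> real"
  assumes m: "3 \<le> m"
  shows "\<exists>u. (\<Sum>i<m. u i * x i) = 0 \<and> (\<Sum>i<m. u i * y i) = 0 \<and> (\<Sum>i<m. (u i)\<^sup>2) > 0"
proof -
  have *: ?thesis if "a * x 0 + b * x 1 + c * x 2 = 0" "a * y 0 + b * y 1 + c * y 2 = 0" "a \<noteq> 0 \<or> b \<noteq> 0 \<or> c \<noteq> 0"
    for a b c :: real
  proof -
    define u where "u = (\<lambda>i::nat. if i = 0 then a else if i = 1 then b else if i = 2 then c else 0)"
    have u: "\<And>i. 3 \<le> i \<Longrightarrow> u i = 0" "u 0 = a" "u 1 = b" "u 2 = c" by (auto simp: u_def)
    have "(\<Sum>i<m. (u i)\<^sup>2) = a\<^sup>2 + b\<^sup>2 + c\<^sup>2"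
      using sum_supported[of m u u, OF m u(1)] u by (simp add: power2_eq_square)
    also have "\<dots> > 0" using that(3) by (metis add_nonneg_nonneg add_nonneg_pos add_pos_nonneg zero_le_power2 zero_less_power2)
    finally show ?thesis using sum_supported[of m u x, OF m u(1)] sum_supported[of m u y, OF m u(1)] u that
      by (intro exI[of _ u]) simp
  qed
  let ?a = "x 1 * y 2 - x 2 * y 1" and ?b = "x 2 * y 0 - x 0 * y 2" and ?c = "x 0 * y 1 - x 1 * y 0"
  show ?thesis
  proof (cases "?a = 0 \<and> ?b = 0 \<and> ?c = 0")
    case False
    then show ?thesis by (intro *[of ?a ?b ?c]) (auto simp: algebra_simps)
  next
    case True
    consider "x 0 \<noteq> 0 \<or> x 1 \<noteq> 0" | "y 0 \<noteq> 0 \<or> y 1 \<noteq> 0" | "x 0 = 0" "x 1 = 0" "y 0 = 0" "y 1 = 0" by blast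
    then show ?thesis
    proof cases
      case 1
      then show ?thesis using True by (intro *[of "- x 1" "x 0" 0]) (auto simp: algebra_simps)
    next
      case 2
      then show ?thesis using True by (intro *[of "- y 1" "y 0" 0]) (auto simp: algebra_simps)
    next
      case 3
      then show ?thesis by (intro *[of 1 0 0]) auto
    qed
  qed
qed

lemma ex_perp_one:
  fixes x :: "nat \<Rightarrow> real"
  assumes m: "2 \<le> m"
  shows "\<exists>u. (\<Sum>i<m. u i * x i) = 0 \<and> (\<Sum>i<m. (u i)\<^sup>2) > 0"
proof -
  have *: ?thesis if "a * x 0 + b * x 1 = 0" "a \<noteq> 0 \<or> b \<noteq> 0" for a b :: real
  proof -
    define u where "u = (\<lambda>i::nat. if i = 0 then a else if i = 1 then b else 0)"
    have s: "(\<Sum>i<m. u i * z i) = a * z 0 + b * z 1" for z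
    proof -
      have "(\<Sum>i<m. u i * z i) = (\<Sum>i<2. u i * z i)"
        by (rule sum.mono_neutral_right) (use m in \<open>auto simp: u_def\<close>)
      then show ?thesis by (simp add: eval_nat_numeral u_def)
    qed
    have "(\<Sum>i<m. (u i)\<^sup>2) = a\<^sup>2 + b\<^sup>2" using s[of u] by (simp add: power2_eq_square u_def)
    also have "\<dots> > 0" using that(2) by (metis add_nonneg_pos add_pos_nonneg zero_le_power2 zero_less_power2)
    finally show ?thesis using s[of x] that by (intro exI[of _ u]) simp
  qed
  show ?thesis
  proof (cases "x 0 = 0 \<and> x 1 = 0")
    case True
    then show ?thesis by (intro *[of 1 0]) auto
  next
    case False
    then show ?thesis by (intro *[of "- x 1" "x 0"]) auto
  qed
qed

lemma square_le_self_imp_le_one: "(x::real)\<^sup>2 \<le> x \<Longrightarrow> x \<le> 1"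
proof (rule ccontr)
  assume "x\<^sup>2 \<le> x" "\<not> x \<le> 1"
  moreover from this have "x * 1 < x * x" by (intro mult_strict_left_mono) auto
  ultimately show False by (simp add: power2_eq_square)
qed

lemma pairing_eq_sum:
  "s m = 1 \<Longrightarrow> pairing m n s f = (\<Sum>i<m. of_real (s i) * f i) - f n"
  by (simp add: pairing_def lp_def lor_def)

text \<open>When no multiple is timelike, the last coordinate is the product of \<open>f\<close>
  with a real vector \<open>a\<close> of length at most 1. A direction orthogonal to the real and
  the imaginary part lets \<open>a\<close> slide to the unit sphere and yields a null ray orthogonal
  to \<open>f\<close>, a contradiction. Such a direction is missing only for m = 2 with independent
  parts.\<close>

lemma Om0_cases:
  assumes m: "2 \<le> m" and mn: "m \<le> n" and f: "f \<in> Om0 m n"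
  shows "(\<exists>c. c \<noteq> 0 \<and> (\<lambda>i. c * f i) \<in> timelike m n) \<or>
    (m = 2 \<and> (\<exists>a::nat \<Rightarrow> real. (\<Sum>i<m. (a i)\<^sup>2) < 1 \<and> f n = (\<Sum>i<m. of_real (a i) * f i)
      \<and> \<not> (\<exists>c. c \<noteq> 0 \<and> (\<forall>i<m. Im (c * f i) = 0))))"
proof (rule ccontr)
  assume neg: "\<not> ?thesis"
  then have notl: "(\<lambda>i. c * f i) \<notin> timelike m n" if "c \<noteq> 0" for c using that by blast
  define x y where "x = (\<lambda>i. Re (f i))" and "y = (\<lambda>i. Im (f i))"
  have nontl: "(a * x n + b * y n)\<^sup>2 \<le> (\<Sum>i<m. (a * x i + b * y i)\<^sup>2)" if "a \<noteq> 0 \<or> b \<noteq> 0" for a b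
  proof -
    have "Complex a (- b) \<noteq> 0" using that by (simp add: complex_eq_iff)
    from notl[OF this] show ?thesis by (simp add: timelike_def x_def y_def not_less)
  qed
  show False
  proof (cases "(\<Sum>i<m. (x i)\<^sup>2) * (\<Sum>i<m. (y i)\<^sup>2) = (\<Sum>i<m. x i * y i)\<^sup>2")
    case False
    obtain \<alpha> \<beta> where ab: "(\<Sum>i<m. (\<alpha> * x i + \<beta> * y i) * x i) = x n" "(\<Sum>i<m. (\<alpha> * x i + \<beta> * y i) * y i) = y n"
      using gram_solve[OF False] by blast
    define a where "a = (\<lambda>i. \<alpha> * x i + \<beta> * y i)"
    have fa: "f n = (\<Sum>i<m. of_real (a i) * f i)"
      using ab by (simp add: complex_eq_iff a_def x_def y_def)
    have aa: "(\<Sum>i<m. (a i)\<^sup>2) = \<alpha> * x n + \<beta> * y n"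
    proof -
      have "(\<Sum>i<m. (a i)\<^sup>2) = (\<Sum>i<m. \<alpha> * (a i * x i) + \<beta> * (a i * y i))"
        by (rule sum.cong) (auto simp: a_def power2_eq_square algebra_simps)
      also have "\<dots> = \<alpha> * x n + \<beta> * y n"
        unfolding sum.distrib sum_distrib_left[symmetric] using ab by (simp add: a_def)
      finally show ?thesis .
    qed
    \<comment> \<open>The combination with coefficients \<alpha>, \<beta> has spatial part
      \<open>a\<close> and last coordinate |a|^2 by \<open>aa\<close>. Not being timelike, it
      satisfies |a|^4 \<le> |a|^2.\<close>
    have le1: "(\<Sum>i<m. (a i)\<^sup>2) \<le> 1"
    proof (cases "\<alpha> = 0 \<and> \<beta> = 0")
      case True
      then show ?thesis by (simp add: a_def)
    next
      case False
      then have "(\<alpha> * x n + \<beta> * y n)\<^sup>2 \<le> (\<Sum>i<m. (a i)\<^sup>2)"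
        using nontl[of \<alpha> \<beta>] by (auto simp: a_def)
      then have "(\<Sum>i<m. (a i)\<^sup>2)\<^sup>2 \<le> (\<Sum>i<m. (a i)\<^sup>2)" by (simp add: aa)
      then show ?thesis using square_le_self_imp_le_one by blast
    qed
    have nonull: "(\<lambda>i. if i < m then a i + l * u i else if i = m then 1 else 0) \<notin> nullray m"
      if u: "(\<Sum>i<m. u i * x i) = 0" "(\<Sum>i<m. u i * y i) = 0" for u l
    proof
      let ?s = "\<lambda>i. if i < m then a i + l * u i else if i = m then 1 else 0"
      assume s: "?s \<in> nullray m"
      have uf: "(\<Sum>i<m. of_real (u i) * f i) = 0" using u by (simp add: complex_eq_iff x_def y_def)
      have "pairing m n ?s f = (\<Sum>i<m. of_real (a i) * f i + of_real l * (of_real (u i) * f i)) - f n"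
        by (subst pairing_eq_sum) (auto simp: algebra_simps intro!: sum.cong)
      also have "\<dots> = 0" unfolding sum.distrib sum_distrib_left[symmetric] uf fa[symmetric] by simp
      finally show False using f s by (simp add: Om0_def)
    qed
    show False
    proof (cases "m = 2")
      case True
      have "\<not> (\<exists>c. c \<noteq> 0 \<and> (\<forall>i<m. Im (c * f i) = 0))"
      proof
        assume "\<exists>c. c \<noteq> 0 \<and> (\<forall>i<m. Im (c * f i) = 0)"
        then obtain c where c: "c \<noteq> 0" "\<forall>i<m. Re c * y i + Im c * x i = 0" by (auto simp: x_def y_def)
        have 1: "Re c * (\<Sum>i<m. x i * y i) + Im c * (\<Sum>i<m. (x i)\<^sup>2) = 0"
          "Re c * (\<Sum>i<m. (y i)\<^sup>2) + Im c * (\<Sum>i<m. x i * y i) = 0"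
        proof -
          have "Re c * (\<Sum>i<m. x i * y i) + Im c * (\<Sum>i<m. (x i)\<^sup>2) = (\<Sum>i<m. x i * (Re c * y i + Im c * x i))"
            unfolding sum_distrib_left sum.distrib[symmetric] by (rule sum.cong) (auto simp: algebra_simps power2_eq_square)
          then show "Re c * (\<Sum>i<m. x i * y i) + Im c * (\<Sum>i<m. (x i)\<^sup>2) = 0" using c by simp
          have "Re c * (\<Sum>i<m. (y i)\<^sup>2) + Im c * (\<Sum>i<m. x i * y i) = (\<Sum>i<m. y i * (Re c * y i + Im c * x i))"
            unfolding sum_distrib_left sum.distrib[symmetric] by (rule sum.cong) (auto simp: algebra_simps power2_eq_square)
          then show "Re c * (\<Sum>i<m. (y i)\<^sup>2) + Im c * (\<Sum>i<m. x i * y i) = 0" using c by simp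
        qed
        define P Q R where "P = (\<Sum>i<m. (x i)\<^sup>2)" and "Q = (\<Sum>i<m. (y i)\<^sup>2)" and "R = (\<Sum>i<m. x i * y i)"
        have "Re c * (P * Q - R\<^sup>2) = P * (Re c * Q + Im c * R) - R * (Re c * R + Im c * P)"
          "Im c * (P * Q - R\<^sup>2) = Q * (Re c * R + Im c * P) - R * (Re c * Q + Im c * R)"
          by (simp_all add: power2_eq_square algebra_simps)
        then have "Re c * (P * Q - R\<^sup>2) = 0" "Im c * (P * Q - R\<^sup>2) = 0"
          using 1 by (simp_all add: P_def Q_def R_def)
        then show False using False c(1) by (auto simp: P_def Q_def R_def complex_eq_iff)
      qed
      moreover have "(\<Sum>i<m. (a i)\<^sup>2) \<noteq> 1"
        using nonull[of "\<lambda>_. 0" 0] by (auto simp: nullray_def lp_self_eq)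
      ultimately show False using neg True fa le1 by (metis order_le_less)
    next
      case False
      obtain u where u: "(\<Sum>i<m. u i * x i) = 0" "(\<Sum>i<m. u i * y i) = 0" "(\<Sum>i<m. (u i)\<^sup>2) > 0"
        using ex_perp_two[of m x y] False m by auto
      have "(\<Sum>i<m. a i * u i) = \<alpha> * (\<Sum>i<m. u i * x i) + \<beta> * (\<Sum>i<m. u i * y i)"
        unfolding a_def sum_distrib_left sum.distrib[symmetric] by (rule sum.cong) (auto simp: algebra_simps)
      then have "(\<Sum>i<m. a i * u i) = 0" using u by simp
      from complete_to_null[OF le1 u(3) this] nonull[OF u(1,2)] show False by blast
    qed
  next
    case True
    obtain c where c: "c \<noteq> 0" "\<forall>i<m. Im (c * f i) = 0"
      using gram_degenerate[OF True] by (auto simp: x_def y_def)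
    define g where "g = (\<lambda>i. c * f i)"
    have gO: "g \<in> Om0 m n" using f c by (simp add: Om0_def g_def pairing_scale)
    have gi: "Im (g i) = 0" if "i < m" for i using c that by (simp add: g_def)
    \<comment> \<open>\<open>g\<close> has real spatial part. Multiplication by -\<i> moves
      imaginary parts into real parts, so failure to be timelike forces the last coordinate to be
      real too.\<close>
    have "(\<lambda>i. - \<i> * c * f i) \<notin> timelike m n" by (rule notl) (use c in simp)
    moreover have "Re (- \<i> * c * f i) = Im (g i)" for i by (simp add: g_def algebra_simps)
    ultimately have "(Im (g n))\<^sup>2 \<le> (\<Sum>i<m. (Im (g i))\<^sup>2)" by (simp only: timelike_def mem_Collect_eq not_less)
    then have "Im (g n) = 0" using gi by simp
    define P where "P = (\<Sum>i<m. (Re (g i))\<^sup>2)"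
    have P: "(Re (g n))\<^sup>2 \<le> P" using notl[OF c(1)] by (simp add: timelike_def g_def P_def not_less)
    have P0: "P \<ge> 0" by (simp add: P_def sum_nonneg)
    obtain u where u: "(\<Sum>i<m. u i * Re (g i)) = 0" "(\<Sum>i<m. (u i)\<^sup>2) > 0" using ex_perp_one[OF m, of "\<lambda>i. Re (g i)"] by blast
    \<comment> \<open>The shortest vector with the required scalar product with the real part of
      \<open>g\<close>. For P = 0 the division yields a = 0, as it should, since
      \<open>Re (g n)\<close> vanishes then.\<close>
    define a where "a = (\<lambda>i. Re (g n) / P * Re (g i))"
    have aa: "(\<Sum>i<m. (a i)\<^sup>2) = (Re (g n) / P)\<^sup>2 * P"
    proof -
      have "(\<Sum>i<m. (a i)\<^sup>2) = (\<Sum>i<m. (Re (g n) / P)\<^sup>2 * (Re (g i))\<^sup>2)"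
        by (rule sum.cong) (auto simp: a_def power_mult_distrib power_divide)
      then show ?thesis unfolding sum_distrib_left[symmetric] P_def[symmetric] .
    qed
    have "(\<Sum>i<m. (a i)\<^sup>2) \<le> 1"
      unfolding aa using P P0 by (cases "P = 0") (auto simp: power2_eq_square divide_simps)
    moreover have "(\<Sum>i<m. a i * u i) = Re (g n) / P * (\<Sum>i<m. u i * Re (g i))"
      unfolding a_def sum_distrib_left by (rule sum.cong) auto
    then have "(\<Sum>i<m. a i * u i) = 0" using u by simp
    ultimately obtain l where s: "(\<lambda>i. if i < m then a i + l * u i else if i = m then 1 else 0) \<in> nullray m" (is "?s \<in> _")
      using complete_to_null u(2) by blast
    have "pairing m n ?s g = (\<Sum>i<m. of_real (a i + l * u i) * g i) - g n"
      by (subst pairing_eq_sum) auto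
    also have "(\<Sum>i<m. of_real (a i + l * u i) * g i) = of_real (\<Sum>i<m. Re (g n) / P * (Re (g i))\<^sup>2 + l * (u i * Re (g i)))"
      unfolding of_real_sum
      by (rule sum.cong) (auto simp: complex_eq_iff gi a_def power2_eq_square algebra_simps)
    also have "\<dots> = of_real (Re (g n) / P * P)"
      unfolding sum.distrib sum_distrib_left[symmetric] u P_def by simp
    also have "of_real (Re (g n) / P * P) - g n = 0"
      using P \<open>Im (g n) = 0\<close> by (cases "P = 0") (auto simp: complex_eq_iff)
    finally show False using gO s by (simp add: Om0_def)
  qed
qed

context kulkarni_setup
begin

lemma closure_timelike_superset:
  assumes "2 < m"
  shows "kulkarni_region X GG proj_act \<subseteq> X closure_of (pp n ` timelike m n)"
proof
  fix z assume z: "z \<in> kulkarni_region X GG proj_act"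
  then obtain f where f: "f \<in> nz n" "z = pp n f"
    by (auto simp: kulkarni_region_def topspace_proj_pp)
  have tlX: "pp n ` timelike m n \<subseteq> topspace X"
    using Om0_subset_nz[OF m1 mn] timelike_subset_Om0[OF mn] by blast
  have cl: "closedin X (X closure_of (pp n ` timelike m n))" by simp
  have sub: "pp n ` timelike m n \<subseteq> X closure_of (pp n ` timelike m n)" by (rule closure_of_subset[OF tlX])
  show "z \<in> X closure_of (pp n ` timelike m n)"
  proof (cases "f \<in> Om0 m n")
    case True
    then obtain c where c: "c \<noteq> 0" "(\<lambda>i. c * f i) \<in> timelike m n" using Om0_cases[OF m2 mn True] assms by auto
    then show ?thesis using sub pp_scale[OF c(1) f(1)] f(2) by (metis imageI subsetD)
  next
    case False
    then obtain s where s: "s \<in> nullray m" "pairing m n s f = 0" by (auto simp: Om0_def)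
    from null_perp_cases[OF mn s] show ?thesis
    proof
      assume "\<exists>q\<in>nullray m. q \<noteq> s \<and> pairing m n q f = 0"
      then obtain q where "q \<in> nullray m" "q \<noteq> s" "pairing m n q f = 0" by blast
      then have "pp n f \<in> L0 \<union> L1" using two_null_perp_in_limit_set[OF f(1) s(1), of q] s(2) by blast
      then show ?thesis using z f by (simp add: kulkarni_region_def kulkarni_limit_set_def)
    next
      assume "\<exists>c F. c \<noteq> 0 \<and> F \<longlonglongrightarrow> (\<lambda>i. c * f i) \<and> (\<forall>k. F k \<in> timelike m n)"
      then obtain c F where c: "c \<noteq> 0" "F \<longlonglongrightarrow> (\<lambda>i. c * f i)" "\<And>k. F k \<in> timelike m n" by blast
      have "pp n (\<lambda>i. c * f i) \<in> X closure_of (pp n ` timelike m n)"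
        by (rule closedin_proj_eventually[OF cl c(2)])
          (use c f sub in \<open>auto simp: nz_def intro!: always_eventually\<close>)
      then show ?thesis using pp_scale[OF c(1) f(1)] f(2) by simp
    qed
  qed
qed

lemma connected_region:
  assumes "2 < m"
  shows "connected_space (subtopology X (kulkarni_region X GG proj_act))"
proof -
  have "pp n ` timelike m n \<subseteq> kulkarni_region X GG proj_act"
    using timelike_subset_Om0[OF mn] Om0_subset_region by blast
  then have "connectedin X (kulkarni_region X GG proj_act)"
    using connectedin_intermediate_closure_of[OF connected_pp_timelike[OF m1 mn]] closure_timelike_superset[OF assms] by blast
  then show ?thesis by (simp add: connectedin_def)
qed

end

section \<open>The plane case\<close>

text \<open>The Lorentz part is a complex multiple of a real vector. Expressed through pairings with
  arbitrary real vectors, this is a closed condition, invariant under scaling and under the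
  group.\<close>

definition realish :: "nat \<Rightarrow> nat \<Rightarrow> (nat \<Rightarrow> complex) \<Rightarrow> bool" where
  "realish m n f \<longleftrightarrow> (\<forall>p q. Im (cnj (pairing m n p f) * pairing m n q f) = 0)"

lemma Im_cnj_scale: "Im (cnj (c * a) * (c * b)) = (norm c)\<^sup>2 * Im (cnj a * b)"
proof -
  have "cnj (c * a) * (c * b) = complex_of_real ((norm c)\<^sup>2) * (cnj a * b)"
    unfolding complex_norm_square by simp
  then show ?thesis by (simp only: Im_complex_of_real Re_complex_of_real times_complex.simps)
qed

lemma realish_scale: "c \<noteq> 0 \<Longrightarrow> realish m n (\<lambda>i. c * f i) \<longleftrightarrow> realish m n f"
  unfolding realish_def pairing_scale Im_cnj_scale by simp

lemma realish_cong: "m \<le> n \<Longrightarrow> (\<And>i. i \<le> n \<Longrightarrow> f i = g i) \<Longrightarrow> realish m n f \<longleftrightarrow> realish m n g"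
  unfolding realish_def using pairing_cong[of m n f g] by simp

lemma realish_cact: "m \<le> n \<Longrightarrow> realish m n f \<Longrightarrow> realish m n (cact m n A f)"
  unfolding realish_def pairing_cact by blast

lemma realish_embed_real: "m \<le> n \<Longrightarrow> realish m n (embed_real m n x)"
  unfolding realish_def by (simp add: pairing_embed_real)

lemma lp2: "lp 2 x y = x 0 * y 0 + x 1 * y 1 - x 2 * y 2"
  by (simp add: lp_def eval_nat_numeral)

text \<open>The unit tangent at \<open>s\<close> of the circle at infinity, the spatial part of
  \<open>s\<close> turned by a right angle.\<close>

definition tangent :: "(nat \<Rightarrow> real) \<Rightarrow> nat \<Rightarrow> real" where
  "tangent s = (\<lambda>i. if i = 0 then - s 1 else if i = 1 then s 0 else 0)"

lemma lp_tangent: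
  assumes "s \<in> nullray 2"
  shows "lp 2 (tangent s) (tangent s) = 1" "lp 2 (tangent s) s = 0"
proof -
  have "s 0 * s 0 + s 1 * s 1 = 1" "s 2 = 1" using nullrayD[OF assms] by (simp_all add: lp2)
  then show "lp 2 (tangent s) (tangent s) = 1" "lp 2 (tangent s) s = 0"
    by (simp_all add: lp2 tangent_def algebra_simps)
qed

text \<open>With d the corner entry, k and a the time coordinates of the images of \<open>s\<close>
  and its tangent: in this frame the spatial part of the base point's inverse image has components d
  - k and, up to sign, a, and squared length d^2 - 1. Bounds on a and two-sided positive bounds on k
  therefore bound the element.\<close>

lemma frame_estimate:
  assumes A: "A \<in> carrier (SO_plus 2)" and s: "s \<in> nullray 2"
  shows "A $$ (2, 2) = ((mv 2 A s 2)\<^sup>2 + (mv 2 A (tangent s) 2)\<^sup>2 + 1) / (2 * mv 2 A s 2)"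
proof -
  let ?r = "mv 2 (adj 2 A) (em 2) :: nat \<Rightarrow> real" and ?k = "mv 2 A s 2" and ?a = "mv 2 A (tangent s) 2"
  have k0: "?k > 0" by (rule mv_nullray_pos[OF A s])
  have s1: "s 0 * s 0 + s 1 * s 1 = 1" "s 2 = 1" using nullrayD[OF s] by (simp_all add: lp2)
  have r: "?r 0 * ?r 0 + ?r 1 * ?r 1 = ?r 2 * ?r 2 - 1"
    using lp_row(1)[OF A, unfolded lp2] by linarith
  have k: "?k = ?r 2 - (?r 0 * s 0 + ?r 1 * s 1)" unfolding mv_time[of 2 A s] by (simp add: lp2 s1)
  have a: "?a = ?r 0 * s 1 - ?r 1 * s 0" unfolding mv_time[of 2 A "tangent s"] by (simp add: lp2 tangent_def)
  have "(?r 2 - ?k)\<^sup>2 + ?a\<^sup>2 = (?r 0 * ?r 0 + ?r 1 * ?r 1) * (s 0 * s 0 + s 1 * s 1)"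
    unfolding k a by (simp add: power2_eq_square algebra_simps)
  then have "(?r 2 - ?k)\<^sup>2 + ?a\<^sup>2 = ?r 2 * ?r 2 - 1" unfolding s1 r by simp
  then have "2 * ?k * ?r 2 = ?k\<^sup>2 + ?a\<^sup>2 + 1" by (simp add: power2_eq_square algebra_simps)
  then show ?thesis using k0 lp_row(2)[OF A] by (simp add: field_simps)
qed

text \<open>By Lagrange's identity the squares of the minors sum to the Euclidean Gram determinant,
  which the Lorentz relations reduce to 2 \<open>(N 2)\<^sup>2\<close>.\<close>

lemma minors_bound:
  fixes V N :: "nat \<Rightarrow> real"
  assumes V: "lp 2 V V = 1" and N: "lp 2 N N = 0" and VN: "lp 2 V N = 0" and k: "0 < N 2"
  shows "\<bar>V 0 * N 1 - V 1 * N 0\<bar> \<le> 2 * N 2" "\<bar>V 0 * N 2 - V 2 * N 0\<bar> \<le> 2 * N 2"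
    "\<bar>V 1 * N 2 - V 2 * N 1\<bar> \<le> 2 * N 2"
proof -
  have v: "V 0 * V 0 + V 1 * V 1 = 1 + V 2 * V 2" and n: "N 0 * N 0 + N 1 * N 1 = N 2 * N 2"
    and vn: "V 0 * N 0 + V 1 * N 1 = V 2 * N 2" using V N VN by (simp_all add: lp2)
  let ?a = "V 0 * N 1 - V 1 * N 0" and ?b = "V 0 * N 2 - V 2 * N 0" and ?c = "V 1 * N 2 - V 2 * N 1"
  have "?a\<^sup>2 + ?b\<^sup>2 + ?c\<^sup>2 = (V 0 * V 0 + V 1 * V 1 + V 2 * V 2) * (N 0 * N 0 + N 1 * N 1 + N 2 * N 2)
      - (V 0 * N 0 + V 1 * N 1 + V 2 * N 2)\<^sup>2"
    by (simp add: power2_eq_square algebra_simps)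
  also have "\<dots> = 2 * (N 2)\<^sup>2" unfolding v n vn by (simp add: power2_eq_square algebra_simps)
  finally have s: "?a\<^sup>2 + ?b\<^sup>2 + ?c\<^sup>2 = 2 * (N 2)\<^sup>2" .
  have N2: "2 * (N 2)\<^sup>2 \<le> (2 * N 2)\<^sup>2" by (simp add: power2_eq_square)
  have sq: "0 \<le> ?a\<^sup>2" "0 \<le> ?b\<^sup>2" "0 \<le> ?c\<^sup>2" by simp_all
  show "\<bar>?a\<bar> \<le> 2 * N 2" by (rule square_le_of_le) (use s sq N2 k in linarith)+
  show "\<bar>?b\<bar> \<le> 2 * N 2" by (rule square_le_of_le) (use s sq N2 k in linarith)+
  show "\<bar>?c\<bar> \<le> 2 * N 2" by (rule square_le_of_le) (use s sq N2 k in linarith)+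
qed

lemma lp_minor_bound:
  fixes V N p q :: "nat \<Rightarrow> real"
  assumes "lp 2 V V = 1" "lp 2 N N = 0" "lp 2 V N = 0" "0 < N 2"
  shows "\<bar>lp 2 p V * lp 2 q N - lp 2 p N * lp 2 q V\<bar>
    \<le> 2 * (\<bar>p 0 * q 1 - p 1 * q 0\<bar> + \<bar>p 0 * q 2 - p 2 * q 0\<bar> + \<bar>p 1 * q 2 - p 2 * q 1\<bar>) * N 2"
proof -
  let ?a = "V 0 * N 1 - V 1 * N 0" and ?b = "V 0 * N 2 - V 2 * N 0" and ?c = "V 1 * N 2 - V 2 * N 1"
  let ?A = "p 0 * q 1 - p 1 * q 0" and ?B = "p 0 * q 2 - p 2 * q 0" and ?C = "p 1 * q 2 - p 2 * q 1"
  have "lp 2 p V * lp 2 q N - lp 2 p N * lp 2 q V = ?A * ?a - ?B * ?b - ?C * ?c"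
    by (simp add: lp2 algebra_simps)
  then have "\<bar>lp 2 p V * lp 2 q N - lp 2 p N * lp 2 q V\<bar> \<le> \<bar>?A\<bar> * \<bar>?a\<bar> + \<bar>?B\<bar> * \<bar>?b\<bar> + \<bar>?C\<bar> * \<bar>?c\<bar>"
    unfolding abs_mult[symmetric] by linarith
  also have "\<dots> \<le> \<bar>?A\<bar> * (2 * N 2) + \<bar>?B\<bar> * (2 * N 2) + \<bar>?C\<bar> * (2 * N 2)"
    by (intro add_mono mult_left_mono minors_bound[OF assms]) auto
  finally show ?thesis by (simp add: algebra_simps)
qed

lemma null_perp_normal_form:
  assumes n: "2 \<le> n" and s: "s \<in> nullray 2" and f: "pairing 2 n s f = 0"
  shows "\<exists>\<rho>. \<forall>i\<le>2. lor 2 n f i = \<rho> * of_real (tangent s i) + f n * of_real (s i)"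
proof -
  have s1: "s 0 * s 0 + s 1 * s 1 = 1" "s 2 = 1" using nullrayD[OF s] by (simp_all add: lp2)
  have c1: "of_real (s 0) * of_real (s 0) + of_real (s 1) * of_real (s 1) = (1::complex)"
    using s1(1) by (metis of_real_1 of_real_add of_real_mult)
  have fn: "f n = of_real (s 0) * f 0 + of_real (s 1) * f 1"
    using f s1(2) by (simp add: pairing_def lp2 lor_def)
  define \<rho> where "\<rho> = of_real (s 0) * f 1 - of_real (s 1) * f 0"
  have "f 0 = (of_real (s 0) * of_real (s 0) + of_real (s 1) * of_real (s 1)) * f 0"
    "f 1 = (of_real (s 0) * of_real (s 0) + of_real (s 1) * of_real (s 1)) * f 1"
    unfolding c1 by simp_all
  then have f01: "f 0 = \<rho> * of_real (- s 1) + f n * of_real (s 0)" "f 1 = \<rho> * of_real (s 0) + f n * of_real (s 1)"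
    unfolding fn \<rho>_def by (simp_all add: algebra_simps)
  have "lor 2 n f i = \<rho> * of_real (tangent s i) + f n * of_real (s i)" if i: "i \<le> 2" for i
  proof -
    consider "i = 0" | "i = 1" | "i = 2" using i by linarith
    then show ?thesis
    proof cases
      case 1
      then show ?thesis using f01(1) by (simp add: lor_def tangent_def)
    next
      case 2
      then show ?thesis using f01(2) by (simp add: lor_def tangent_def)
    next
      case 3
      then show ?thesis using s1(2) by (simp add: lor_def tangent_def)
    qed
  qed
  then show ?thesis by blast
qed

locale kulkarni_plane = kulkarni_setup +
  assumes m_eq: "m = 2"
begin

lemma n2: "2 \<le> n" using mn m_eq by simp

definition real_locus :: "complex vec set set" where
  "real_locus = pp n ` {f \<in> nz n. realish m n f}"

lemma pp_in_real_locus_iff: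
  assumes "f \<in> nz n"
  shows "pp n f \<in> real_locus \<longleftrightarrow> realish m n f"
proof
  assume "pp n f \<in> real_locus"
  then obtain g where g: "g \<in> nz n" "realish m n g" "pp n f = pp n g" by (auto simp: real_locus_def)
  then obtain c where c: "c \<noteq> 0" "\<forall>i\<le>n. f i = c * g i" using pp_eq_iff assms by blast
  then show "realish m n f" using realish_cong[OF mn, of f "\<lambda>i. c * g i"] realish_scale g by blast
qed (use assms in \<open>auto simp: real_locus_def\<close>)

lemma closedin_real_locus: "closedin X real_locus"
proof -
  define V where "V = {f. \<not> realish m n f}"
  have "V = (\<Union>p. \<Union>q. {f. Im (cnj (pairing m n p f) * pairing m n q f) \<noteq> 0})" by (auto simp: V_def realish_def)
  moreover have "open {f. Im (cnj (pairing m n p f) * pairing m n q f) \<noteq> 0}" for p q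
    by (intro open_Collect_neq continuous_on_Im continuous_on_mult continuous_on_cnj continuous_on_pairing continuous_on_const)
  ultimately have "open V" by (simp only:) (intro open_UN ballI)
  then have "openin X (pp n ` (V \<inter> nz n))" by (rule openin_pp_image)
  moreover have "pp n ` (V \<inter> nz n) = topspace X - real_locus"
    unfolding topspace_proj_pp using pp_in_real_locus_iff by (auto simp: V_def)
  moreover have "real_locus \<subseteq> topspace X" by (auto simp: real_locus_def)
  ultimately show ?thesis by (simp add: closedin_def)
qed

lemma act_real_locus: "g \<in> GG \<Longrightarrow> z \<in> real_locus \<Longrightarrow> proj_act g z \<in> real_locus"
  using act_pp realish_cact[OF mn] cact_nz[OF G_SO mn] unfolding real_locus_def by fastforce

text \<open>The inverse expands some null ray, so the norm of the image grows at least like the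
  corner entry while \<open>inv_size\<close> stays fixed. Their scale-invariant quotient tends to 0
  along the orbit but is positive near the nonreal point \<open>f'\<close>.\<close>

lemma finite_meeting_Om0:
  assumes f: "f \<in> Om0 m n" and f': "f' \<in> nz n" "\<not> realish m n f'"
  shows "\<exists>U. openin X U \<and> pp n f' \<in> U \<and> finite {g \<in> GG. proj_act g (pp n f) \<in> U}"
proof -
  have fz: "f \<in> nz n" using f Om0_subset_nz[OF m1 mn] by blast
  have "inv_size m n f' \<noteq> 0"
  proof
    assume "inv_size m n f' = 0"
    then obtain s where s: "s \<in> nullray m" "pp n f' = pp n (embed_real m n s)" using inv_size_eq_0_imp[OF f'(1) _ mn] by blast
    then show False using f' pp_in_real_locus_iff[OF f'(1)] pp_in_real_locus_iff[OF embed_real_nz[OF s(1) mn]] realish_embed_real[OF mn] by simp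
  qed
  moreover have hn: "inv_size m n h \<ge> 0" for h unfolding inv_size_def by (intro add_nonneg_nonneg sum_nonneg) auto
  ultimately have h': "inv_size m n f' > 0" by (metis order_le_less)
  have N': "norm1 n f' > 0" by (rule norm1_pos[OF f'(1)])
  define \<epsilon> where "\<epsilon> = inv_size m n f' / (2 * (norm1 n f')\<^sup>2)"
  have \<epsilon>: "\<epsilon> > 0" "\<epsilon> * (norm1 n f')\<^sup>2 < inv_size m n f'" using h' N' by (simp_all add: \<epsilon>_def)
  define V where "V = {h. \<epsilon> * (norm1 n h)\<^sup>2 < inv_size m n h}"
  have "open V" unfolding V_def
    by (intro open_Collect_less continuous_on_mult continuous_on_power continuous_on_const continuous_on_norm1 continuous_on_inv_size)
  then have U: "openin X (pp n ` (V \<inter> nz n))" by (rule openin_pp_image)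
  from Om0_locally_uniform[OF f m1 mn] obtain \<delta> where \<delta>: "\<delta> > 0" "\<forall>s\<in>nullray m. \<delta> \<le> norm (pairing m n s f)" by blast
  have "A $$ (m, m) \<le> inv_size m n f / (\<epsilon> * \<delta>\<^sup>2)" if A: "A \<in> \<Gamma>" and inU: "proj_act (iota m n A) (pp n f) \<in> pp n ` (V \<inter> nz n)" for A
  proof -
    let ?d = "A $$ (m, m)" and ?g = "cact m n A f"
    note SO = G_SO[OF A]
    note SO' = adj_in_SO_plus[OF SO]
    have d1: "?d \<ge> 1" by (rule SO_plus_diag_ge_1[OF SO])
    have gz: "?g \<in> nz n" by (rule cact_nz[OF SO mn fz])
    obtain h where h: "h \<in> V" "h \<in> nz n" "pp n ?g = pp n h" using inU act_pp[OF A] by auto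
    then obtain c where c: "c \<noteq> 0" "\<forall>i\<le>n. ?g i = c * h i" using pp_eq_iff gz by blast
    have "norm1 n ?g = norm c * norm1 n h" "inv_size m n ?g = (norm c)\<^sup>2 * inv_size m n h"
      using norm1_cong[of n ?g "\<lambda>i. c * h i"] inv_size_cong[OF mn, of ?g "\<lambda>i. c * h i"] c by (simp_all add: norm1_scale inv_size_scale)
    moreover have "(norm c)\<^sup>2 * (\<epsilon> * (norm1 n h)\<^sup>2) \<le> (norm c)\<^sup>2 * inv_size m n h"
      using h by (intro mult_left_mono) (auto simp: V_def)
    ultimately have le: "\<epsilon> * (norm1 n ?g)\<^sup>2 \<le> inv_size m n f"
      using inv_size_cact[OF SO mn, of f] by (simp add: power_mult_distrib mult.left_commute)
    obtain s where s: "s \<in> nullray m" "?d \<le> mv m (adj m A) s m" using ex_nullray_expanded[OF SO' m1] by auto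
    have "pairing m n s ?g = of_real (mv m (adj m A) s m) * pairing m n (ray_act m (adj m A) s) f"
      unfolding pairing_cact[OF mn] by (subst mv_ray_act[OF SO' s(1)]) (simp only: pairing_scale_left)
    then have "norm (pairing m n s ?g) = mv m (adj m A) s m * norm (pairing m n (ray_act m (adj m A) s) f)"
      using mv_nullray_pos[OF SO' s(1)] by (simp add: norm_mult)
    moreover have "?d * \<delta> \<le> mv m (adj m A) s m * norm (pairing m n (ray_act m (adj m A) s) f)"
      using s \<delta> d1 ray_act_nullray[OF SO' s(1)] by (intro mult_mono) auto
    ultimately have "?d * \<delta> \<le> norm1 n ?g" using norm_pairing_le[OF mn s(1), of ?g] by simp
    then have "\<epsilon> * (?d * \<delta>)\<^sup>2 \<le> \<epsilon> * (norm1 n ?g)\<^sup>2" using \<epsilon> d1 \<delta> by (intro mult_left_mono power_mono) auto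
    then have "?d\<^sup>2 * (\<epsilon> * \<delta>\<^sup>2) \<le> inv_size m n f" using le by (simp add: power_mult_distrib mult_ac)
    then have "?d\<^sup>2 \<le> inv_size m n f / (\<epsilon> * \<delta>\<^sup>2)" using \<epsilon> \<delta> by (simp add: pos_le_divide_eq)
    moreover have "?d \<le> ?d\<^sup>2" using d1 by (simp add: power2_eq_square)
    ultimately show ?thesis by linarith
  qed
  then have "{g \<in> GG. proj_act g (pp n f) \<in> pp n ` (V \<inter> nz n)} \<subseteq> iota m n ` {A \<in> \<Gamma>. A $$ (m, m) \<le> inv_size m n f / (\<epsilon> * \<delta>\<^sup>2)}"
    by blast
  then have "finite {g \<in> GG. proj_act g (pp n f) \<in> pp n ` (V \<inter> nz n)}"
    using finite_bounded finite_subset by blast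
  moreover have "pp n f' \<in> pp n ` (V \<inter> nz n)" using f' \<epsilon> by (auto simp: V_def)
  ultimately show ?thesis using U by blast
qed

lemma pairing_frame:
  assumes "\<And>i. i \<le> m \<Longrightarrow> lor m n g i = of_real (V i) + \<alpha> * of_real (N i)"
  shows "pairing m n p g = of_real (lp m p V) + \<alpha> * of_real (lp m p N)"
proof -
  have "pairing m n p g = lp m (\<lambda>i. of_real (p i)) (\<lambda>i. of_real (V i) + \<alpha> * of_real (N i))"
    unfolding pairing_def using assms by (intro lp_cong) auto
  then show ?thesis by (simp add: lp_linear lp_of_real)
qed

text \<open>Near \<open>f'\<close> the quantity \<open>D\<close> dominates the squared norm. For an
  image of \<open>f\<close> it is at most a multiple of k, by the minor estimates, while the norm is
  at least 1 and at least |Im \<alpha>| k. This bounds k from both sides, hence a, and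
  \<open>frame_estimate\<close> applies.\<close>

lemma finite_meeting_frame:
  assumes s: "s \<in> nullray m" and \<alpha>: "Im \<alpha> \<noteq> 0" and f: "f \<in> nz n"
    and frame: "\<And>i. i \<le> m \<Longrightarrow> lor m n f i = of_real (tangent s i) + \<alpha> * of_real (s i)"
    and f': "f' \<in> nz n" "\<not> realish m n f'"
  shows "\<exists>U. openin X U \<and> pp n f' \<in> U \<and> finite {g \<in> GG. proj_act g (pp n f) \<in> U}"
proof -
  obtain p q where pq: "Im (cnj (pairing m n p f') * pairing m n q f') \<noteq> 0" using f' by (auto simp: realish_def)
  define D where "D = (\<lambda>h. \<bar>Im (cnj (pairing m n p h) * pairing m n q h)\<bar>)"
  have Dscale: "D (\<lambda>i. c * h i) = (norm c)\<^sup>2 * D h" for c h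
    unfolding D_def pairing_scale Im_cnj_scale by (simp add: abs_mult)
  have Dcong: "D h = D h'" if "\<And>i. i \<le> n \<Longrightarrow> h i = h' i" for h h'
    unfolding D_def using pairing_cong[OF mn that] by simp
  have D': "D f' > 0" using pq by (simp add: D_def)
  have N': "norm1 n f' > 0" by (rule norm1_pos[OF f'(1)])
  define \<delta> where "\<delta> = D f' / (2 * (norm1 n f')\<^sup>2)"
  have \<delta>: "\<delta> > 0" "\<delta> * (norm1 n f')\<^sup>2 < D f'" using D' N' by (simp_all add: \<delta>_def)
  define V where "V = {h. \<delta> * (norm1 n h)\<^sup>2 < D h}"
  have "open V" unfolding V_def D_def
    by (intro open_Collect_less continuous_on_mult continuous_on_power continuous_on_const continuous_on_norm1
        continuous_on_rabs continuous_on_Im continuous_on_cnj continuous_on_pairing)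
  then have U: "openin X (pp n ` (V \<inter> nz n))" by (rule openin_pp_image)
  define C where "C = 2 * (\<bar>p 0 * q 1 - p 1 * q 0\<bar> + \<bar>p 0 * q 2 - p 2 * q 0\<bar> + \<bar>p 1 * q 2 - p 2 * q 1\<bar>) + 1"
  have C: "C > 0" by (simp add: C_def add_nonneg_pos)
  define \<alpha>i where "\<alpha>i = \<bar>Im \<alpha>\<bar>"
  have \<alpha>i: "\<alpha>i > 0" using \<alpha> by (simp add: \<alpha>i_def)
  define k0 where "k0 = \<delta> / (\<alpha>i * C)"
  define k1 where "k1 = C / (\<delta> * \<alpha>i)"
  define a1 where "a1 = C / \<delta> + norm \<alpha> * k1"
  have k01: "k0 > 0" "k1 > 0" "a1 \<ge> 0" using \<delta> \<alpha>i C by (simp_all add: k0_def k1_def a1_def)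
  have "A $$ (m, m) \<le> (k1\<^sup>2 + a1\<^sup>2 + 1) / (2 * k0)" if A: "A \<in> \<Gamma>" and inU: "proj_act (iota m n A) (pp n f) \<in> pp n ` (V \<inter> nz n)" for A
  proof -
    let ?g = "cact m n A f" and ?V = "mv m A (tangent s)" and ?N = "mv m A s"
    note SO = G_SO[OF A]
    have gz: "?g \<in> nz n" by (rule cact_nz[OF SO mn f])
    obtain h where h: "h \<in> V" "h \<in> nz n" "pp n ?g = pp n h" using inU act_pp[OF A] by auto
    then obtain c where c: "c \<noteq> 0" "\<forall>i\<le>n. ?g i = c * h i" using pp_eq_iff gz by blast
    have "norm1 n ?g = norm c * norm1 n h" "D ?g = (norm c)\<^sup>2 * D h"
      using norm1_cong[of n ?g "\<lambda>i. c * h i"] Dcong[of ?g "\<lambda>i. c * h i"] c by (simp_all add: norm1_scale Dscale)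
    moreover have "(norm c)\<^sup>2 * (\<delta> * (norm1 n h)\<^sup>2) \<le> (norm c)\<^sup>2 * D h"
      using h by (intro mult_left_mono) (auto simp: V_def)
    ultimately have le: "\<delta> * (norm1 n ?g)\<^sup>2 \<le> D ?g" by (simp add: power_mult_distrib mult.left_commute)
    have lg: "lor m n ?g i = of_real (?V i) + \<alpha> * of_real (?N i)" if "i \<le> m" for i
    proof -
      have "lor m n ?g i = mv m A (lor m n f) i" by (rule lor_cact[OF mn that])
      also have "mv m A (lor m n f) = mv m A (\<lambda>i. of_real (tangent s i) + \<alpha> * of_real (s i))"
        by (rule mv_cong) (rule frame)
      finally show ?thesis by (simp add: mv_add mv_scale mv_of_real)
    qed
    define k a where "k = ?N m" and "a = ?V m"
    have k: "k > 0" unfolding k_def by (rule mv_nullray_pos[OF SO s])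
    have VN: "lp 2 ?V ?V = 1" "lp 2 ?N ?N = 0" "lp 2 ?V ?N = 0" "0 < ?N 2"
      using lp_mv[OF SO, of "tangent s" "tangent s"] lp_mv[OF SO, of s s] lp_mv[OF SO, of "tangent s" s] lp_tangent[of s] nullrayD(2)[OF s] s k unfolding m_eq k_def by simp_all
    have prg: "pairing m n x ?g = of_real (lp m x ?V) + \<alpha> * of_real (lp m x ?N)" for x by (rule pairing_frame[OF lg])
    have "D ?g = \<alpha>i * \<bar>lp m p ?V * lp m q ?N - lp m p ?N * lp m q ?V\<bar>"
      unfolding D_def prg \<alpha>i_def abs_mult[symmetric] by (simp add: algebra_simps)
    also have "\<dots> \<le> \<alpha>i * (C * k)"
    proof (rule mult_left_mono)
      have "\<bar>lp m p ?V * lp m q ?N - lp m p ?N * lp m q ?V\<bar> \<le> (C - 1) * k"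
        using lp_minor_bound[OF VN, of p q] unfolding m_eq C_def k_def by simp
      also have "\<dots> \<le> C * k" using k by (intro mult_right_mono) auto
      finally show "\<bar>lp m p ?V * lp m q ?N - lp m p ?N * lp m q ?V\<bar> \<le> C * k" .
    qed (use \<alpha>i in simp)
    finally have le2: "\<delta> * (norm1 n ?g)\<^sup>2 \<le> \<alpha>i * C * k" using le by simp
    have gn: "norm (of_real a + \<alpha> * of_real k) \<le> norm1 n ?g"
    proof -
      have "?g n = of_real a + \<alpha> * of_real k" using lg[of m] by (simp add: lor_def a_def k_def)
      then show ?thesis using norm_le_norm1[of n n ?g] by simp
    qed
    \<comment> \<open>The real part of the image's Lorentz part is a unit spacelike vector, whose
      spatial length is at least 1.\<close>
    have N1: "1 \<le> norm1 n ?g"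
    proof -
      let ?W = "\<lambda>i. ?V i + Re \<alpha> * ?N i"
      have "lp 2 ?W ?W = 1" using VN lp_commute[of 2 ?N ?V] by (simp add: lp_linear)
      then have W: "1 \<le> (?W 0)\<^sup>2 + (?W 1)\<^sup>2" by (simp add: lp2 power2_eq_square) (smt (verit) zero_le_square)
      have wi: "\<bar>?W i\<bar> \<le> norm (?g i)" if "i < 2" for i
      proof -
        have "Re (?g i) = ?W i" using lg[of i] that m_eq by (simp add: lor_def)
        then show ?thesis using abs_Re_le_cmod[of "?g i"] by simp
      qed
      have "1 \<le> (\<bar>?W 0\<bar> + \<bar>?W 1\<bar>)\<^sup>2"
      proof -
        have "0 \<le> 2 * (\<bar>?W 0\<bar> * \<bar>?W 1\<bar>)" by simp
        then show ?thesis using W by (simp add: power2_sum del: mult_nonneg_nonneg)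
      qed
      then have "1\<^sup>2 \<le> (\<bar>?W 0\<bar> + \<bar>?W 1\<bar>)\<^sup>2" by simp
      then have "1 \<le> \<bar>?W 0\<bar> + \<bar>?W 1\<bar>" by (rule power2_le_imp_le) simp
      also have "\<dots> \<le> norm (?g 0) + norm (?g 1)" by (intro add_mono wi) auto
      also have "\<dots> \<le> norm1 n ?g" using sum_le_norm1[OF n2, of ?g] norm_ge_zero[of "?g n"] 
        by (simp del: norm_ge_zero add: eval_nat_numeral)
      finally show ?thesis .
    qed
    have "\<delta> * 1\<^sup>2 \<le> \<delta> * (norm1 n ?g)\<^sup>2" using \<delta> N1 by (intro mult_left_mono power_mono) auto
    then have "\<delta> \<le> \<alpha>i * C * k" using le2 by simp
    then have kk0: "k0 \<le> k" unfolding k0_def using \<alpha>i C by (simp add: pos_divide_le_eq mult_ac)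
    have "\<alpha>i * k = \<bar>Im (of_real a + \<alpha> * of_real k)\<bar>" using k by (simp add: \<alpha>i_def abs_mult)
    also have "\<dots> \<le> norm1 n ?g" using abs_Im_le_cmod gn order_trans by blast
    finally have ak: "\<alpha>i * k \<le> norm1 n ?g" .
    have "\<delta> * norm1 n ?g * (\<alpha>i * k) \<le> \<delta> * norm1 n ?g * norm1 n ?g"
      using ak \<delta> N1 by (intro mult_left_mono) auto
    also have "\<dots> \<le> C * (\<alpha>i * k)" using le2 by (simp add: power2_eq_square mult_ac)
    finally have NC: "\<delta> * norm1 n ?g \<le> C" using \<alpha>i k by simp
    then have NC': "norm1 n ?g \<le> C / \<delta>" using \<delta> by (simp add: pos_le_divide_eq mult.commute)
    then have "\<alpha>i * k \<le> C / \<delta>" using ak by simp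
    then have kk1: "k \<le> k1" unfolding k1_def using \<alpha>i \<delta> by (simp add: field_simps)
    have "\<bar>a\<bar> \<le> norm (of_real a + \<alpha> * of_real k) + norm (\<alpha> * of_real k)"
      using norm_triangle_ineq4[of "of_real a + \<alpha> * of_real k" "\<alpha> * of_real k"] by simp
    also have "\<dots> \<le> C / \<delta> + norm \<alpha> * k1"
      using gn NC' kk1 k by (intro add_mono) (auto simp: norm_mult intro!: mult_left_mono)
    finally have aa: "\<bar>a\<bar> \<le> a1" by (simp add: a1_def)
    have "A $$ (m, m) = (k\<^sup>2 + a\<^sup>2 + 1) / (2 * k)"
      using frame_estimate[of A s] SO s unfolding m_eq k_def a_def by simp
    also have "\<dots> \<le> (k1\<^sup>2 + a1\<^sup>2 + 1) / (2 * k0)"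
    proof (rule frac_le)
      have "k\<^sup>2 \<le> k1\<^sup>2" using kk1 k by (intro power_mono) auto
      moreover have "a\<^sup>2 \<le> a1\<^sup>2" using aa k01 abs_le_square_iff[of a a1] by simp
      ultimately show "k\<^sup>2 + a\<^sup>2 + 1 \<le> k1\<^sup>2 + a1\<^sup>2 + 1" by simp
    qed (use kk0 k01 in auto)
    finally show ?thesis .
  qed
  then have "{g \<in> GG. proj_act g (pp n f) \<in> pp n ` (V \<inter> nz n)} \<subseteq> iota m n ` {A \<in> \<Gamma>. A $$ (m, m) \<le> (k1\<^sup>2 + a1\<^sup>2 + 1) / (2 * k0)}"
    by blast
  then have "finite {g \<in> GG. proj_act g (pp n f) \<in> pp n ` (V \<inter> nz n)}"
    using finite_bounded finite_subset by blast
  moreover have "pp n f' \<in> pp n ` (V \<inter> nz n)" using f' \<delta> by (auto simp: V_def)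
  ultimately show ?thesis using U by blast
qed

text \<open>A nonreal point outside \<open>Om0\<close> can be rescaled to the form tangent +
  \<alpha> s: a vanishing tangential coefficient or a real \<alpha> would make it real.\<close>

lemma finite_meeting_not_real:
  assumes f: "f \<in> nz n" "\<not> realish m n f" and f': "f' \<in> nz n" "\<not> realish m n f'"
  shows "\<exists>U. openin X U \<and> pp n f' \<in> U \<and> finite {g \<in> GG. proj_act g (pp n f) \<in> U}"
proof (cases "f \<in> Om0 m n")
  case True
  then show ?thesis using finite_meeting_Om0 f' by blast
next
  case False
  then obtain s where s: "s \<in> nullray m" "pairing m n s f = 0" by (auto simp: Om0_def)
  obtain \<rho> where \<rho>: "\<forall>i\<le>m. lor m n f i = \<rho> * of_real (tangent s i) + f n * of_real (s i)"
    using null_perp_normal_form[OF n2, of s f] s unfolding m_eq by blast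
  have pairing_f: "pairing m n x f = \<rho> * of_real (lp m x (tangent s)) + f n * of_real (lp m x s)" for x
  proof -
    have "pairing m n x f = lp m (\<lambda>i. of_real (x i)) (\<lambda>i. \<rho> * of_real (tangent s i) + f n * of_real (s i))"
      unfolding pairing_def using \<rho> by (intro lp_cong) auto
    then show ?thesis by (simp add: lp_linear lp_of_real)
  qed
  have \<rho>0: "\<rho> \<noteq> 0"
  proof
    assume "\<rho> = 0"
    then have "realish m n f" unfolding realish_def pairing_f by simp
    then show False using f by simp
  qed
  have im: "Im (f n / \<rho>) \<noteq> 0"
  proof
    assume 0: "Im (f n / \<rho>) = 0"
    then have "f n / \<rho> = of_real (Re (f n / \<rho>))" by (simp add: complex_eq_iff)
    then have fn: "f n = \<rho> * of_real (Re (f n / \<rho>))" using \<rho>0 by (metis nonzero_mult_div_cancel_left times_divide_eq_right)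
    have "pairing m n x f = \<rho> * of_real (lp m x (tangent s) + Re (f n / \<rho>) * lp m x s)" for x
      unfolding pairing_f by (subst fn) (simp add: algebra_simps)
    then have "realish m n f" unfolding realish_def Im_cnj_scale by (simp add: Im_cnj_scale del: of_real_add complex_cnj_mult)
    then show False using f by simp
  qed
  let ?f = "\<lambda>i. 1 / \<rho> * f i"
  have "?f \<in> nz n" using f \<rho>0 by (auto simp: nz_def)
  moreover have "lor m n ?f i = of_real (tangent s i) + f n / \<rho> * of_real (s i)" if "i \<le> m" for i
  proof -
    have "lor m n ?f i = 1 / \<rho> * lor m n f i" by (simp add: lor_def)
    then show ?thesis using \<rho> that \<rho>0 by (simp add: field_simps)
  qed
  ultimately have "\<exists>U. openin X U \<and> pp n f' \<in> U \<and> finite {g \<in> GG. proj_act g (pp n ?f) \<in> U}"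
    by (intro finite_meeting_frame[OF s(1) im _ _ f'])
  moreover have "pp n ?f = pp n f" using \<rho>0 f by (intro pp_scale) auto
  ultimately show ?thesis by simp
qed

lemma L0_subset_real_locus: "L0 \<subseteq> real_locus"
  unfolding kulkarni_L0_def
proof (rule closure_of_minimal[OF _ closedin_real_locus], rule subsetI, rule ccontr)
  fix x assume x: "x \<in> {x \<in> topspace X. infinite {g \<in> GG. proj_act g x = x}}" "x \<notin> real_locus"
  then obtain f where f: "f \<in> nz n" "x = pp n f" by (auto simp: topspace_proj_pp)
  then have "\<not> realish m n f" using x pp_in_real_locus_iff by blast
  from finite_meeting_not_real[OF f(1) this f(1) this] obtain U where
    U: "pp n f \<in> U" "finite {g \<in> GG. proj_act g x \<in> U}" using f by blast
  have "{g \<in> GG. proj_act g x = x} \<subseteq> {g \<in> GG. proj_act g x \<in> U}" using U f by auto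
  then show False using U x finite_subset by blast
qed

text \<open>Together with the inclusion of L_0, this makes every compact set of nonreal points
  admissible in the definition of L_2.\<close>

lemma L1_subset_real_locus: "L1 \<subseteq> real_locus"
  unfolding kulkarni_L1_def
proof (rule closure_of_minimal[OF _ closedin_real_locus], rule subsetI, rule ccontr)
  fix y assume "y \<in> (\<Union>z\<in>topspace X - L0. X derived_set_of (\<lambda>g. proj_act g z) ` GG)" and y: "y \<notin> real_locus"
  then obtain z where z: "z \<in> topspace X" and d: "y \<in> X derived_set_of (\<lambda>g. proj_act g z) ` GG" by blast
  have "y \<in> topspace X" by (rule subsetD[OF derived_set_of_subset_topspace d])
  then obtain f' where f': "f' \<in> nz n" "y = pp n f'" by (auto simp: topspace_proj_pp)
  then have r': "\<not> realish m n f'" using y pp_in_real_locus_iff by blast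
  show False
  proof (cases "z \<in> real_locus")
    case True
    then have "(\<lambda>g. proj_act g z) ` GG \<subseteq> real_locus" using act_real_locus by blast
    then have "X derived_set_of (\<lambda>g. proj_act g z) ` GG \<subseteq> real_locus"
      using derived_set_of_mono[of "(\<lambda>g. proj_act g z) ` GG" real_locus X]
        closedin_contains_derived_set[of X real_locus] closedin_real_locus by blast
    then show False using d y by blast
  next
    case False
    obtain f where f: "f \<in> nz n" "z = pp n f" using z by (auto simp: topspace_proj_pp)
    then have "\<not> realish m n f" using False pp_in_real_locus_iff by blast
    from finite_meeting_not_real[OF f(1) this f'(1) r'] obtain U where
      U: "openin X U" "y \<in> U" "finite {g \<in> GG. proj_act g z \<in> U}" using f f' by blast
    have "(\<lambda>g. proj_act g z) ` GG \<inter> U \<subseteq> (\<lambda>g. proj_act g z) ` {g \<in> GG. proj_act g z \<in> U}" by blast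
    then have "finite ((\<lambda>g. proj_act g z) ` GG \<inter> U)" using U(3) by (meson finite_imageI finite_subset)
    then show False using proj_derived_set_infinite[OF d U(1,2)] by blast
  qed
qed

end

section \<open>Points of tangent hyperplanes as cluster points of compact families\<close>

lemma compact_insert_limit:
  fixes f :: "nat \<Rightarrow> 'a::topological_space"
  assumes "f \<longlonglongrightarrow> l"
  shows "compact (insert l (range f))"
proof (rule compactI)
  fix \<C> :: "'a set set" assume op: "\<forall>t\<in>\<C>. open t" and cov: "insert l (range f) \<subseteq> \<Union>\<C>"
  then obtain U where U: "U \<in> \<C>" "l \<in> U" by blast
  then have "\<forall>\<^sub>F k in sequentially. f k \<in> U" using topological_tendstoD[OF assms] op by blast
  then obtain N where N: "\<And>k. k \<ge> N \<Longrightarrow> f k \<in> U" unfolding eventually_sequentially by blast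
  have "\<forall>k. \<exists>V\<in>\<C>. f k \<in> V" using cov by blast
  then obtain V where V: "\<And>k. V k \<in> \<C>" "\<And>k. f k \<in> V k" by metis
  have "insert l (range f) \<subseteq> \<Union>(insert U (V ` {..<N}))"
  proof
    fix x assume "x \<in> insert l (range f)"
    then consider "x = l" | k where "x = f k" by blast
    then show "x \<in> \<Union>(insert U (V ` {..<N}))"
    proof cases
      case (2 k)
      then show ?thesis using N[of k] V(2)[of k] by (cases "k < N") auto
    qed (use U in simp)
  qed
  moreover have "insert U (V ` {..<N}) \<subseteq> \<C>" using U V by blast
  ultimately show "\<exists>\<C>'\<subseteq>\<C>. finite \<C>' \<and> insert l (range f) \<subseteq> \<Union>\<C>'"
    by (intro exI[of _ "insert U (V ` {..<N})"]) simp
qed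

lemma not_realish_nz: "m \<le> n \<Longrightarrow> \<not> realish m n f \<Longrightarrow> f \<in> nz n"
proof (rule ccontr)
  assume *: "m \<le> n" "\<not> realish m n f" "f \<notin> nz n"
  then have "lor m n f i = 0" for i by (auto simp: lor_def nz_def)
  then have "pairing m n p f = 0" for p by (simp add: pairing_def lp_def)
  then show False using * by (simp add: realish_def)
qed

context kulkarni_plane
begin

text \<open>In Lorentz coordinates f = v + \<sigma> e with \<open>v\<close> orthogonal to both fixed
  rays. The points z_k = v + \<sigma> \<kappa>^(-k) e + \<i> e' converge, and the k-th power of
  \<open>A\<close> sends z_k to the image of \<open>v\<close> plus \<sigma> e plus a vanishing
  multiple of e'; along recurrent powers this tends to \<open>f\<close>.\<close>

lemma generic_in_L2:
  assumes lox: "lox A e e'" and ne: "e \<noteq> e'" and \<alpha>: "Im \<alpha> \<noteq> 0" and f: "f \<in> nz n"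
    and frame: "\<And>i. i \<le> m \<Longrightarrow> lor m n f i = of_real (tangent e i) + \<alpha> * of_real (e i)"
  shows "pp n f \<in> L2"
proof -
  from lox obtain \<kappa> \<kappa>' where A: "A \<in> \<Gamma>" and e: "e \<in> nullray m" "\<kappa> > 1" "mv m A e = (\<lambda>i. \<kappa> * e i)"
    and e': "e' \<in> nullray m" "\<kappa>' > 1" "mv m (adj m A) e' = (\<lambda>i. \<kappa>' * e' i)" unfolding lox_def by blast
  have e'A: "mv m A e' = (\<lambda>i. 1 / \<kappa>' * e' i)"
    using mv_adj_eigen(2)[OF G_SO[OF G_adj[OF A]] e'(1,3)] adj_adj[OF G_mat[OF A]] by simp
  have D: "lp m e e' \<noteq> 0" using nullray_lp_eq_0[OF e(1) e'(1)] ne by blast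
  have tang: "lp m (tangent e) (tangent e) = 1" "lp m (tangent e) e = 0" "lp m e (tangent e) = 0"
    using lp_tangent[of e] e(1) lp_commute[of m e "tangent e"] m_eq by simp_all
  define \<rho> where "\<rho> = - lp m e' (tangent e) / lp m e e'"
  define v where "v = (\<lambda>i. tangent e i + \<rho> * e i)"
  have ve: "lp m e v = 0" "lp m e' v = 0" "lp m v v = 1" "lp m v e = 0" "lp m v e' = 0"
  proof -
    show 1: "lp m e v = 0" unfolding v_def lp_linear using tang nullrayD(2)[OF e(1)] by simp
    show 2: "lp m e' v = 0" unfolding v_def lp_linear \<rho>_def using D lp_commute[of m e' e] by simp
    show "lp m v v = 1" unfolding v_def lp_linear using tang nullrayD(2)[OF e(1)] by simp
    show "lp m v e = 0" "lp m v e' = 0" using 1 2 lp_commute[of m v e] lp_commute[of m v e'] by simp_all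
  qed
  define \<sigma> where "\<sigma> = \<alpha> - of_real \<rho>"
  define u where "u = (\<lambda>c t i. complex_of_real (v i) + c * of_real (e i) + t * of_real (e' i))"
  define G where "G = (\<lambda>c t i. if i < m then u c t i else if i = n then u c t m else f i)"
  have lorG: "lor m n (G c t) i = u c t i" if "i \<le> m" for c t i
    using that mn by (auto simp: lor_def G_def)
  have prG: "pairing m n x (G c t) = of_real (lp m x v) + c * of_real (lp m x e) + t * of_real (lp m x e')" for x c t
  proof -
    have "pairing m n x (G c t) = lp m (\<lambda>i. of_real (x i)) (u c t)"
      unfolding pairing_def by (rule lp_cong) (simp_all add: lorG)
    then show ?thesis unfolding u_def by (simp add: lp_linear lp_of_real)
  qed
  \<comment> \<open>Pairing with \<open>v\<close> gives 1, pairing with \<open>e\<close> gives \<i>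
    times \<open>lp m e e'\<close>. The term \<i> e' is there to keep the whole sequence, including
    its limit, off the real points.\<close>
  have nr: "\<not> realish m n (G c \<i>)" for c
  proof
    assume "realish m n (G c \<i>)"
    then have "Im (cnj (pairing m n v (G c \<i>)) * pairing m n e (G c \<i>)) = 0" unfolding realish_def by blast
    then show False unfolding prG using ve D nullrayD(2)[OF e(1)] by simp
  qed
  have Gnz: "G c \<i> \<in> nz n" for c by (rule not_realish_nz[OF mn nr])
  have Gf: "G \<sigma> 0 = f"
  proof
    fix i
    have "u \<sigma> 0 j = lor m n f j" if "j \<le> m" for j
      using frame[OF that] by (simp add: u_def v_def \<sigma>_def algebra_simps)
    then show "G \<sigma> 0 i = f i" by (simp add: G_def lor_def)
  qed
  define z where "z = (\<lambda>k. G (\<sigma> * of_real ((1 / \<kappa>) ^ k)) \<i>)"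
  have pow0: "(\<lambda>k. complex_of_real ((1 / \<kappa>) ^ k)) \<longlonglongrightarrow> of_real 0" "(\<lambda>k. (1 / \<kappa>') ^ k) \<longlonglongrightarrow> 0"
    using e(2) e'(2) by (intro tendsto_of_real LIMSEQ_realpow_zero; simp)+
  have zlim: "z \<longlonglongrightarrow> G 0 \<i>"
    unfolding tendsto_fun_iff
  proof
    fix i
    have "(\<lambda>k. u (\<sigma> * of_real ((1 / \<kappa>) ^ k)) \<i> j) \<longlonglongrightarrow> u (\<sigma> * of_real 0) \<i> j" for j
      unfolding u_def by (intro tendsto_add tendsto_mult tendsto_const pow0)
    then show "(\<lambda>k. z k i) \<longlonglongrightarrow> G 0 \<i> i" unfolding z_def G_def by simp
  qed
  define K where "K = pp n ` insert (G 0 \<i>) (range z)"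
  have zr: "\<not> realish m n y \<and> y \<in> nz n" if "y \<in> insert (G 0 \<i>) (range z)" for y
    using that nr Gnz by (auto simp: z_def)
  have "compactin X K" unfolding K_def by (rule compactin_pp[OF compact_insert_limit[OF zlim]]) (use zr in blast)
  moreover have "K \<subseteq> topspace X - (L0 \<union> L1)"
  proof
    fix x assume "x \<in> K"
    then obtain y where y: "x = pp n y" "\<not> realish m n y" "y \<in> nz n" unfolding K_def using zr by blast
    then have "x \<notin> real_locus" "x \<in> topspace X" using pp_in_real_locus_iff by auto
    then show "x \<in> topspace X - (L0 \<union> L1)" using L0_subset_real_locus L1_subset_real_locus by blast
  qed
  moreover have "pp n f \<in> cluster_points X GG (\<lambda>g. proj_act g ` K)"
  proof -
    obtain \<phi> where \<phi>: "\<And>k. k \<le> \<phi> k" "\<And>i. i \<le> m \<Longrightarrow> (\<lambda>k. mv m (A ^\<^sub>m \<phi> k) v i) \<longlonglongrightarrow> v i"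
      using recurrent_powers[OF lox ne ve(1,2) ve(1,2)] by blast
    have \<phi>top: "filterlim \<phi> sequentially sequentially"
      by (rule filterlim_at_top_mono[OF filterlim_ident]) (use \<phi>(1) in auto)
    have mvz: "lor m n (cact m n (A ^\<^sub>m k) (z k)) i
        = of_real (mv m (A ^\<^sub>m k) v i) + \<sigma> * of_real (e i) + \<i> * of_real ((1 / \<kappa>') ^ k) * of_real (e' i)" if "i \<le> m" for k i
    proof -
      have "lor m n (cact m n (A ^\<^sub>m k) (z k)) i = mv m (A ^\<^sub>m k) (lor m n (z k)) i" by (rule lor_cact[OF mn that])
      also have "mv m (A ^\<^sub>m k) (lor m n (z k)) = mv m (A ^\<^sub>m k) (u (\<sigma> * of_real ((1 / \<kappa>) ^ k)) \<i>)"
        by (rule mv_cong) (simp add: z_def lorG)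
      also have "\<dots> i = of_real (mv m (A ^\<^sub>m k) v i) + \<sigma> * of_real ((1 / \<kappa>) ^ k) * of_real (mv m (A ^\<^sub>m k) e i)
          + \<i> * of_real (mv m (A ^\<^sub>m k) e' i)"
        unfolding u_def by (simp only: mv_add mv_scale mv_of_real)
      also have "mv m (A ^\<^sub>m k) e i = \<kappa> ^ k * e i" using mv_pow_eigen[OF A e(1,3), of k] by simp
      also have "mv m (A ^\<^sub>m k) e' i = (1 / \<kappa>') ^ k * e' i" using mv_pow_eigen[OF A e'(1) e'A, of k] by simp
      also have "\<sigma> * of_real ((1 / \<kappa>) ^ k) * complex_of_real (\<kappa> ^ k * e i) = \<sigma> * of_real (e i)"
        using e(2) by (simp add: power_divide)
      finally show ?thesis by simp
    qed
    have Flim: "(\<lambda>k. cact m n (A ^\<^sub>m \<phi> k) (z (\<phi> k))) \<longlonglongrightarrow> f"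
      unfolding tendsto_fun_iff
    proof
      fix i
      have lim: "(\<lambda>k. lor m n (cact m n (A ^\<^sub>m \<phi> k) (z (\<phi> k))) j) \<longlonglongrightarrow> lor m n f j" if "j \<le> m" for j
      proof -
        have inv0: "(\<lambda>k. (1 / \<kappa>') ^ \<phi> k) \<longlonglongrightarrow> 0"
          by (rule filterlim_compose[OF pow0(2) \<phi>top])
        have "(\<lambda>k. of_real (mv m (A ^\<^sub>m \<phi> k) v j) + \<sigma> * of_real (e j) + \<i> * of_real ((1 / \<kappa>') ^ \<phi> k) * of_real (e' j))
            \<longlonglongrightarrow> of_real (v j) + \<sigma> * of_real (e j) + \<i> * of_real 0 * of_real (e' j)"
          by (intro tendsto_add tendsto_mult tendsto_const tendsto_of_real \<phi>(2)[OF that] inv0)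
        moreover have "of_real (v j) + \<sigma> * of_real (e j) + \<i> * of_real 0 * of_real (e' j) = lor m n f j"
          using lorG[OF that, of \<sigma> 0] unfolding Gf by (simp add: u_def)
        ultimately show ?thesis unfolding mvz[OF that] by simp
      qed
      consider "i < m" | "i = n" "\<not> i < m" | "\<not> i < m" "i \<noteq> n" by blast
      then show "(\<lambda>k. cact m n (A ^\<^sub>m \<phi> k) (z (\<phi> k)) i) \<longlonglongrightarrow> f i"
      proof cases
        case 1
        then show ?thesis using lim[of i] by (simp add: lor_def)
      next
        case 2
        then show ?thesis using lim[of m] by (simp add: lor_def)
      next
        case 3
        then show ?thesis by (simp add: cact_def z_def G_def)
      qed
    qed
    show ?thesis
      unfolding cluster_points_def
    proof (intro CollectI conjI allI impI)
      show "pp n f \<in> topspace X" using f by blast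
      fix U assume U: "openin X U \<and> pp n f \<in> U"
      then have "\<forall>\<^sub>F k in sequentially. pp n (cact m n (A ^\<^sub>m \<phi> k) (z (\<phi> k))) \<in> U"
        using limitinD[OF limitin_proj_space[OF Flim f]] by blast
      then obtain N where N: "\<And>k. k \<ge> N \<Longrightarrow> pp n (cact m n (A ^\<^sub>m \<phi> k) (z (\<phi> k))) \<in> U"
        unfolding eventually_sequentially by blast
      let ?S = "{g \<in> GG. U \<inter> proj_act g ` K \<noteq> {}}"
      have mem: "iota m n (A ^\<^sub>m \<phi> k) \<in> ?S" if "k \<ge> N" for k
      proof -
        have "pp n (z (\<phi> k)) \<in> K" by (simp add: K_def)
        then have "pp n (cact m n (A ^\<^sub>m \<phi> k) (z (\<phi> k))) \<in> proj_act (iota m n (A ^\<^sub>m \<phi> k)) ` K"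
          using act_pp[OF G_pow[OF A]] by (metis imageI)
        then show ?thesis using N[OF that] G_pow[OF A] by blast
      qed
      show "infinite ?S"
      proof
        assume "finite ?S"
        then have "finite ((\<lambda>k. iota m n (A ^\<^sub>m k)) -` ?S)"
          by (rule finite_vimageI[OF _ pow_iota_inj[OF lox]])
        then obtain M where M: "\<And>k. iota m n (A ^\<^sub>m k) \<in> ?S \<Longrightarrow> k < M"
          unfolding finite_nat_set_iff_bounded by auto
        have "\<phi> (max N M) < M" by (rule M[OF mem]) simp
        then show False using \<phi>(1)[of "max N M"] by simp
      qed
    qed
  qed
  ultimately have "pp n f \<in> (\<Union>K\<in>{K. compactin X K \<and> K \<subseteq> topspace X - (L0 \<union> L1)}. cluster_points X GG (\<lambda>g. proj_act g ` K))"
    by blast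
  moreover have "(\<Union>K\<in>{K. compactin X K \<and> K \<subseteq> topspace X - (L0 \<union> L1)}. cluster_points X GG (\<lambda>g. proj_act g ` K)) \<subseteq> L2"
    unfolding kulkarni_L2_def by (intro closure_of_subset UN_least) (auto simp: cluster_points_def)
  ultimately show ?thesis by blast
qed

text \<open>L_2 is closed, so \<open>f\<close> may be approximated: \<open>s\<close> by attracting
  rays of loxodromic elements, and the coefficients by generic ones. Any second ray distinct from
  \<open>s\<close> serves for the density statement; the antipode is one.\<close>

lemma null_perp_in_L2:
  assumes f: "f \<in> nz n" and s: "s \<in> nullray m" and pairing0: "pairing m n s f = 0"
  shows "pp n f \<in> L2"
proof -
  obtain \<rho> where \<rho>: "\<And>i. i \<le> m \<Longrightarrow> lor m n f i = \<rho> * of_real (tangent s i) + f n * of_real (s i)"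
    using null_perp_normal_form[OF n2, of s f] s pairing0 unfolding m_eq by blast
  let ?q = "antipode m s"
  have q: "?q \<in> nullray m" by (rule antipode_nullray[OF s])
  have sq: "lp m s ?q \<noteq> 0" "s \<noteq> ?q"
    using lp_antipode[of s m s] nullrayD[OF s] by auto
  obtain A e e' where lox: "\<And>k. lox (A k) (e k) (e' k)"
    and es: "\<And>i. (\<lambda>k. e k i) \<longlonglongrightarrow> s i" and eq: "\<And>i. (\<lambda>k. e' k i) \<longlonglongrightarrow> ?q i"
    using lox_near_seq[OF lox_dense[OF s q sq(2)]] by blast
  have en: "e k \<in> nullray m" "e' k \<in> nullray m" for k using lox[of k] by (simp_all add: lox_def)
  have "(\<lambda>k. lp m (e k) (e' k)) \<longlonglongrightarrow> lp m s ?q" by (intro tendsto_intros es eq)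
  then have ne: "\<forall>\<^sub>F k in sequentially. lp m (e k) (e' k) \<noteq> 0" using tendsto_imp_eventually_ne sq(1) by blast
  define \<epsilon> where "\<epsilon> = (\<lambda>k. inverse (real (Suc k)))"
  have \<epsilon>: "\<epsilon> \<longlonglongrightarrow> 0" "\<And>k. \<epsilon> k > 0" unfolding \<epsilon>_def by (rule LIMSEQ_inverse_real_of_nat) simp
  \<comment> \<open>A vanishing tangential coefficient is replaced by small positive numbers, so
    that dividing by it is possible.\<close>
  define r where "r = (\<lambda>k. if \<rho> = 0 then of_real (\<epsilon> k) else \<rho>)"
  \<comment> \<open>The sign of the correction agrees with the imaginary part to be corrected, so
    the two cannot cancel.\<close>
  define \<tau> where "\<tau> = (\<lambda>k. if Im (f n / r k) \<ge> 0 then 1 else - 1 :: real)"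
  define \<beta> where "\<beta> = (\<lambda>k. f n + \<i> * r k * of_real (\<tau> k * \<epsilon> k))"
  have r0: "r k \<noteq> 0" for k using \<epsilon>(2)[of k] by (simp add: r_def)
  have rlim: "r \<longlonglongrightarrow> \<rho>"
  proof (cases "\<rho> = 0")
    case True
    have "(\<lambda>k. complex_of_real (\<epsilon> k)) \<longlonglongrightarrow> of_real 0" by (intro tendsto_of_real \<epsilon>)
    then show ?thesis using True by (simp add: r_def)
  qed (simp add: r_def)
  have "(\<lambda>k. \<tau> k * \<epsilon> k) \<longlonglongrightarrow> 0"
    by (rule tendsto_rabs_zero_cancel, rule tendsto_sandwich[OF _ _ tendsto_const \<epsilon>(1)])
      (use \<epsilon>(2) in \<open>auto simp: \<tau>_def abs_mult less_imp_le intro!: always_eventually\<close>)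
  then have "(\<lambda>k. complex_of_real (\<tau> k * \<epsilon> k)) \<longlonglongrightarrow> of_real 0" by (rule tendsto_of_real)
  then have "\<beta> \<longlonglongrightarrow> f n + \<i> * \<rho> * of_real 0"
    unfolding \<beta>_def by (intro tendsto_add tendsto_mult tendsto_const rlim)
  then have \<beta>lim: "\<beta> \<longlonglongrightarrow> f n" by simp
  have im: "Im (\<beta> k / r k) \<noteq> 0" for k
  proof -
    have "\<beta> k / r k = f n / r k + \<i> * of_real (\<tau> k * \<epsilon> k)" using r0[of k] by (simp add: \<beta>_def add_divide_distrib)
    then have "Im (\<beta> k / r k) = Im (f n / r k) + \<tau> k * \<epsilon> k" by simp
    then show ?thesis using \<epsilon>(2)[of k] by (auto simp: \<tau>_def split: if_splits)
  qed
  define F where "F = (\<lambda>k i. if i < m then r k * of_real (tangent (e k) i) + \<beta> k * of_real (e k i) else if i = n then \<beta> k else f i)"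
  have Flim: "F \<longlonglongrightarrow> f"
    unfolding tendsto_fun_iff
  proof
    fix i
    consider "i < m" | "i = n" "\<not> i < m" | "\<not> i < m" "i \<noteq> n" by blast
    then show "(\<lambda>k. F k i) \<longlonglongrightarrow> f i"
    proof cases
      case 1
      have "(\<lambda>k. tangent (e k) i) \<longlonglongrightarrow> tangent s i"
        unfolding tangent_def by (cases "i = 0"; cases "i = 1") (auto intro: es tendsto_minus)
      then have "(\<lambda>k. r k * of_real (tangent (e k) i) + \<beta> k * of_real (e k i)) \<longlonglongrightarrow> \<rho> * of_real (tangent s i) + f n * of_real (s i)"
        by (intro tendsto_add tendsto_mult rlim \<beta>lim tendsto_of_real es)
      then show ?thesis using \<rho>[of i] 1 by (simp add: F_def lor_def)
    next
      case 2
      then show ?thesis using \<beta>lim by (simp add: F_def)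
    next
      case 3
      then show ?thesis by (simp add: F_def)
    qed
  qed
  have "\<forall>\<^sub>F k in sequentially. F k \<in> nz n" using topological_tendstoD[OF Flim open_nz f] .
  then have "\<forall>\<^sub>F k in sequentially. pp n (F k) \<in> L2"
    using ne
  proof eventually_elim
    case (elim k)
    let ?G = "\<lambda>i. 1 / r k * F k i"
    have "e k \<noteq> e' k" using elim(2) nullrayD(2)[OF en(1), of k] by auto
    moreover have "?G \<in> nz n" using elim(1) r0[of k] by (auto simp: nz_def)
    moreover have "lor m n ?G i = of_real (tangent (e k) i) + \<beta> k / r k * of_real (e k i)" if "i \<le> m" for i
    proof (cases "i < m")
      case True
      then show ?thesis using r0[of k] by (simp add: lor_def F_def add_divide_distrib)
    next
      case False
      then have "i = m" using that by simp
      moreover have "tangent (e k) m = 0" by (simp add: tangent_def m_eq)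
      ultimately show ?thesis using mn nullrayD(1)[OF en(1), of k] by (simp add: lor_def F_def)
    qed
    ultimately have "pp n ?G \<in> L2" by (intro generic_in_L2[OF lox _ im])
    moreover have "pp n ?G = pp n (F k)" using r0[of k] elim(1) by (intro pp_scale) auto
    ultimately show ?case by simp
  qed
  then show ?thesis by (intro closedin_proj_eventually[OF _ Flim f]) (simp_all add: kulkarni_L2_def)
qed

lemma region_eq: "kulkarni_region X GG proj_act = pp n ` Om0 m n"
proof
  show "kulkarni_region X GG proj_act \<subseteq> pp n ` Om0 m n"
  proof
    fix x assume x: "x \<in> kulkarni_region X GG proj_act"
    then obtain f where f: "f \<in> nz n" "x = pp n f" by (auto simp: kulkarni_region_def topspace_proj_pp)
    have "x \<notin> L2" using x by (simp add: kulkarni_region_def kulkarni_limit_set_def)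
    then have "f \<in> Om0 m n" using null_perp_in_L2[OF f(1)] f(2) by (auto simp: Om0_def)
    then show "x \<in> pp n ` Om0 m n" using f by blast
  qed
qed (rule Om0_subset_region)

end

section \<open>The three components\<close>

text \<open>Up to sign, the three minors are the components of the cross product of the real and
  imaginary parts of (f 0, f 1, f n). The inequality says that the normal of their span is timelike;
  \<sigma> = 1 or -1 selects the orientation.\<close>

definition spacelike :: "nat \<Rightarrow> real \<Rightarrow> (nat \<Rightarrow> complex) set" where
  "spacelike n \<sigma> = {f. 0 < \<sigma> * Im (cnj (f 0) * f 1) \<and>
     (Im (cnj (f n) * f 1))\<^sup>2 + (Im (cnj (f 0) * f n))\<^sup>2 < (Im (cnj (f 0) * f 1))\<^sup>2}"

lemma open_spacelike: "open (spacelike n \<sigma>)"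
  unfolding spacelike_def
  by (intro open_Collect_conj open_Collect_less continuous_on_add continuous_on_mult continuous_on_power continuous_on_Im
      continuous_on_cnj continuous_on_component continuous_on_const)

text \<open>Cramer's rule: the real coefficients of \<open>f n\<close> in the basis
  \<open>f 0\<close>, \<open>f 1\<close> are quotients of the minors.\<close>

lemma spacelike_iff:
  "f \<in> spacelike n \<sigma> \<longleftrightarrow> 0 < \<sigma> * Im (cnj (f 0) * f 1) \<and>
    (\<exists>a b::real. a\<^sup>2 + b\<^sup>2 < 1 \<and> f n = of_real a * f 0 + of_real b * f 1)" (is "?l \<longleftrightarrow> ?r")
proof -
  let ?J = "Im (cnj (f 0) * f 1)" and ?P = "Im (cnj (f n) * f 1)" and ?Q = "Im (cnj (f 0) * f n)"
  show ?thesis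
  proof
    assume l: ?l
    then have J: "?J \<noteq> 0" by (auto simp: spacelike_def)
    have re: "?P * Re (f 0) + ?Q * Re (f 1) = ?J * Re (f n)" and im: "?P * Im (f 0) + ?Q * Im (f 1) = ?J * Im (f n)"
      by (simp_all add: algebra_simps)
    have "f n = of_real (?P / ?J) * f 0 + of_real (?Q / ?J) * f 1"
    proof (rule complex_eqI)
      have "Re (of_real (?P / ?J) * f 0 + of_real (?Q / ?J) * f 1) = (?P * Re (f 0) + ?Q * Re (f 1)) / ?J"
        by (simp only: plus_complex.simps times_complex.simps Re_complex_of_real Im_complex_of_real) (simp add: add_divide_distrib)
      then show "Re (f n) = Re (of_real (?P / ?J) * f 0 + of_real (?Q / ?J) * f 1)" unfolding re using J by simp
      have "Im (of_real (?P / ?J) * f 0 + of_real (?Q / ?J) * f 1) = (?P * Im (f 0) + ?Q * Im (f 1)) / ?J"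
        by (simp only: plus_complex.simps times_complex.simps Re_complex_of_real Im_complex_of_real) (simp add: add_divide_distrib)
      then show "Im (f n) = Im (of_real (?P / ?J) * f 0 + of_real (?Q / ?J) * f 1)" unfolding im using J by simp
    qed
    moreover have "(?P / ?J)\<^sup>2 + (?Q / ?J)\<^sup>2 < 1"
    proof -
      have "(?P / ?J)\<^sup>2 + (?Q / ?J)\<^sup>2 = (?P\<^sup>2 + ?Q\<^sup>2) / ?J\<^sup>2" by (simp only: power_divide add_divide_distrib)
      also have "\<dots> < 1" using l J by (simp add: spacelike_def)
      finally show ?thesis .
    qed
    moreover have "0 < \<sigma> * ?J" using l by (simp add: spacelike_def)
    ultimately show ?r by blast
  next
    assume ?r
    then obtain a b :: real where J: "0 < \<sigma> * ?J" and ab: "a\<^sup>2 + b\<^sup>2 < 1" "f n = of_real a * f 0 + of_real b * f 1" by blast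
    have "?P = a * ?J" "?Q = b * ?J" unfolding ab(2) by (simp_all add: algebra_simps)
    then have "?P\<^sup>2 + ?Q\<^sup>2 = (a\<^sup>2 + b\<^sup>2) * ?J\<^sup>2" by (simp only: power_mult_distrib distrib_right)
    also have "\<dots> < 1 * ?J\<^sup>2" using ab J by (intro mult_strict_right_mono) auto
    finally show ?l using J by (simp add: spacelike_def)
  qed
qed

lemma connected_pp_spacelike:
  assumes n: "2 \<le> n"
  shows "connectedin (proj_space n) (pp n ` spacelike n \<sigma>)"
proof -
  \<comment> \<open>\<open>g 0\<close> encodes the disc of coefficients (a, b) as a complex number,
    \<open>g 1\<close> is the quotient f 1 / f 0 in a half-plane, and the other coordinates are
    free; this parameter set is convex.\<close>
  define Q where "Q = {g :: nat \<Rightarrow> complex. norm (g 0) < 1 \<and> 0 < \<sigma> * Im (g 1)}"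
  define \<Phi> where "\<Phi> = (\<lambda>g i. if i = 0 then 1 else if i = 1 then g 1 else if i = n
    then of_real (Re (g 0)) + of_real (Im (g 0)) * g 1 else g i :: complex)"
  have n01: "n \<noteq> 0" "n \<noteq> 1" using n by auto
  have "connected Q"
  proof (rule connected_of_segments)
    fix f g and t :: real assume fg: "f \<in> Q" "g \<in> Q" and t: "0 \<le> t" "t \<le> 1"
    have "norm (of_real (1 - t) * f 0 + of_real t * g 0) \<le> norm (of_real (1 - t) * f 0) + norm (of_real t * g 0)"
      by (rule norm_triangle_ineq)
    also have "\<dots> = (1 - t) * norm (f 0) + t * norm (g 0)"
      using t by (simp only: norm_mult norm_of_real)
    also have "\<dots> < 1"
    proof (cases "t = 0")
      case False
      have "(1 - t) * norm (f 0) \<le> (1 - t) * 1" using fg t by (intro mult_left_mono) (auto simp: Q_def)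
      moreover have "t * norm (g 0) < t * 1" using fg t False by (intro mult_strict_left_mono) (auto simp: Q_def)
      ultimately show ?thesis by simp
    qed (use fg in \<open>simp add: Q_def\<close>)
    finally have "norm (of_real (1 - t) * f 0 + of_real t * g 0) < 1" .
    moreover have "0 < \<sigma> * Im (of_real (1 - t) * f 1 + of_real t * g 1)"
    proof -
      have "\<sigma> * Im (of_real (1 - t) * f 1 + of_real t * g 1) = (1 - t) * (\<sigma> * Im (f 1)) + t * (\<sigma> * Im (g 1))"
        by (simp add: algebra_simps)
      also have "\<dots> > 0"
      proof (cases "t = 0")
        case False
        have pos: "0 < \<sigma> * Im (f 1)" "0 < \<sigma> * Im (g 1)" using fg by (simp_all add: Q_def)
        have "0 \<le> (1 - t) * (\<sigma> * Im (f 1))" by (rule mult_nonneg_nonneg) (use t pos in auto)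
        moreover have "0 < t * (\<sigma> * Im (g 1))" by (rule mult_pos_pos) (use t False pos in auto)
        ultimately show ?thesis by linarith
      qed (use fg in \<open>simp add: Q_def\<close>)
      finally show ?thesis .
    qed
    ultimately show "(\<lambda>i. of_real (1 - t) * f i + of_real t * g i) \<in> Q" by (simp add: Q_def)
  qed
  moreover have "continuous_on Q \<Phi>"
  proof (rule continuous_on_coordinatewise_then_product)
    fix i
    show "continuous_on Q (\<lambda>g. \<Phi> g i)"
      unfolding \<Phi>_def
      by (cases "i = 0"; cases "i = 1"; cases "i = n")
        (simp_all add: continuous_on_component continuous_on_add continuous_on_mult continuous_on_of_real
          continuous_on_Re continuous_on_Im)
  qed
  ultimately have "connected (\<Phi> ` Q)" by (rule connected_continuous_image[rotated])
  moreover have "\<Phi> ` Q \<subseteq> nz n" by (auto simp: nz_def \<Phi>_def)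
  ultimately have con: "connectedin (proj_space n) (pp n ` \<Phi> ` Q)" by (rule connectedin_pp)
  have "\<Phi> g \<in> spacelike n \<sigma>" if "g \<in> Q" for g
  proof -
    have "(Re (g 0))\<^sup>2 + (Im (g 0))\<^sup>2 < 1"
    proof -
      have "(norm (g 0))\<^sup>2 < 1\<^sup>2" using that by (intro power_strict_mono) (auto simp: Q_def)
      then show ?thesis by (simp add: cmod_power2)
    qed
    then show ?thesis unfolding spacelike_iff using that n01 by (auto simp: \<Phi>_def Q_def)
  qed
  moreover have "pp n f \<in> pp n ` \<Phi> ` Q" if f: "f \<in> spacelike n \<sigma>" for f
  proof -
    obtain a b :: real where J: "0 < \<sigma> * Im (cnj (f 0) * f 1)" and ab: "a\<^sup>2 + b\<^sup>2 < 1"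
      "f n = of_real a * f 0 + of_real b * f 1" using f unfolding spacelike_iff by blast
    have f0: "f 0 \<noteq> 0" using J by auto
    then have fz: "f \<in> nz n" by (auto simp: nz_def)
    define g where "g = (\<lambda>i. if i = 0 then Complex a b else f i / f 0)"
    have "Im (f 1 / f 0) = Im (cnj (f 0) * f 1) / (norm (f 0))\<^sup>2"
      by (simp add: Im_divide cmod_power2 algebra_simps)
    then have "0 < \<sigma> * Im (f 1 / f 0)" using J f0 by (simp add: zero_less_divide_iff)
    moreover have "norm (Complex a b) < 1" using ab by (simp add: cmod_def)
    ultimately have "g \<in> Q" by (simp add: Q_def g_def)
    have eq: "\<Phi> g i = 1 / f 0 * f i" for i
      using f0 ab(2) by (simp add: \<Phi>_def g_def field_simps)
    have "pp n (\<Phi> g) = pp n f"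
    proof -
      have "\<Phi> g = (\<lambda>i. 1 / f 0 * f i)" using eq by blast
      then show ?thesis using f0 fz by (simp only:) (rule pp_scale, auto)
    qed
    then show ?thesis using \<open>g \<in> Q\<close> by (metis imageI)
  qed
  ultimately have "pp n ` spacelike n \<sigma> = pp n ` \<Phi> ` Q" by blast
  then show ?thesis using con by simp
qed

lemma spacelike_subset_nz: "spacelike n \<sigma> \<subseteq> nz n"
  by (auto simp: spacelike_def nz_def intro!: exI[of _ 0])

lemma Im_cnj_nonzero_unique:
  assumes "Im (cnj x * y) \<noteq> 0" and "of_real a * x + of_real b * y = (0::complex)"
  shows "a = 0" "b = 0"
proof -
  have r: "a * Re x + b * Re y = 0" and i: "a * Im x + b * Im y = 0" using assms(2) by (simp_all add: complex_eq_iff)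
  have "a * Im (cnj x * y) = (a * Re x + b * Re y) * Im y - (a * Im x + b * Im y) * Re y"
    "b * Im (cnj x * y) = (a * Im x + b * Im y) * Re x - (a * Re x + b * Re y) * Im x"
    by (simp_all add: algebra_simps)
  then show "a = 0" "b = 0" using assms(1) r i by auto
qed

text \<open>The real coefficients of \<open>f n\<close> are unique, so an orthogonal null ray would
  have spatial part (a, b), which is shorter than 1.\<close>

lemma spacelike_subset_Om0: "2 \<le> n \<Longrightarrow> spacelike n \<sigma> \<subseteq> Om0 2 n"
proof
  fix f assume n: "2 \<le> n" and f: "f \<in> spacelike n \<sigma>"
  obtain a b :: real where J: "0 < \<sigma> * Im (cnj (f 0) * f 1)" and ab: "a\<^sup>2 + b\<^sup>2 < 1"
    "f n = of_real a * f 0 + of_real b * f 1" using f unfolding spacelike_iff by blast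
  show "f \<in> Om0 2 n"
    unfolding Om0_def
  proof (intro CollectI ballI notI)
    fix s assume s: "s \<in> nullray 2" and pairing0: "pairing 2 n s f = 0"
    have s1: "s 0 * s 0 + s 1 * s 1 = 1" "s 2 = 1" using nullrayD[OF s] by (simp_all add: lp2)
    have "of_real (s 0) * f 0 + of_real (s 1) * f 1 = f n"
      using pairing0 s1(2) by (simp add: pairing_def lp2 lor_def)
    then have 0: "of_real (s 0 - a) * f 0 + of_real (s 1 - b) * f 1 = 0"
      unfolding ab(2) by (simp add: algebra_simps)
    have J0: "Im (cnj (f 0) * f 1) \<noteq> 0" using J by auto
    have "s 0 = a" "s 1 = b" using Im_cnj_nonzero_unique[OF J0 0] by auto
    then show False using s1 ab by (simp add: power2_eq_square)
  qed
qed

lemma Om0_plane: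
  assumes n: "2 \<le> n"
  shows "pp n ` Om0 2 n = pp n ` timelike 2 n \<union> (pp n ` spacelike n 1 \<union> pp n ` spacelike n (- 1))"
proof
  show "pp n ` Om0 2 n \<subseteq> pp n ` timelike 2 n \<union> (pp n ` spacelike n 1 \<union> pp n ` spacelike n (- 1))"
  proof (rule image_subsetI)
    fix f assume f: "f \<in> Om0 2 n"
    then have fz: "f \<in> nz n" using Om0_subset_nz[of 2 n] n by auto
    from Om0_cases[OF order_refl n f]
    show "pp n f \<in> pp n ` timelike 2 n \<union> (pp n ` spacelike n 1 \<union> pp n ` spacelike n (- 1))"
    proof
      assume "\<exists>c. c \<noteq> 0 \<and> (\<lambda>i. c * f i) \<in> timelike 2 n"
      then obtain c where c: "c \<noteq> 0" "(\<lambda>i. c * f i) \<in> timelike 2 n" by blast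
      then have "pp n f \<in> pp n ` timelike 2 n" using pp_scale[OF c(1) fz] by (metis imageI)
      then show ?thesis by blast
    next
      assume "2 = 2 \<and> (\<exists>a::nat \<Rightarrow> real. (\<Sum>i<2. (a i)\<^sup>2) < 1 \<and> f n = (\<Sum>i<2. of_real (a i) * f i)
        \<and> \<not> (\<exists>c. c \<noteq> 0 \<and> (\<forall>i<2. Im (c * f i) = 0)))"
      then obtain a :: "nat \<Rightarrow> real" where a: "(\<Sum>i<2. (a i)\<^sup>2) < 1" "f n = (\<Sum>i<2. of_real (a i) * f i)"
        and nd: "\<And>c. c \<noteq> 0 \<Longrightarrow> \<exists>i<2. Im (c * f i) \<noteq> 0" by blast
      have a': "(a 0)\<^sup>2 + (a 1)\<^sup>2 < 1" "f n = of_real (a 0) * f 0 + of_real (a 1) * f 1"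
        using a by (simp_all add: eval_nat_numeral)
      have J: "Im (cnj (f 0) * f 1) \<noteq> 0"
      proof
        assume J0: "Im (cnj (f 0) * f 1) = 0"
        \<comment> \<open>When the determinant vanishes, the conjugate of a nonzero coordinate makes
          both coordinates real.\<close>
        define c where "c = (if f 0 \<noteq> 0 then cnj (f 0) else if f 1 \<noteq> 0 then cnj (f 1) else 1)"
        have "c \<noteq> 0" by (simp add: c_def)
        moreover have "Im (c * f i) = 0" if "i < 2" for i
        proof -
          have "i = 0 \<or> i = 1" using that by auto
          then show ?thesis using J0 by (auto simp: c_def)
        qed
        ultimately show False using nd by blast
      qed
      then consider "0 < 1 * Im (cnj (f 0) * f 1)" | "0 < - 1 * Im (cnj (f 0) * f 1)" by linarith
      then show ?thesis
      proof cases
        case 1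
        then have "f \<in> spacelike n 1" unfolding spacelike_iff using a' by blast
        then show ?thesis by blast
      next
        case 2
        then have "f \<in> spacelike n (- 1)" unfolding spacelike_iff using a' by blast
        then show ?thesis by blast
      qed
    qed
  qed
  show "pp n ` timelike 2 n \<union> (pp n ` spacelike n 1 \<union> pp n ` spacelike n (- 1)) \<subseteq> pp n ` Om0 2 n"
    using timelike_subset_Om0[OF n] spacelike_subset_Om0[OF n] by blast
qed

text \<open>Rescaling by c multiplies the orientation determinant by |c|^2, so its sign is a
  projective invariant.\<close>

lemma spacelike_disjoint:
  assumes n: "2 \<le> n"
  shows "disjnt (pp n ` spacelike n 1) (pp n ` spacelike n (- 1))"
  unfolding disjnt_iff
proof (intro allI notI)
  fix x assume "x \<in> pp n ` spacelike n 1 \<and> x \<in> pp n ` spacelike n (- 1)"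
  then obtain f g where fg: "f \<in> spacelike n 1" "g \<in> spacelike n (- 1)" "pp n f = pp n g" by (metis imageE)
  then obtain c where c: "c \<noteq> 0" "\<forall>i\<le>n. f i = c * g i" using pp_eq_iff spacelike_subset_nz by blast
  have "f 0 = c * g 0" "f 1 = c * g 1" using c n by auto
  then have "Im (cnj (f 0) * f 1) = (norm c)\<^sup>2 * Im (cnj (g 0) * g 1)" by (simp only: Im_cnj_scale)
  moreover have "Im (cnj (f 0) * f 1) > 0" "Im (cnj (g 0) * g 1) < 0" using fg by (simp_all add: spacelike_def)
  ultimately show False using mult_nonneg_nonpos[of "(norm c)\<^sup>2" "Im (cnj (g 0) * g 1)"] by simp
qed

lemma timelike_spacelike_disjoint:
  assumes n: "2 \<le> n"
  shows "disjnt (pp n ` timelike 2 n) (pp n ` spacelike n \<sigma>)"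
  unfolding disjnt_iff
proof (intro allI notI)
  fix x assume "x \<in> pp n ` timelike 2 n \<and> x \<in> pp n ` spacelike n \<sigma>"
  then obtain f g where fg: "f \<in> timelike 2 n" "g \<in> spacelike n \<sigma>" "pp n f = pp n g" by (metis imageE)
  have "f \<in> nz n" using timelike_subset_Om0[OF n] Om0_subset_nz[of 2 n] n fg by auto
  then obtain c where c: "c \<noteq> 0" "\<forall>i\<le>n. f i = c * g i" using pp_eq_iff spacelike_subset_nz fg by blast
  obtain a b :: real where ab: "a\<^sup>2 + b\<^sup>2 < 1" "g n = of_real a * g 0 + of_real b * g 1"
    using fg(2) unfolding spacelike_iff by blast
  have "f n = of_real a * f 0 + of_real b * f 1" using c n ab(2) by (simp add: algebra_simps)
  then have "Re (f n) = a * Re (f 0) + b * Re (f 1)" by simp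
  \<comment> \<open>Lagrange's identity. The coefficients a, b are real and survive rescaling, so
    the real part of every multiple satisfies the same relation.\<close>
  then have "(Re (f n))\<^sup>2 = (a\<^sup>2 + b\<^sup>2) * ((Re (f 0))\<^sup>2 + (Re (f 1))\<^sup>2) - (a * Re (f 1) - b * Re (f 0))\<^sup>2"
    by (simp add: power2_eq_square algebra_simps)
  also have "\<dots> \<le> (a\<^sup>2 + b\<^sup>2) * ((Re (f 0))\<^sup>2 + (Re (f 1))\<^sup>2)" by simp
  also have "\<dots> \<le> 1 * ((Re (f 0))\<^sup>2 + (Re (f 1))\<^sup>2)" using ab by (intro mult_right_mono) auto
  finally show False using fg(1) by (simp add: timelike_def eval_nat_numeral)
qed

text \<open>The union of the other members is open as well, so no connected set can leave a member
  that it meets.\<close>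

lemma connected_components_of_open_partition:
  assumes "\<Union>\<F> = topspace Y" "pairwise disjnt \<F>" "{} \<notin> \<F>"
    and "\<And>S. S \<in> \<F> \<Longrightarrow> openin Y S" "\<And>S. S \<in> \<F> \<Longrightarrow> connectedin Y S"
  shows "connected_components_of Y = \<F>"
proof -
  have comp: "connected_component_of_set Y x = S" if S: "S \<in> \<F>" "x \<in> S" for S x
  proof
    show "S \<subseteq> connected_component_of_set Y x" by (rule connected_component_of_maximal[OF assms(5)[OF S(1)] S(2)])
    show "connected_component_of_set Y x \<subseteq> S"
    proof
      fix y assume "y \<in> connected_component_of_set Y x"
      then obtain C where C: "connectedin Y C" "x \<in> C" "y \<in> C" by (auto simp: connected_component_of_def)
      have op: "openin Y (\<Union>(\<F> - {S}))" using assms(4) by blast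
      have "C \<subseteq> S \<union> \<Union>(\<F> - {S})" using connectedin_subset_topspace[OF C(1)] assms(1) by blast
      moreover have "S \<inter> \<Union>(\<F> - {S}) \<inter> C = {}"
        using assms(2) S(1) by (auto simp: pairwise_def disjnt_iff)
      ultimately have "\<Union>(\<F> - {S}) \<inter> C = {}"
        using C assms(4)[OF S(1)] op S(2) unfolding connectedin by blast
      then show "y \<in> S" using C(3) \<open>C \<subseteq> S \<union> \<Union>(\<F> - {S})\<close> by blast
    qed
  qed
  show ?thesis
    unfolding connected_components_of_def
  proof (intro equalityI subsetI)
    fix S assume "S \<in> connected_component_of_set Y ` topspace Y"
    then obtain x where "x \<in> topspace Y" "S = connected_component_of_set Y x" by blast
    then show "S \<in> \<F>" using comp assms(1) by (metis UnionE)
  next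
    fix S assume S: "S \<in> \<F>"
    then obtain x where "x \<in> S" using assms(3) by (metis ex_in_conv)
    then show "S \<in> connected_component_of_set Y ` topspace Y" using comp[OF S] S assms(1) by blast
  qed
qed

lemma card_components_Om0_plane:
  assumes n: "2 \<le> n"
  shows "card (connected_components_of (subtopology (proj_space n) (pp n ` Om0 2 n))) = 3"
proof -
  let ?T = "pp n ` timelike 2 n" and ?P = "pp n ` spacelike n 1" and ?N = "pp n ` spacelike n (- 1)"
  let ?Y = "subtopology (proj_space n) (pp n ` Om0 2 n)"
  have nzT: "timelike 2 n \<subseteq> nz n" using timelike_subset_Om0[OF n] Om0_subset_nz[of 2 n] n by auto
  have op: "openin (proj_space n) ?T" "openin (proj_space n) (pp n ` spacelike n \<sigma>)" for \<sigma>
    using openin_pp_image[OF open_timelike, of n 2 n] openin_pp_image[OF open_spacelike, of n n \<sigma>] nzT spacelike_subset_nz[of n \<sigma>]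
    by (simp_all add: Int_absorb2)
  have ne: "?T \<noteq> {}" "?P \<noteq> {}" "?N \<noteq> {}"
  proof -
    have "(\<lambda>i. if i = n then 1 else 0) \<in> timelike 2 n" using n by (simp add: timelike_def eval_nat_numeral)
    then show "?T \<noteq> {}" by blast
    have "(\<lambda>i. if i = 0 then 1 else if i = 1 then \<i> else 0) \<in> spacelike n 1" using n by (simp add: spacelike_def)
    then show "?P \<noteq> {}" by blast
    have "(\<lambda>i. if i = 0 then 1 else if i = 1 then - \<i> else 0) \<in> spacelike n (- 1)" using n by (simp add: spacelike_def)
    then show "?N \<noteq> {}" by blast
  qed
  have dj: "disjnt ?T ?P" "disjnt ?T ?N" "disjnt ?P ?N"
    using timelike_spacelike_disjoint[OF n] spacelike_disjoint[OF n] by blast+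
  have "connected_components_of ?Y = {?T, ?P, ?N}"
  proof (rule connected_components_of_open_partition)
    have "?T \<union> (?P \<union> ?N) \<subseteq> topspace (proj_space n)" using op openin_subset by blast
    then show "\<Union>{?T, ?P, ?N} = topspace ?Y" unfolding Om0_plane[OF n] by auto
    show "pairwise disjnt {?T, ?P, ?N}"
      using dj disjnt_sym by (auto simp: pairwise_def)
    show "{} \<notin> {?T, ?P, ?N}" using ne by auto
  next
    fix S assume S: "S \<in> {?T, ?P, ?N}"
    then have sub: "S \<subseteq> pp n ` Om0 2 n" unfolding Om0_plane[OF n] by blast
    have "openin (proj_space n) S" using S op by blast
    then show "openin ?Y S" using sub by (auto simp: openin_subtopology)
    have "connectedin (proj_space n) S"
      using S connected_pp_timelike[of 2 n] connected_pp_spacelike[OF n] n by auto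
    then show "connectedin ?Y S" using sub by (simp add: connectedin_subtopology)
  qed
  moreover have "card {?T, ?P, ?N} = 3"
  proof -
    have "?T \<noteq> ?P" "?T \<noteq> ?N" "?P \<noteq> ?N" using dj ne by (metis disjnt_self_iff_empty)+
    then show ?thesis by simp
  qed
  ultimately show ?thesis by simp
qed

theorem theorem1p3:
  fixes m n :: nat and \<Gamma> :: "real mat set" and Omega :: "complex vec set set"
  assumes "2 \<le> m" and "m \<le> n"
    and "subgroup \<Gamma> (SO_plus m)"
    and "discrete_matrices (m + 1) \<Gamma>"
    and "limit_set m \<Gamma> = sphere_at_infinity m"
    and "Omega = kulkarni_region (proj_space n) (iota m n ` \<Gamma>) proj_act"
  shows "(m = 2 \<longrightarrow> card (connected_components_of (subtopology (proj_space n) Omega)) = 3) \<and>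
         (m > 2 \<longrightarrow> connected_space (subtopology (proj_space n) Omega))"
proof -
  interpret kulkarni_setup m \<Gamma> n
    by (intro kulkarni_setup.intro full_lorentz_lattice.intro lorentz_lattice.intro
        kulkarni_setup_axioms.intro full_lorentz_lattice_axioms.intro assms)
  have "card (connected_components_of (subtopology X Omega)) = 3" if "m = 2"
  proof -
    interpret kulkarni_plane m \<Gamma> n by unfold_locales (rule that)
    show ?thesis
      using card_components_Om0_plane[OF n2] region_eq assms(6) that by simp
  qed
  then show ?thesis using connected_region assms(6) by blast
qed

end
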